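(* Let $$c=\frac{\sqrt{a_0^2+a_0\sum_{j\in\mathbb{Z}^d\setminus\{0\}}a_j}-a_0}{\sum_{j\in\mathbb{Z}^d\setminus\{0\}}a_j}.$$ If $\lambda<\frac{2}{3}\,\frac{1+c}{\sum_{j\in\mathbb{Z}^d}a_j}$, then $\mathbb{E}[x_{0;\infty}(0)^2]<\infty$.
   Context: $\mathbb{N}=\{0,1,2,\dots\}$. Fix $d\ge 1$, $\lambda>0$ and an interference sequence $\{a_i\}_{i\in\mathbb{Z}^d}$, meaning: $a_i\ge 0$ and $a_i=a_{-i}$ for all $i$, $a_0>0$, $a_i>0$ for at least one $i\ne 0$, and $\{i:a_i>0\}$ is finite. Dynamics. Let $(\mathcal{A}_i,\mathcal{D}_i)_{i\in\mathbb{Z}^d}$ be mutually independent, with $\mathcal{A}_i$ a Poisson point process of intensity $\lambda$ on $\mathbb{R}$ and $\mathcal{D}_i$ a Poisson point process of intensity $1$ on $\mathbb{R}\times[0,1/a_0]$. The state is $\{x_i(t)\}_{i\in\mathbb{Z}^d}\in\mathbb{N}^{\mathbb{Z}^d}$. At each atom of $\mathcal{A}_i$ a customer is added to queue $i$. At each atom $(D,U)$ of $\mathcal{D}_i$ a customer (if any) is removed from queue $i$ if and only if $U\le \frac{x_i(D^-)}{\sum_{j}a_jx_{i-j}(D^-)}$. Thus, given the state at time $t$, the departure rate from queue $i$ is $\frac{x_i(t)}{\sum_{j\in\mathbb{Z}^d}a_jx_{i-j}(t)}$, with $0/0=0$. Almost surely these rules determine a unique process with right-continuous, piecewise constant coordinates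 from any initial condition in $\mathbb{N}^{\mathbb{Z}^d}$ at any starting time. For $T\ge 0$ and $s\ge -T$, let $\{x_{i;T}(s)\}_{i}$ be the state at time $s$ when the system is started at time $-T$ with all queues empty. Almost surely $x_{i;T}(s)$ is non-decreasing in $T$; set $x_{i;\infty}(s)=\lim_{T\to\infty}x_{i;T}(s)\in\mathbb{N}\cup\{\infty\}$ (the minimal stationary solution). *)

theory Defs
  imports "HOL-Probability.Probability"
begin

text \<open>
  The lattice of dimension \<open>d \<ge> 1\<close> is the type \<^typ>\<open>int ^ 'd\<close> with \<open>d = CARD('d)\<close>.
\<close>

definition interference_sequence :: "(int ^ 'd::finite \<Rightarrow> real) \<Rightarrow> bool" where
  "interference_sequence a \<longleftrightarrow>
     (\<forall>i. 0 \<le> a i \<and> a i = a (- i)) \<and> 0 < a 0 \<and> (\<exists>i. i \<noteq> 0 \<and> 0 < a i) \<and> finite {i. 0 < a i}"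

text \<open>
  A homogeneous Poisson point process of intensity \<open>r\<close> (per unit of Lebesgue measure) on the
  region \<open>S\<close>, as a random locally finite set. Representing configurations by sets is no
  restriction, since a Poisson process with a diffuse intensity measure is almost surely simple.
  All the sets \<open>B\<close> below are bounded, so that \<^const>\<open>card\<close> is the true number of points.
\<close>

definition poisson_point_process ::
    "'w measure \<Rightarrow> real \<Rightarrow> 'b::euclidean_space set \<Rightarrow> ('w \<Rightarrow> 'b set) \<Rightarrow> bool" where
  "poisson_point_process M r S N \<longleftrightarrow>
     (\<forall>\<omega>\<in>space M. N \<omega> \<subseteq> S \<and> (\<forall>B. bounded B \<longrightarrow> finite (N \<omega> \<inter> B))) \<and>
     (\<forall>B. B \<in> sets borel \<and> bounded B \<and> B \<subseteq> S \<longrightarrow>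
        (\<lambda>\<omega>. card (N \<omega> \<inter> B)) \<in> measurable M (count_space UNIV) \<and>
        (\<forall>k. measure M {\<omega> \<in> space M. card (N \<omega> \<inter> B) = k}
               = exp (- (r * measure lborel B)) * (r * measure lborel B) ^ k / fact k)) \<and>
     (\<forall>\<B>. finite \<B> \<and> disjoint \<B> \<and> (\<forall>B\<in>\<B>. B \<in> sets borel \<and> bounded B \<and> B \<subseteq> S) \<longrightarrow>
        prob_space.indep_vars M (\<lambda>_. count_space UNIV) (\<lambda>B \<omega>. card (N \<omega> \<inter> B)) \<B>)"

text \<open>The \<open>\<sigma>\<close>-algebra on the sample space generated by a point process.\<close>

definition point_process_events ::
    "'w measure \<Rightarrow> 'b::euclidean_space set \<Rightarrow> ('w \<Rightarrow> 'b set) \<Rightarrow> 'w set set" where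
  "point_process_events M S N =
     sigma_sets (space M)
       {{\<omega> \<in> space M. card (N \<omega> \<inter> B) = k} | B k. B \<in> sets borel \<and> bounded B \<and> B \<subseteq> S}"

definition driving_processes ::
    "'w measure \<Rightarrow> real \<Rightarrow> real \<Rightarrow> (int ^ 'd::finite \<Rightarrow> 'w \<Rightarrow> real set)
       \<Rightarrow> (int ^ 'd \<Rightarrow> 'w \<Rightarrow> (real \<times> real) set) \<Rightarrow> bool" where
  "driving_processes M lam a0 A D \<longleftrightarrow>
     (\<forall>i. poisson_point_process M lam UNIV (A i)) \<and>
     (\<forall>i. poisson_point_process M 1 (UNIV \<times> {0..1 / a0}) (D i)) \<and>
     prob_space.indep_sets M
       (case_sum (\<lambda>i. point_process_events M UNIV (A i))
                 (\<lambda>i. point_process_events M (UNIV \<times> {0..1 / a0}) (D i)))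
       UNIV"

definition departure_ratio ::
    "(int ^ 'd::finite \<Rightarrow> real) \<Rightarrow> (int ^ 'd \<Rightarrow> nat) \<Rightarrow> int ^ 'd \<Rightarrow> real" where
  "departure_ratio a y i = real (y i) / (\<Sum>j | 0 < a j. a j * real (y (i - j)))"

text \<open>
  The path \<open>x\<close> (time, then site) starts at time \<open>t0\<close> in state \<open>x0\<close> and evolves on
  \<open>[t0, \<infinity>)\<close> by the rules driven by the realizations \<open>A\<close>, \<open>D\<close>; its values before \<open>t0\<close> are
  irrelevant. Here \<open>y\<close> is the state just before time \<open>t\<close>. As \<^typ>\<open>nat\<close> carries the discrete
  topology, right-continuity with left limits says that each coordinate is piecewise constant,
  with finitely many jumps in bounded time intervals. Almost surely all atoms (over all sites, of
  both kinds) have distinct times, so at most one of the two kinds of event occurs at each \<open>t\<close>.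
\<close>

definition queue_evolution ::
    "(int ^ 'd::finite \<Rightarrow> real) \<Rightarrow> (int ^ 'd \<Rightarrow> real set) \<Rightarrow> (int ^ 'd \<Rightarrow> (real \<times> real) set)
       \<Rightarrow> real \<Rightarrow> (int ^ 'd \<Rightarrow> nat) \<Rightarrow> (real \<Rightarrow> int ^ 'd \<Rightarrow> nat) \<Rightarrow> bool" where
  "queue_evolution a A D t0 x0 x \<longleftrightarrow>
     x t0 = x0 \<and>
     (\<forall>t\<ge>t0. \<forall>i. ((\<lambda>s. x s i) \<longlongrightarrow> x t i) (at_right t)) \<and>
     (\<forall>t>t0. \<exists>y. (\<forall>i. ((\<lambda>s. x s i) \<longlongrightarrow> y i) (at_left t)) \<and>
        (\<forall>i. x t i =
           y i + (if t \<in> A i then 1 else 0)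
               - (if 0 < y i \<and> (\<exists>u. (t, u) \<in> D i \<and> u \<le> departure_ratio a y i) then 1 else 0)))"

text \<open>
  For a family \<open>x\<close> where \<open>x T\<close> is the path started empty at time \<open>-T\<close>: the limiting value at
  time \<open>s\<close> and site \<open>i\<close> as \<open>T\<close> tends to infinity.
\<close>

definition limit_state ::
    "(real \<Rightarrow> real \<Rightarrow> int ^ 'd::finite \<Rightarrow> nat) \<Rightarrow> real \<Rightarrow> int ^ 'd \<Rightarrow> enat" where
  "limit_state x s i = Lim at_top (\<lambda>T. enat (x T s i))"

end

theory Submission
  imports Defs
begin

text \<open>
  The hypothesis implies \<open>lam * s < 1\<close> with \<open>s = (\<Sum>j | 0 < a j. a j)\<close>, and this suffices. Let \<open>S i\<close> be
  the denominator of the departure rate of queue \<open>i\<close>. For the system restricted to a finite box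
  (empty outside) and weights \<open>w\<close> that decay slowly and exponentially in space, the generator
  applied to \<open>\<Sum>i. w i * (y i)\<^sup>2 * S i\<close> is at most \<open>- \<epsilon> * (\<Sum>i. w i * (y i)\<^sup>2) + C * (\<Sum>i. w i)\<close>, because
  \<open>(S i)\<^sup>2\<close> is at most about \<open>s * (\<Sum>k. a (i - k) * (y k)\<^sup>2)\<close>. Since the dynamics is monotone, this bounds
  the second moment at the origin uniformly in the time and in the box.

  To make this rigorous, time is cut into cells of length \<open>h\<close>, and the box system is replaced by a
  Markov chain that reacts to the cells containing exactly one atom. For a large box and a small \<open>h\<close>
  this chain agrees at the origin with any solution of the infinite system with probability close
  to one: influence travels backwards in time only along atoms of the departure processes, so it
  rarely comes from outside the box. The same argument shows that solutions started empty are almost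
  surely monotone in the starting time, so that Borel-Cantelli and Fatou's lemma give the claim.
\<close>

section \<open>The generator on a finite box\<close>

text \<open>Write \<open>S\<close> for the load. A departure rate \<open>y i / S i\<close> has
  degree 0, so a quadratic function would have a drift of degree 1 only. For the cubic function
  \<open>S i\<close> cancels and departures yield \<open>- 2 * (y i)^2\<close>; moreover they
  relieve the loads of neighbours. With \<open>G\<close> the sum of the \<open>(y i)^2\<close>,
  \<open>H\<close> the sum of the \<open>y i * S i\<close>, and weights ignored, the leading terms
  are at most \<open>(lam * s - 2) * G + (2 * lam - 1 / s) * H\<close>. Since
  \<open>0 \<le> H \<le> s * G\<close>, this is bounded by the larger of
  \<open>(lam * s - 2) * G\<close> and \<open>3 * (lam * s - 1) * G\<close>, which is why
  \<open>lam * s < 1\<close> is enough. Without weights the bound would grow with the number of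
  sites of the box; summable weights remove this. They must vary slowly, since moving a weight
  between interacting sites costs a factor that the slack \<open>1 - lam * s\<close> has to pay.
  Discrete time replaces the theory of jump processes by powers of one operator, and reduces all
  randomness to counts of atoms, the only thing the Poisson definition speaks about. The price is
  the probability that two atoms share a cell.\<close>

locale weighted_kernel =
  fixes B :: "'i set" and b :: "'i \<Rightarrow> 'i \<Rightarrow> real" and a0 lam s :: real
  assumes finite_B: "finite B"
    and b_sym: "b i k = b k i"
    and b_nonneg: "0 \<le> b i k"
    and b_diag: "b i i = a0"
    and a0_pos: "0 < a0"
    and lam_pos: "0 < lam"
    and row_sum: "i \<in> B \<Longrightarrow> (\<Sum>k\<in>B. b i k) \<le> s"
begin

definition load :: "('i \<Rightarrow> nat) \<Rightarrow> 'i \<Rightarrow> real" where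
  "load y i = (\<Sum>k\<in>B. b i k * real (y k))"

definition rate :: "('i \<Rightarrow> nat) \<Rightarrow> 'i \<Rightarrow> real" where
  "rate y i = real (y i) / load y i"

definition gen :: "(('i \<Rightarrow> nat) \<Rightarrow> real) \<Rightarrow> ('i \<Rightarrow> nat) \<Rightarrow> real" where
  "gen f y = (\<Sum>i\<in>B. lam * (f (y(i := y i + 1)) - f y) + rate y i * (f (y(i := y i - 1)) - f y))"

text \<open>One step of a chain in which site \<open>i\<close> gains a customer with probability
  \<open>p * lam\<close> and loses one with probability \<open>p * rate y i\<close>, all these
  events being disjoint.\<close>

definition trans_op :: "real \<Rightarrow> (('i \<Rightarrow> nat) \<Rightarrow> real) \<Rightarrow> ('i \<Rightarrow> nat) \<Rightarrow> real" where
  "trans_op p f y = f y + p * gen f y"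

text \<open>Intensity of all driving atoms of the box: per site \<open>lam\<close> for arrivals and
  \<open>1 / a0\<close>, the length of the mark interval, for potential departures.\<close>

definition total_rate :: real where
  "total_rate = real (card B) * (lam + 1 / a0)"

lemma load_nonneg: "0 \<le> load y i"
  unfolding load_def by (intro sum_nonneg mult_nonneg_nonneg b_nonneg) auto

lemma load_ge: "i \<in> B \<Longrightarrow> a0 * real (y i) \<le> load y i"
  unfolding load_def using member_le_sum[of i B "\<lambda>k. b i k * real (y k)"]
  by (simp add: finite_B b_nonneg b_diag)

lemma load_mono: "y \<le> z \<Longrightarrow> load y i \<le> load z i"
  unfolding load_def by (intro sum_mono mult_left_mono b_nonneg) (simp add: le_fun_def)

lemma rate_nonneg: "0 \<le> rate y i"
  unfolding rate_def by (simp add: load_nonneg)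

lemma load_pos: "i \<in> B \<Longrightarrow> 0 < y i \<Longrightarrow> 0 < load y i"
  using load_ge[of i y] a0_pos by (smt (verit) mult_pos_pos of_nat_0_less_iff)

lemma rate_le: "i \<in> B \<Longrightarrow> rate y i \<le> 1 / a0"
proof (cases "y i = 0")
  case False
  assume "i \<in> B"
  with False have "0 < load y i" "a0 * real (y i) \<le> load y i"
    using load_pos load_ge by auto
  then show ?thesis using a0_pos by (simp add: rate_def divide_simps mult.commute)
qed (use a0_pos in \<open>simp add: rate_def\<close>)

lemma rate_antimono:
  assumes "i \<in> B" "y \<le> z" "y i = z i"
  shows "rate z i \<le> rate y i"
proof (cases "y i = 0")
  case False
  then show ?thesis unfolding rate_def assms(3)
    using load_mono[OF assms(2), of i] load_pos[OF assms(1), of y] assms(3)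
    by (intro divide_left_mono) (auto intro!: mult_pos_pos)
qed (use assms in \<open>simp add: rate_def\<close>)

text \<open>Rejected departure marks are kept as moves that leave the state alone, with weight
  \<open>1 / a0 - rate y i\<close>. All weights are then nonnegative once
  \<open>p * total_rate \<le> 1\<close>, and the total weight at a site does not depend on the
  state, so two states can be compared term by term.\<close>

lemma trans_op_alt:
  "trans_op p f y = (1 - p * total_rate) * f y
     + p * (\<Sum>i\<in>B. lam * f (y(i := y i + 1))
              + (rate y i * f (y(i := y i - 1)) + (1 / a0 - rate y i) * f y))"
proof -
  have "gen f y = (\<Sum>i\<in>B. (lam * f (y(i := y i + 1))
              + (rate y i * f (y(i := y i - 1)) + (1 / a0 - rate y i) * f y)) - (lam + 1 / a0) * f y)"
    unfolding gen_def by (intro sum.cong) (auto simp: algebra_simps)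
  also have "\<dots> = (\<Sum>i\<in>B. (lam * f (y(i := y i + 1))
              + (rate y i * f (y(i := y i - 1)) + (1 / a0 - rate y i) * f y))) - total_rate * f y"
    by (simp only: sum_subtractf total_rate_def sum_constant mult.assoc)
  finally have "gen f y + total_rate * f y = (\<Sum>i\<in>B. lam * f (y(i := y i + 1))
              + (rate y i * f (y(i := y i - 1)) + (1 / a0 - rate y i) * f y))" by simp
  then have "p * (gen f y + total_rate * f y) = p * (\<Sum>i\<in>B. lam * f (y(i := y i + 1))
              + (rate y i * f (y(i := y i - 1)) + (1 / a0 - rate y i) * f y))" by (rule arg_cong)
  then show ?thesis unfolding trans_op_def by (simp only: algebra_simps)
qed

lemma gen_add: "gen (\<lambda>z. f z + g z) y = gen f y + gen g y"
  unfolding gen_def by (simp add: sum.distrib[symmetric] algebra_simps)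

lemma gen_cmult: "gen (\<lambda>z. c * f z) y = c * gen f y"
  unfolding gen_def by (simp add: sum_distrib_left algebra_simps)

lemma gen_const: "gen (\<lambda>_. c) y = 0"
  unfolding gen_def by simp

lemma trans_op_affine:
  "trans_op p (\<lambda>z. f z + c * g z + d) y = trans_op p f y + c * trans_op p g y + d"
  unfolding trans_op_def gen_add gen_cmult gen_const by (simp add: algebra_simps)

section \<open>Positivity and monotonicity of the one-step operator\<close>

context
  fixes p :: real
  assumes p_nonneg: "0 \<le> p" and p_le: "p * total_rate \<le> 1"
begin

lemma trans_op_le:
  assumes "\<And>z. f z \<le> g z"
  shows "trans_op p f y \<le> trans_op p g y"
  unfolding trans_op_alt using p_nonneg p_le lam_pos rate_nonneg rate_le assms
  by (intro add_mono mult_left_mono sum_mono) auto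

text \<open>Attractiveness, checked site by site. Where \<open>y i = z i\<close>, the larger state
  has the larger load, hence the smaller departure rate. Where \<open>y i < z i\<close>, even a
  departure in \<open>z\<close> alone preserves the order, so both sides can be compared with
  \<open>f y\<close>.\<close>

lemma trans_op_mono:
  assumes "mono f"
  shows "mono (trans_op p f)"
proof (rule monoI)
  fix y z :: "'i \<Rightarrow> nat" assume yz: "y \<le> z"
  have *: "rate y i * f (y(i := y i - 1)) + (1 / a0 - rate y i) * f y
     \<le> rate z i * f (z(i := z i - 1)) + (1 / a0 - rate z i) * f z" if i: "i \<in> B" for i
  proof (cases "y i = z i")
    case True
    have r: "rate z i \<le> rate y i" using rate_antimono i yz True by blast
    have 1: "f (y(i := y i - 1)) \<le> f (z(i := z i - 1))"
      using True yz by (intro monoD[OF assms]) (auto simp: le_fun_def)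
    have 2: "f (y(i := y i - 1)) \<le> f y" by (intro monoD[OF assms]) (auto simp: le_fun_def)
    have 3: "f y \<le> f z" by (intro monoD[OF assms] yz)
    have "rate y i * f (y(i := y i - 1)) + (1 / a0 - rate y i) * f y
      = rate z i * f (y(i := y i - 1)) + (1 / a0 - rate z i) * f y
        - (rate y i - rate z i) * (f y - f (y(i := y i - 1)))"
      by (simp add: algebra_simps)
    also have "\<dots> \<le> rate z i * f (y(i := y i - 1)) + (1 / a0 - rate z i) * f y"
      using r 2 by simp
    also have "\<dots> \<le> rate z i * f (z(i := z i - 1)) + (1 / a0 - rate z i) * f z"
      using 1 3 rate_nonneg rate_le[OF i] by (intro add_mono mult_left_mono) auto
    finally show ?thesis .
  next
    case False
    with yz have lt: "y i < z i" by (simp add: le_fun_def order_le_neq_trans)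
    have 1: "f (y(i := y i - 1)) \<le> f y" by (intro monoD[OF assms]) (auto simp: le_fun_def)
    have 2: "f y \<le> f (z(i := z i - 1))"
      using lt yz by (intro monoD[OF assms]) (auto simp: le_fun_def)
    have 3: "f (z(i := z i - 1)) \<le> f z" by (intro monoD[OF assms]) (auto simp: le_fun_def)
    have "rate y i * f (y(i := y i - 1)) + (1 / a0 - rate y i) * f y
       \<le> rate y i * f y + (1 / a0 - rate y i) * f y"
      using 1 rate_nonneg by (intro add_right_mono mult_left_mono)
    also have "\<dots> = rate z i * f y + (1 / a0 - rate z i) * f y" by (simp add: algebra_simps)
    also have "\<dots> \<le> rate z i * f (z(i := z i - 1)) + (1 / a0 - rate z i) * f z"
      using 2 3 rate_nonneg rate_le[OF i] by (intro add_mono mult_left_mono) auto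
    finally show ?thesis .
  qed
  show "trans_op p f y \<le> trans_op p f z"
    unfolding trans_op_alt
  proof (rule add_mono)
    show "(1 - p * total_rate) * f y \<le> (1 - p * total_rate) * f z"
      using p_le yz by (intro mult_left_mono monoD[OF assms]) auto
    show "p * (\<Sum>i\<in>B. lam * f (y(i := y i + 1))
              + (rate y i * f (y(i := y i - 1)) + (1 / a0 - rate y i) * f y))
      \<le> p * (\<Sum>i\<in>B. lam * f (z(i := z i + 1))
              + (rate z i * f (z(i := z i - 1)) + (1 / a0 - rate z i) * f z))"
    proof (rule mult_left_mono[OF sum_mono p_nonneg], rule add_mono[OF _ *])
      show "lam * f (y(i := y i + 1)) \<le> lam * f (z(i := z i + 1))" for i
        using lam_pos yz by (intro mult_left_mono monoD[OF assms]) (auto simp: le_fun_def)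
    qed
  qed
qed

text \<open>The operator is positive and, by \<open>trans_op_affine\<close>, respects affine
  combinations exactly. So a one-step drift inequality survives iteration even with the negative
  \<open>c\<close> that \<open>Foster_bound\<close> inserts.\<close>

lemma trans_op_pow_le:
  assumes "\<And>z. f z \<le> g z + c * h z + d"
  shows "(trans_op p ^^ k) f y \<le> (trans_op p ^^ k) g y + c * (trans_op p ^^ k) h y + d"
proof (induction k arbitrary: y)
  case (Suc k)
  have "trans_op p ((trans_op p ^^ k) f) y
      \<le> trans_op p (\<lambda>z. (trans_op p ^^ k) g z + c * (trans_op p ^^ k) h z + d) y"
    by (intro trans_op_le Suc.IH)
  then show ?case by (simp add: trans_op_affine)
qed (use assms in simp)

lemma trans_op_pow_nonneg:
  assumes "\<And>z. 0 \<le> f z"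
  shows "0 \<le> (trans_op p ^^ k) f y"
proof (induction k arbitrary: y)
  case (Suc k)
  have "trans_op p (\<lambda>_. 0) y \<le> trans_op p ((trans_op p ^^ k) f) y"
    by (intro trans_op_le Suc.IH)
  then show ?case by (simp add: trans_op_def[of p "\<lambda>_. 0"] gen_const)
qed (use assms in simp)

lemma trans_op_pow_mono: "mono f \<Longrightarrow> mono ((trans_op p ^^ k) f)"
  by (induction k) (auto intro: trans_op_mono)

text \<open>In the empty state \<open>rate\<close> is 0 and only arrivals happen, so one additional
  initial step cannot lower the expectation of a monotone function.\<close>

lemma trans_op_pow_empty_incseq:
  assumes "mono f"
  shows "incseq (\<lambda>k. (trans_op p ^^ k) f (\<lambda>_. 0))"
proof (rule incseq_SucI)
  fix k
  let ?g = "(trans_op p ^^ k) f"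
  have "?g (\<lambda>_. 0) \<le> ?g ((\<lambda>_. 0)(i := (0::nat) + 1))" for i
    by (intro monoD[OF trans_op_pow_mono[OF assms]]) (auto simp: le_fun_def)
  then have "0 \<le> gen ?g (\<lambda>_. 0)"
    unfolding gen_def using lam_pos by (intro sum_nonneg) (auto simp: rate_def)
  then show "?g (\<lambda>_. 0) \<le> (trans_op p ^^ Suc k) f (\<lambda>_. 0)"
    using p_nonneg by (simp add: trans_op_def)
qed

text \<open>The drift condition only bounds time averages; started from the empty state, however, the
  expectations of an increasing function increase with time, so that the average over
  \<open>{k..<2*k}\<close> dominates the value at \<open>k\<close>.\<close>

lemma Foster_bound:
  assumes G: "mono G" "G (\<lambda>_. 0) = 0" and F: "\<And>z. 0 \<le> F z" "F (\<lambda>_. 0) = 0"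
    and drift: "\<And>y. gen F y \<le> - e * G y + C"
    and e: "0 < e" and C: "0 \<le> C" and p: "0 < p"
  shows "(trans_op p ^^ k) G (\<lambda>_. 0) \<le> 2 * C / e"
proof -
  define g where "g k = (trans_op p ^^ k) G (\<lambda>_. 0)" for k
  define v where "v k = (trans_op p ^^ k) F (\<lambda>_. 0)" for k
  have step: "v (Suc j) \<le> v j - p * e * g j + p * C" for j
  proof -
    have "trans_op p F z \<le> F z + (- (p * e)) * G z + p * C" for z
      using mult_left_mono[OF drift[of z] p_nonneg] by (simp add: trans_op_def algebra_simps)
    from trans_op_pow_le[of "trans_op p F" F "- (p * e)" G "p * C", OF this, of j "\<lambda>_. 0"]
    show ?thesis unfolding v_def g_def by (simp add: funpow_swap1)
  qed
  have tele: "p * e * (\<Sum>j<N. g j) \<le> real N * (p * C) - v N" for N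
  proof (induction N)
    case (Suc N)
    then show ?case using step[of N] by (simp add: algebra_simps)
  qed (simp add: v_def F)
  have g_mono: "incseq g" unfolding g_def by (rule trans_op_pow_empty_incseq[OF G(1)])
  have g0: "g 0 = 0" by (simp add: g_def G)
  show ?thesis
  proof (cases "k = 0")
    case False
    have nn: "0 \<le> g j" for j using incseqD[OF g_mono, of 0 j] g0 by simp
    have "real k * g k = (\<Sum>j\<in>{k..<2*k}. g k)" by simp
    also have "\<dots> \<le> (\<Sum>j\<in>{k..<2*k}. g j)" by (intro sum_mono incseqD[OF g_mono]) simp
    also have "\<dots> \<le> (\<Sum>j<2*k. g j)" by (intro sum_mono2) (auto simp: nn)
    finally have "p * e * (real k * g k) \<le> p * e * (\<Sum>j<2*k. g j)"
      using p e by (intro mult_left_mono) auto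
    also have "\<dots> \<le> real (2 * k) * (p * C)"
      using tele[of "2*k"] trans_op_pow_nonneg[of F "2*k" "\<lambda>_. 0"] F(1) by (simp add: v_def)
    \<comment> \<open>The factor \<open>p * k\<close> cancels. The bound sees neither the number of
      steps nor the step size, hence is uniform in time and mesh.\<close>
    finally have "(p * real k) * (e * g k) \<le> (p * real k) * (2 * C)" by (simp add: algebra_simps)
    then have "e * g k \<le> 2 * C" using p False by (subst (asm) mult_le_cancel_left_pos) auto
    then show ?thesis using e by (simp add: g_def field_simps)
  qed (use C e g0 in \<open>simp add: g_def\<close>)
qed

end

end

section \<open>The cubic Lyapunov function and its drift\<close>

locale lyapunov = weighted_kernel +
  fixes w :: "'a \<Rightarrow> real" and q :: real
  assumes w_pos: "0 < w i"
    and w_ratio: "0 < b i k \<Longrightarrow> w i \<le> q * w k"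
    and subcritical: "lam * s < 1"
    and s_pos: "0 < s"
    and q_def: "q = 1 + (1 - lam * s) / 2"
begin

definition cubic :: "('a \<Rightarrow> nat) \<Rightarrow> real" where
  "cubic y = (\<Sum>k\<in>B. w k * (real (y k))\<^sup>2 * load y k)"

definition energy :: "('a \<Rightarrow> nat) \<Rightarrow> real" where
  "energy y = (\<Sum>k\<in>B. w k * (real (y k))\<^sup>2)"

lemma q_gt_1: "1 < q" using subcritical q_def by simp

lemma w_b: "w i * b i k \<le> q * w k * b i k"
  using w_ratio[of i k] b_nonneg[of i k] by (cases "b i k = 0") (auto intro!: mult_right_mono)

lemma load_upd:
  assumes "i \<in> B" "real (v) = real (y i) + t"
  shows "load (y(i := v)) k = load y k + t * b i k"
proof -
  have "load (y(i := v)) k = (\<Sum>l\<in>B. b k l * real (y l) + (if l = i then t * b i k else 0))"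
    unfolding load_def using assms(2) b_sym[of k i]
    by (intro sum.cong) (auto simp: algebra_simps)
  also have "\<dots> = load y k + t * b i k"
    by (simp add: sum.distrib load_def finite_B assms(1))
  finally show ?thesis .
qed

text \<open>By symmetry of \<open>b\<close>, a change at \<open>i\<close> alters the load of every
  \<open>k\<close> by \<open>t * b i k\<close>; these changes against the old squares form the sum.
  What remains is the change of the square at \<open>i\<close>, where \<open>t^2 = 1\<close>,
  against the new load of \<open>i\<close>.\<close>

lemma cubic_upd:
  assumes i: "i \<in> B" and v: "real v = real (y i) + t" and t: "t = 1 \<or> t = -1"
  shows "cubic (y(i := v)) - cubic y
     = t * (\<Sum>k\<in>B. w k * b i k * (real (y k))\<^sup>2) + w i * (2 * t * real (y i) + 1) * (load y i + t * a0)"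
proof -
  have "cubic (y(i := v)) - cubic y = (\<Sum>k\<in>B. t * (w k * b i k * (real (y k))\<^sup>2)
     + (if k = i then w i * (2 * t * real (y i) + 1) * (load y i + t * a0) else 0))"
    unfolding cubic_def sum_subtractf[symmetric] load_upd[of i v y t, OF i v]
  proof (rule sum.cong[OF refl])
    fix k
    have "w i * (real v)\<^sup>2 * (load y i + t * a0) - w i * (real (y i))\<^sup>2 * load y i
      = t * (w i * a0 * (real (y i))\<^sup>2) + w i * (2 * t * real (y i) + 1) * (load y i + t * a0)"
      using t unfolding v by (auto simp: algebra_simps power2_eq_square)
    then show "w k * (real ((y(i := v)) k))\<^sup>2 * (load y k + t * b i k)
         - w k * (real (y k))\<^sup>2 * load y k
      = t * (w k * b i k * (real (y k))\<^sup>2)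
        + (if k = i then w i * (2 * t * real (y i) + 1) * (load y i + t * a0) else 0)"
      by (auto simp: b_diag algebra_simps)
  qed
  then show ?thesis by (simp add: sum.distrib finite_B i sum_distrib_left)
qed

text \<open>Cauchy-Schwarz; this is the gain from departures at \<open>i\<close> that lower the load of the other sites.\<close>

lemma load_sq_le:
  assumes "i \<in> B"
  shows "w i * (load y i)\<^sup>2 \<le> q * s * (\<Sum>k\<in>B. w k * b i k * (real (y k))\<^sup>2)"
proof -
  have "(load y i)\<^sup>2 = (\<Sum>k\<in>B. sqrt (b i k) * (sqrt (b i k) * real (y k)))\<^sup>2"
    unfolding load_def using b_nonneg by (simp flip: mult.assoc)
  also have "\<dots> \<le> (\<Sum>k\<in>B. (sqrt (b i k))\<^sup>2) * (\<Sum>k\<in>B. (sqrt (b i k) * real (y k))\<^sup>2)"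
    by (rule Cauchy_Schwarz_ineq_sum)
  also have "\<dots> = (\<Sum>k\<in>B. b i k) * (\<Sum>k\<in>B. b i k * (real (y k))\<^sup>2)"
    using b_nonneg by (simp add: power_mult_distrib)
  also have "\<dots> \<le> s * (\<Sum>k\<in>B. b i k * (real (y k))\<^sup>2)"
    using row_sum[OF assms] b_nonneg by (intro mult_right_mono sum_nonneg) auto
  finally have "w i * (load y i)\<^sup>2 \<le> w i * (s * (\<Sum>k\<in>B. b i k * (real (y k))\<^sup>2))"
    using w_pos[of i] by (intro mult_left_mono) auto
  also have "\<dots> = s * (\<Sum>k\<in>B. (w i * b i k) * (real (y k))\<^sup>2)"
    by (simp add: sum_distrib_left algebra_simps)
  also have "\<dots> \<le> s * (\<Sum>k\<in>B. (q * w k * b i k) * (real (y k))\<^sup>2)"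
    using s_pos by (intro mult_left_mono sum_mono mult_right_mono w_b) auto
  finally show ?thesis by (simp add: sum_distrib_left algebra_simps)
qed

text \<open>Summing over \<open>i\<close> first leaves a row sum of \<open>b\<close>. The weight
  already sits at \<open>k\<close>, which is why the coefficient \<open>lam * s - 2\<close> in
  \<open>cubic_drift\<close> carries no \<open>q\<close>.\<close>

lemma sum_wb:
  assumes "\<And>k. 0 \<le> f k"
  shows "(\<Sum>i\<in>B. \<Sum>k\<in>B. w k * b i k * f k) \<le> s * (\<Sum>k\<in>B. w k * f k)"
proof -
  have "(\<Sum>i\<in>B. \<Sum>k\<in>B. w k * b i k * f k) = (\<Sum>k\<in>B. w k * f k * (\<Sum>i\<in>B. b k i))"
    by (subst sum.swap) (simp add: sum_distrib_left algebra_simps b_sym)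
  also have "\<dots> \<le> (\<Sum>k\<in>B. w k * f k * s)"
    using row_sum w_pos assms by (intro sum_mono mult_left_mono) (auto simp: less_imp_le)
  finally show ?thesis by (simp add: sum_distrib_left mult.commute)
qed

lemma sum_w_load: "(\<Sum>i\<in>B. w i * load y i) \<le> q * s * (\<Sum>k\<in>B. w k * real (y k))"
proof -
  have "(\<Sum>i\<in>B. w i * load y i) = (\<Sum>i\<in>B. \<Sum>k\<in>B. (w i * b i k) * real (y k))"
    by (simp add: load_def sum_distrib_left algebra_simps)
  also have "\<dots> \<le> (\<Sum>i\<in>B. \<Sum>k\<in>B. (q * w k * b i k) * real (y k))"
    by (intro sum_mono mult_right_mono w_b) auto
  also have "\<dots> = q * (\<Sum>i\<in>B. \<Sum>k\<in>B. w k * b i k * real (y k))"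
    by (simp add: sum_distrib_left algebra_simps)
  also have "\<dots> \<le> q * (s * (\<Sum>k\<in>B. w k * real (y k)))"
    using q_gt_1 sum_wb[of "\<lambda>k. real (y k)"] by (intro mult_left_mono) auto
  finally show ?thesis by simp
qed

text \<open>The inequality \<open>2 * y i * y k \<le> (y i)^2 + (y k)^2\<close> splits the double
  sum into halves. In one the weight sits at the squared site; in the other it is moved there at
  cost \<open>q\<close>. Hence the mean \<open>(1 + q) / 2\<close>.\<close>

lemma sum_w_y_load: "(\<Sum>i\<in>B. w i * real (y i) * load y i) \<le> s * (1 + q) / 2 * energy y"
proof -
  have "(\<Sum>i\<in>B. w i * real (y i) * load y i)
      = (\<Sum>i\<in>B. \<Sum>k\<in>B. w i * b i k * (real (y i) * real (y k)))"
    by (simp add: load_def sum_distrib_left algebra_simps)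
  also have "\<dots> \<le> (\<Sum>i\<in>B. \<Sum>k\<in>B. w i * b i k * (((real (y i))\<^sup>2 + (real (y k))\<^sup>2) / 2))"
  proof (intro sum_mono mult_left_mono)
    fix i k
    show "real (y i) * real (y k) \<le> ((real (y i))\<^sup>2 + (real (y k))\<^sup>2) / 2"
      using sum_squares_bound[of "real (y i)" "real (y k)"] by simp
    show "0 \<le> w i * b i k" using w_pos[of i] b_nonneg by simp
  qed
  also have "\<dots> = (\<Sum>i\<in>B. \<Sum>k\<in>B. w i * b i k * (real (y i))\<^sup>2) / 2
                 + (\<Sum>i\<in>B. \<Sum>k\<in>B. w i * b i k * (real (y k))\<^sup>2) / 2"
    by (simp add: sum.distrib algebra_simps add_divide_distrib sum_divide_distrib)
  also have "(\<Sum>i\<in>B. \<Sum>k\<in>B. w i * b i k * (real (y i))\<^sup>2)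
       = (\<Sum>i\<in>B. \<Sum>k\<in>B. w k * b i k * (real (y k))\<^sup>2)"
    by (subst sum.swap) (simp add: b_sym)
  also have "(\<Sum>i\<in>B. \<Sum>k\<in>B. w i * b i k * (real (y k))\<^sup>2)
       \<le> (\<Sum>i\<in>B. \<Sum>k\<in>B. (q * w k * b i k) * (real (y k))\<^sup>2)"
    by (intro sum_mono mult_right_mono w_b) auto
  also have "\<dots> = q * (\<Sum>i\<in>B. \<Sum>k\<in>B. w k * b i k * (real (y k))\<^sup>2)"
    by (simp add: sum_distrib_left algebra_simps)
  finally have "(\<Sum>i\<in>B. w i * real (y i) * load y i)
     \<le> (1 + q) / 2 * (\<Sum>i\<in>B. \<Sum>k\<in>B. w k * b i k * (real (y k))\<^sup>2)"
    by (simp add: algebra_simps add_divide_distrib)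
  also have "\<dots> \<le> (1 + q) / 2 * (s * energy y)"
    unfolding energy_def using q_gt_1 sum_wb[of "\<lambda>k. (real (y k))\<^sup>2"]
    by (intro mult_left_mono) auto
  finally show ?thesis by (simp add: algebra_simps)
qed

text \<open>The rate divides by the load. For the relief \<open>V\<close> of all loads,
  \<open>load_sq_le\<close> returns a square of the load, of which one power survives; for the drop
  of the square at \<open>i\<close>, the load in the increment cancels and
  \<open>2 * (y i)^2\<close> is left, up to a linear correction.\<close>

lemma departure_term:
  assumes i: "i \<in> B"
  shows "rate y i * (cubic (y(i := y i - 1)) - cubic y)
     \<le> - (w i * real (y i) * load y i / (q * s)) - 2 * (w i * (real (y i))\<^sup>2) + 3 * (w i * real (y i))"
proof (cases "y i = 0")
  case False
  define n where "n = real (y i)"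
  define S where "S = load y i"
  define V where "V = (\<Sum>k\<in>B. w k * b i k * (real (y k))\<^sup>2)"
  have n: "n \<ge> 1" using False by (simp add: n_def)
  have S: "S > 0" "a0 * n \<le> S" using False load_pos[OF i] load_ge[OF i] by (auto simp: S_def n_def)
  have qs: "q * s > 0" using q_gt_1 s_pos by simp
  have "real (y i - 1) = real (y i) + (-1)" using False by (simp add: of_nat_diff)
  from cubic_upd[of i "y i - 1" y "-1", OF i this] have eq: "cubic (y(i := y i - 1)) - cubic y
      = - V - w i * (2 * n - 1) * (S - a0)"
    by (simp add: V_def n_def S_def algebra_simps)
  have "w i * S\<^sup>2 \<le> q * s * V" using load_sq_le[OF i] by (simp add: S_def V_def)
  then have "n / S * (w i * S\<^sup>2 / (q * s)) \<le> n / S * V"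
    using n S qs by (intro mult_left_mono) (auto simp: divide_simps mult.commute)
  then have 1: "w i * n * S / (q * s) \<le> n / S * V"
    using S by (simp add: power2_eq_square mult_ac)
  have "n * S - 2 * (n * (a0 * n)) \<ge> n * S - 2 * (n * S)"
    using S n by (simp add: mult_left_mono)
  \<comment> \<open>After division by \<open>S\<close>, the correction \<open>a0\<close> to the load
    costs at most \<open>2 * n\<close>, because \<open>a0 * n \<le> S\<close>. Together with the
    \<open>n\<close> lost in \<open>n * (2 * n - 1)\<close> this gives the constant 3.\<close>
  have "(n * (2 * n - 1)) * a0 \<le> (2 * n) * (n * a0)"
    using a0_pos n by (simp add: algebra_simps)
  also have "\<dots> \<le> 2 * n * S" using S n by (intro mult_left_mono) (auto simp: mult.commute)
  finally have "2 * n\<^sup>2 * S - 3 * n * S \<le> n * (2 * n - 1) * (S - a0)"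
    using S by (simp add: algebra_simps power2_eq_square)
  then have "(2 * n\<^sup>2 - 3 * n) * S \<le> n * (2 * n - 1) * (S - a0)"
    by (simp add: algebra_simps)
  then have "2 * n\<^sup>2 - 3 * n \<le> n / S * ((2 * n - 1) * (S - a0))"
    using S by (simp add: pos_le_divide_eq)
  then have "w i * (2 * n\<^sup>2 - 3 * n) \<le> w i * (n / S * ((2 * n - 1) * (S - a0)))"
    using w_pos[of i] by (intro mult_left_mono) auto
  then have 2: "2 * (w i * n\<^sup>2) - 3 * (w i * n) \<le> n / S * (w i * (2 * n - 1) * (S - a0))"
    by (simp only: right_diff_distrib mult_ac)
  have "rate y i * (cubic (y(i := y i - 1)) - cubic y)
       = - (n / S * V) - n / S * (w i * (2 * n - 1) * (S - a0))"
    unfolding eq rate_def by (simp add: n_def S_def algebra_simps)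
  with 1 2 show ?thesis unfolding n_def[symmetric] S_def[symmetric] by simp
qed (simp add: rate_def)

text \<open>Only \<open>G\<close> and \<open>H\<close> have degree 2, and \<open>G\<close> wins
  because \<open>H\<close> is controlled by it. The constant \<open>C1\<close> collects the
  coefficients of the linear term \<open>Y\<close>: \<open>lam * q * s\<close> from the loads,
  \<open>2 * lam * a0\<close> from the growth of the own load at an arrival, and 3 from
  \<open>departure_term\<close>.\<close>

lemma cubic_drift:
  defines "C1 \<equiv> lam * (q * s + 2 * a0) + 3"
  shows "gen cubic y \<le> - ((1 - lam * s) / 2) * energy y
       + (C1\<^sup>2 / (2 * (1 - lam * s)) + lam * a0) * (\<Sum>i\<in>B. w i)"
proof -
  define e where "e = 1 - lam * s"
  define G where "G = energy y"
  define H where "H = (\<Sum>i\<in>B. w i * real (y i) * load y i)"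
  define Y where "Y = (\<Sum>i\<in>B. w i * real (y i))"
  define W where "W = (\<Sum>i\<in>B. w i)"
  have e: "0 < e" "e < 1" using subcritical lam_pos s_pos by (auto simp: e_def)
  have G0: "0 \<le> G" unfolding G_def energy_def using w_pos
    by (intro sum_nonneg) (simp add: less_imp_le)
  have H0: "0 \<le> H" unfolding H_def using w_pos load_nonneg
    by (intro sum_nonneg) (simp add: less_imp_le)
  have "gen cubic y \<le> (\<Sum>i\<in>B. lam * ((\<Sum>k\<in>B. w k * b i k * (real (y k))\<^sup>2)
        + w i * (2 * real (y i) + 1) * (load y i + a0))
     + (- (w i * real (y i) * load y i / (q * s)) - 2 * (w i * (real (y i))\<^sup>2) + 3 * (w i * real (y i))))"
    unfolding gen_def
  proof (intro sum_mono add_mono departure_term)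
    fix i assume i: "i \<in> B"
    have "real (y i + 1) = real (y i) + 1" by simp
    from cubic_upd[of i "y i + 1" y 1, OF i this] show "lam * (cubic (y(i := y i + 1)) - cubic y)
       \<le> lam * ((\<Sum>k\<in>B. w k * b i k * (real (y k))\<^sup>2)
        + w i * (2 * real (y i) + 1) * (load y i + a0))" by simp
  qed
  also have "\<dots> = (\<Sum>i\<in>B. lam * (\<Sum>k\<in>B. w k * b i k * (real (y k))\<^sup>2)
        + 2 * lam * (w i * real (y i) * load y i) + lam * (w i * load y i)
        + 2 * lam * a0 * (w i * real (y i)) + lam * a0 * w i
        - 1 / (q * s) * (w i * real (y i) * load y i) - 2 * (w i * (real (y i))\<^sup>2)
        + 3 * (w i * real (y i)))"
    by (intro sum.cong) (auto simp: algebra_simps)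
  also have "\<dots> = lam * (\<Sum>i\<in>B. \<Sum>k\<in>B. w k * b i k * (real (y k))\<^sup>2)
     + 2 * lam * H + lam * (\<Sum>i\<in>B. w i * load y i) + 2 * lam * a0 * Y + lam * a0 * W
     - 1 / (q * s) * H - 2 * G + 3 * Y"
    by (simp only: sum.distrib sum_subtractf sum_distrib_left[symmetric] H_def Y_def W_def G_def
        energy_def)
  also have "\<dots> \<le> lam * (s * G) + 2 * lam * H + lam * (q * s * Y) + 2 * lam * a0 * Y + lam * a0 * W
     - 1 / (q * s) * H - 2 * G + 3 * Y"
    unfolding G_def energy_def Y_def using sum_wb[of "\<lambda>k. (real (y k))\<^sup>2"] sum_w_load[of y] lam_pos
    by (intro add_right_mono diff_right_mono add_mono order_refl mult_left_mono) auto
  also have "\<dots> = (lam * s - 2) * G + (2 * lam - 1 / (q * s)) * H + C1 * Y + lam * a0 * W"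
    by (simp add: C1_def algebra_simps)
  also have "(lam * s - 2) * G + (2 * lam - 1 / (q * s)) * H \<le> - e * G"
  \<comment> \<open>The sign decides whether \<open>H\<close> is bounded below by 0 or above by
    \<open>sum_w_y_load\<close>. For \<open>q = 1\<close> the second case would give
    \<open>3 * (lam * s - 1) * G\<close>.\<close>
  proof (cases "2 * lam - 1 / (q * s) \<le> 0")
    case True
    then have "(2 * lam - 1 / (q * s)) * H \<le> 0" using H0 by (simp add: mult_nonpos_nonneg)
    moreover have "(lam * s - 2) * G \<le> - e * G" using G0 by (intro mult_right_mono) (auto simp: e_def)
    ultimately show ?thesis by simp
  next
    case False
    have "(2 * lam - 1 / (q * s)) * H \<le> (2 * lam - 1 / (q * s)) * (s * (1 + q) / 2 * G)"
      using False sum_w_y_load[of y] by (intro mult_left_mono) (auto simp: H_def G_def)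
    also have "\<dots> = (2 * (lam * s) - 1 / q) * (1 + q) / 2 * G"
      using s_pos q_gt_1 by (simp add: field_simps)
    finally have 1: "(2 * lam - 1 / (q * s)) * H \<le> (2 * (lam * s) - 1 / q) * (1 + q) / 2 * G" .
    have "(2 * (lam * s) - 1 / q) * (1 + q) / 2
        = (2 * (lam * s) - 1 / q) + (2 * (lam * s) - 1 / q) * ((q - 1) / 2)"
      by (simp only: times_divide_eq_right right_diff_distrib distrib_left mult_1_right
          diff_divide_distrib add_divide_distrib) simp
    also have "\<dots> \<le> (2 * (lam * s) - 1 / q) + 2 * ((q - 1) / 2)"
      using q_gt_1 subcritical
      by (intro add_left_mono mult_right_mono) (auto intro: order_trans[of _ "2 * (lam * s)"])
    also have "\<dots> \<le> 2 * (lam * s) - 1 + 2 * (q - 1)"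
    proof -
      have "0 \<le> (q - 1)\<^sup>2" by simp
      then have "(2 - q) * q \<le> 1" by (simp add: power2_eq_square algebra_simps)
      then have "2 - q \<le> 1 / q" using q_gt_1 by (simp add: pos_le_divide_eq)
      then have "(2 * t - 1 / q) + 2 * ((q - 1) / 2) \<le> 2 * t - 1 + 2 * (q - 1)" for t
        by argo
      then show ?thesis .
    qed
    \<comment> \<open>This is the origin of \<open>q\<close>: \<open>2 * (q - 1)\<close> equals the
      slack \<open>1 - lam * s\<close>, so a margin of \<open>2 * e\<close> survives the tilt of the
      weights.\<close>
    also have "\<dots> = lam * s" by (simp add: q_def field_simps)
    finally have "(2 * (lam * s) - 1 / q) * (1 + q) / 2 * G \<le> lam * s * G"
      using G0 by (intro mult_right_mono)
    with 1 have "(lam * s - 2) * G + (2 * lam - 1 / (q * s)) * H \<le> (lam * s - 2) * G + lam * s * G"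
      by linarith
    also have "\<dots> = - 2 * e * G" by (simp add: e_def algebra_simps)
    also have "\<dots> \<le> - e * G" using e G0 by simp
    finally show ?thesis .
  qed
  \<comment> \<open>Young's inequality: half of the drift absorbs the linear term, at the price of a
    constant per unit of weight.\<close>
  also have "C1 * Y \<le> e / 2 * G + C1\<^sup>2 / (2 * e) * W"
  proof -
    have "C1 * n \<le> e / 2 * n\<^sup>2 + C1\<^sup>2 / (2 * e)" for n :: real
    proof -
      have "0 \<le> (e * n - C1)\<^sup>2 / (2 * e)" using e by simp
      also have "\<dots> = e / 2 * n\<^sup>2 + C1\<^sup>2 / (2 * e) - C1 * n"
        using e by (simp add: field_simps power2_eq_square)
      finally show ?thesis by simp
    qed
    then have "(\<Sum>i\<in>B. w i * (C1 * real (y i)))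
        \<le> (\<Sum>i\<in>B. w i * (e / 2 * (real (y i))\<^sup>2 + C1\<^sup>2 / (2 * e)))"
      using w_pos by (intro sum_mono mult_left_mono) (auto simp: less_imp_le)
    also have "\<dots> = e / 2 * G + C1\<^sup>2 / (2 * e) * W"
      by (simp add: G_def W_def energy_def sum_distrib_left sum_distrib_right sum.distrib algebra_simps
          sum_divide_distrib)
    finally show ?thesis by (simp add: Y_def sum_distrib_left algebra_simps)
  qed
  finally have "gen cubic y \<le> - e * G + (e / 2 * G + C1\<^sup>2 / (2 * e) * W) + lam * a0 * W" by simp
  also have "\<dots> = - (e / 2) * G + (C1\<^sup>2 / (2 * e) + lam * a0) * W" by (simp add: algebra_simps)
  finally show ?thesis by (simp only: e_def G_def W_def)
qed

text \<open>The box enters this bound only through its total weight, which will be bounded uniformly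
  because the weights are summable over the lattice.\<close>

lemma energy_bound:
  assumes "0 < p" "p * total_rate \<le> 1"
  defines "C1 \<equiv> lam * (q * s + 2 * a0) + 3"
  shows "(trans_op p ^^ k) energy (\<lambda>_. 0)
     \<le> 4 * (C1\<^sup>2 / (2 * (1 - lam * s)) + lam * a0) / (1 - lam * s) * (\<Sum>i\<in>B. w i)"
proof -
  let ?e = "(1 - lam * s) / 2" and ?C = "(C1\<^sup>2 / (2 * (1 - lam * s)) + lam * a0) * (\<Sum>i\<in>B. w i)"
  have "(trans_op p ^^ k) energy (\<lambda>_. 0) \<le> 2 * ?C / ?e"
  proof (rule Foster_bound[where F = cubic])
    show "mono energy"
      unfolding energy_def using w_pos
      by (intro monoI sum_mono mult_left_mono power_mono) (auto simp: le_fun_def less_imp_le)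
    show "0 \<le> cubic z" for z
      unfolding cubic_def using w_pos load_nonneg by (intro sum_nonneg) (simp add: less_imp_le)
    show "gen cubic y \<le> - ?e * energy y + ?C" for y
      using cubic_drift[of y] by (simp add: C1_def)
    show "0 \<le> ?C" using w_pos a0_pos lam_pos subcritical
      by (intro mult_nonneg_nonneg add_nonneg_nonneg sum_nonneg) (auto simp: less_imp_le)
  qed (use assms subcritical in \<open>auto simp: energy_def cubic_def\<close>)
  also have "2 * ?C / ?e = 4 * (C1\<^sup>2 / (2 * (1 - lam * s)) + lam * a0) / (1 - lam * s) * (\<Sum>i\<in>B. w i)"
    by simp
  finally show ?thesis .
qed

end

section \<open>Independence of the driving processes over disjoint time sets\<close>

text \<open>The nonempty atoms of the Boolean algebra generated by \<open>\<S>\<close>: for nonempty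
  \<open>P\<close>, \<open>cell P\<close> holds the points for which \<open>P\<close> is precisely
  the set of members of \<open>\<S>\<close> containing them. Poisson counts are independent over
  disjoint sets, whereas events may speak of overlapping ones.\<close>

lemma finite_disjoint_refinement:
  assumes "finite \<S>" "\<S> \<subseteq> sets N"
  obtains \<T> where "finite \<T>" "disjoint \<T>" "{} \<notin> \<T>" "\<T> \<subseteq> sets N" "\<forall>T\<in>\<T>. \<exists>S\<in>\<S>. T \<subseteq> S"
    "\<forall>S\<in>\<S>. S = \<Union>{T\<in>\<T>. T \<subseteq> S}"
proof -
  define cell where "cell P = \<Inter>P - \<Union>(\<S> - P)" for P
  define \<T> where "\<T> = cell ` (Pow \<S> - {{}}) - {{}}"
  show thesis
  proof
    show "finite \<T>" "{} \<notin> \<T>" using assms(1) by (auto simp: \<T>_def)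
    show "disjoint \<T>"
    proof (rule disjointI)
      fix T T' assume "T \<in> \<T>" "T' \<in> \<T>" "T \<noteq> T'"
      then obtain P P' where P: "P \<subseteq> \<S>" "P' \<subseteq> \<S>" "T = cell P" "T' = cell P'" "P \<noteq> P'"
        by (auto simp: \<T>_def)
      then consider S where "S \<in> P" "S \<in> \<S> - P'" | S where "S \<in> P'" "S \<in> \<S> - P" by blast
      then show "T \<inter> T' = {}" unfolding P(3,4) cell_def by cases blast+
    qed
    show "\<T> \<subseteq> sets N"
    proof
      fix T assume "T \<in> \<T>"
      then obtain P where P: "P \<subseteq> \<S>" "P \<noteq> {}" "T = cell P" by (auto simp: \<T>_def)
      have fin: "finite P" "finite (\<S> - P)" using P assms(1) finite_subset by auto
      show "T \<in> sets N" unfolding P(3) cell_def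
        using fin P assms(2) sets.finite_INT[of P "\<lambda>S. S" N]
        by (intro sets.Diff sets.finite_Union) auto
    qed
    show "\<forall>T\<in>\<T>. \<exists>S\<in>\<S>. T \<subseteq> S" unfolding \<T>_def cell_def by blast
    show "\<forall>S\<in>\<S>. S = \<Union>{T\<in>\<T>. T \<subseteq> S}"
    proof (intro ballI equalityI subsetI)
      fix S x assume S: "S \<in> \<S>" and x: "x \<in> S"
      let ?P = "{S'\<in>\<S>. x \<in> S'}"
      have "x \<in> cell ?P" "cell ?P \<subseteq> S" "?P \<in> Pow \<S> - {{}}"
        using S x by (auto simp: cell_def)
      then show "x \<in> \<Union>{T\<in>\<T>. T \<subseteq> S}" by (auto simp: \<T>_def intro!: exI[of _ "cell ?P"])
    qed auto
  qed
qed

text \<open>A finite product of copies of the discrete space \<open>nat\<close> is countable and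
  discrete, so every predicate of the vector of counts defines an event.\<close>

lemma sets_restrict_nat:
  fixes f :: "'b \<Rightarrow> 'w \<Rightarrow> nat"
  assumes "finite \<S>" "\<And>B. B \<in> \<S> \<Longrightarrow> f B \<in> measurable N (count_space UNIV)"
  shows "{\<omega> \<in> space N. Q (restrict (\<lambda>B. f B \<omega>) \<S>)} \<in> sets N"
proof -
  have "(\<lambda>\<omega>. restrict (\<lambda>B. f B \<omega>) \<S>) \<in> measurable N (PiM \<S> (\<lambda>_. count_space UNIV))"
    using assms(2) by (intro measurable_restrict)
  also have "PiM \<S> (\<lambda>_. count_space (UNIV :: nat set)) = count_space (PiE \<S> (\<lambda>_. UNIV))"
    using assms(1) by (intro count_space_PiM_finite) auto
  finally have "(\<lambda>\<omega>. restrict (\<lambda>B. f B \<omega>) \<S>) -` {v \<in> PiE \<S> (\<lambda>_. UNIV). Q v} \<inter> space N \<in> sets N"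
    by (rule measurable_sets) auto
  also have "(\<lambda>\<omega>. restrict (\<lambda>B. f B \<omega>) \<S>) -` {v \<in> PiE \<S> (\<lambda>_. UNIV). Q v} \<inter> space N
     = {\<omega> \<in> space N. Q (restrict (\<lambda>B. f B \<omega>) \<S>)}"
    by auto
  finally show ?thesis .
qed

text \<open>Cylinder events: arbitrary conditions \<open>Y\<close> on finitely many counts. Unlike
  the single-count generators of \<open>point_process_events\<close> they are closed under
  intersection, which is what the passage from generators to sigma-algebras requires.\<close>

definition count_events ::
    "'w measure \<Rightarrow> ('w \<Rightarrow> 'b::euclidean_space set) \<Rightarrow> 'b set \<Rightarrow> 'w set set" where
  "count_events M N R =
     {{\<omega> \<in> space M. restrict (\<lambda>B. card (N \<omega> \<inter> B)) \<S> \<in> Y} | Y \<S>.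
        finite \<S> \<and> (\<forall>B\<in>\<S>. B \<in> sets borel \<and> bounded B \<and> B \<subseteq> R)}"

lemma count_eventsI:
  assumes "B \<in> sets borel" "bounded B" "B \<subseteq> R"
  shows "{\<omega> \<in> space M. Q (card (N \<omega> \<inter> B))} \<in> count_events M N R"
  unfolding count_events_def using assms
  by (intro CollectI exI[of _ "{v. Q (v B)}"] exI[of _ "{B}"]) auto

lemma count_events_mono: "R \<subseteq> R' \<Longrightarrow> count_events M N R \<subseteq> count_events M N R'"
  unfolding count_events_def by blast

lemma space_in_count_events: "space M \<in> count_events M N R"
  unfolding count_events_def by (intro CollectI exI[of _ "UNIV"] exI[of _ "{}"]) auto

lemma Int_stable_count_events: "Int_stable (count_events M N R)"
proof (rule Int_stableI)
  fix E E' assume "E \<in> count_events M N R" "E' \<in> count_events M N R"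
  then obtain Y \<S> Y' \<S>' where
    E: "E = {\<omega> \<in> space M. restrict (\<lambda>B. card (N \<omega> \<inter> B)) \<S> \<in> Y}"
       "finite \<S>" "\<forall>B\<in>\<S>. B \<in> sets borel \<and> bounded B \<and> B \<subseteq> R" and
    E': "E' = {\<omega> \<in> space M. restrict (\<lambda>B. card (N \<omega> \<inter> B)) \<S>' \<in> Y'}"
       "finite \<S>'" "\<forall>B\<in>\<S>'. B \<in> sets borel \<and> bounded B \<and> B \<subseteq> R"
    unfolding count_events_def by blast
  have *: "restrict (restrict f (\<S> \<union> \<S>')) \<S> = restrict f \<S>"
    "restrict (restrict f (\<S> \<union> \<S>')) \<S>' = restrict f \<S>'" for f :: "'b set \<Rightarrow> nat"
    by (auto simp: restrict_def fun_eq_iff)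
  have "E \<inter> E' = {\<omega> \<in> space M. restrict (\<lambda>B. card (N \<omega> \<inter> B)) (\<S> \<union> \<S>')
      \<in> {v. restrict v \<S> \<in> Y \<and> restrict v \<S>' \<in> Y'}}"
    unfolding E(1) E'(1) mem_Collect_eq * by auto
  then show "E \<inter> E' \<in> count_events M N R"
    unfolding count_events_def using E(2,3) E'(2,3)
    by (intro CollectI exI[of _ "{v. restrict v \<S> \<in> Y \<and> restrict v \<S>' \<in> Y'}"]
        exI[of _ "\<S> \<union> \<S>'"]) auto
qed

section \<open>Factorization over disjoint regions for one Poisson process\<close>

context prob_space
begin

context
  fixes r :: real and S :: "'b::euclidean_space set" and N :: "'a \<Rightarrow> 'b set"
  assumes ppp: "poisson_point_process M r S N"
begin

lemma ppp_finite: "\<omega> \<in> space M \<Longrightarrow> bounded B \<Longrightarrow> finite (N \<omega> \<inter> B)"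
  using ppp[unfolded poisson_point_process_def, THEN conjunct1] by blast

lemma ppp_measurable:
  "B \<in> sets borel \<Longrightarrow> bounded B \<Longrightarrow> B \<subseteq> S \<Longrightarrow> (\<lambda>\<omega>. card (N \<omega> \<inter> B)) \<in> measurable M (count_space UNIV)"
  using ppp[unfolded poisson_point_process_def, THEN conjunct2, THEN conjunct1, rule_format, of B]
  by blast

lemma ppp_prob:
  "B \<in> sets borel \<Longrightarrow> bounded B \<Longrightarrow> B \<subseteq> S \<Longrightarrow>
   prob {\<omega> \<in> space M. card (N \<omega> \<inter> B) = k}
     = exp (- (r * measure lborel B)) * (r * measure lborel B) ^ k / fact k"
  using ppp[unfolded poisson_point_process_def, THEN conjunct2, THEN conjunct1, rule_format, of B]
  by blast

lemma ppp_indep: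
  "finite \<B> \<Longrightarrow> disjoint \<B> \<Longrightarrow> (\<And>B. B \<in> \<B> \<Longrightarrow> B \<in> sets borel \<and> bounded B \<and> B \<subseteq> S) \<Longrightarrow>
   indep_vars (\<lambda>_. count_space UNIV) (\<lambda>B \<omega>. card (N \<omega> \<inter> B)) \<B>"
  using ppp[unfolded poisson_point_process_def, THEN conjunct2, THEN conjunct2, rule_format, of \<B>]
  by blast

lemma point_process_events_subset: "point_process_events M S N \<subseteq> events"
  unfolding point_process_events_def
proof (rule sets.sigma_sets_subset, safe)
  fix B k assume B: "B \<in> sets borel" "bounded B" "B \<subseteq> S"
  from measurable_sets[OF ppp_measurable[OF this], of "{k}"]
  show "{\<omega> \<in> space M. card (N \<omega> \<inter> B) = k} \<in> events"
    by (simp add: vimage_def Int_def conj_commute)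
qed

lemma count_events_subset:
  assumes "R \<subseteq> S"
  shows "count_events M N R \<subseteq> point_process_events M S N"
proof
  fix E assume "E \<in> count_events M N R"
  then obtain Y \<S> where
    E: "E = {\<omega> \<in> space M. restrict (\<lambda>B. card (N \<omega> \<inter> B)) \<S> \<in> Y}"
       "finite \<S>" "\<forall>B\<in>\<S>. B \<in> sets borel \<and> bounded B \<and> B \<subseteq> R"
    unfolding count_events_def by blast
  let ?G = "{{\<omega> \<in> space M. card (N \<omega> \<inter> B) = k} | B k. B \<in> sets borel \<and> bounded B \<and> B \<subseteq> S}"
  have G: "?G \<subseteq> Pow (space M)" by auto
  have "{\<omega> \<in> space (sigma (space M) ?G). restrict (\<lambda>B. card (N \<omega> \<inter> B)) \<S> \<in> Y}
     \<in> sets (sigma (space M) ?G)"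
  proof (rule sets_restrict_nat[OF E(2)])
    fix B assume "B \<in> \<S>"
    then have B: "B \<in> sets borel" "bounded B" "B \<subseteq> S" using E assms by auto
    show "(\<lambda>\<omega>. card (N \<omega> \<inter> B)) \<in> measurable (sigma (space M) ?G) (count_space UNIV)"
    proof (rule measurable_count_space_eq2_countable[THEN iffD2]; intro conjI ballI)
      fix k :: nat
      have "(\<lambda>\<omega>. card (N \<omega> \<inter> B)) -` {k} \<inter> space (sigma (space M) ?G)
         = {\<omega> \<in> space M. card (N \<omega> \<inter> B) = k}"
        using G by auto
      also have "\<dots> \<in> sets (sigma (space M) ?G)"
        using B G by (auto intro!: sigma_sets.Basic)
      finally show "(\<lambda>\<omega>. card (N \<omega> \<inter> B)) -` {k} \<inter> space (sigma (space M) ?G)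
          \<in> sets (sigma (space M) ?G)" .
    qed auto
  qed
  then show "E \<in> point_process_events M S N"
    using G by (simp add: E point_process_events_def)
qed

text \<open>Counts are additive over disjoint pieces, so a condition on the original counts becomes
  one on sums of counts of the pieces. Nonempty pieces ensure that pieces of disjoint regions are
  different sets.\<close>

lemma count_events_refine:
  assumes E: "E \<in> count_events M N R"
  shows "\<exists>\<T> Y. finite \<T> \<and> disjoint \<T> \<and> {} \<notin> \<T> \<and>
    (\<forall>T\<in>\<T>. T \<in> sets borel \<and> bounded T \<and> T \<subseteq> R) \<and>
    E = {\<omega> \<in> space M. restrict (\<lambda>B. card (N \<omega> \<inter> B)) \<T> \<in> Y}"
proof -
  obtain Y \<S> where
    E: "E = {\<omega> \<in> space M. restrict (\<lambda>B. card (N \<omega> \<inter> B)) \<S> \<in> Y}"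
       "finite \<S>" "\<forall>B\<in>\<S>. B \<in> sets borel \<and> bounded B \<and> B \<subseteq> R"
    using E unfolding count_events_def by blast
  obtain \<T> where T: "finite \<T>" "disjoint \<T>" "{} \<notin> \<T>" "\<T> \<subseteq> sets borel"
      "\<forall>T\<in>\<T>. \<exists>S\<in>\<S>. T \<subseteq> S" "\<forall>S\<in>\<S>. S = \<Union>{T\<in>\<T>. T \<subseteq> S}"
    using finite_disjoint_refinement[of \<S> borel] E by blast
  have *: "card (N \<omega> \<inter> B) = (\<Sum>T | T \<in> \<T> \<and> T \<subseteq> B. card (N \<omega> \<inter> T))"
    if "\<omega> \<in> space M" "B \<in> \<S>" for \<omega> B
  proof -
    have B: "B = \<Union>{T\<in>\<T>. T \<subseteq> B}" using T that by blast
    have "N \<omega> \<inter> B = (\<Union>T\<in>{T\<in>\<T>. T \<subseteq> B}. N \<omega> \<inter> T)" by (subst B) auto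
    also have "card \<dots> = (\<Sum>T | T \<in> \<T> \<and> T \<subseteq> B. card (N \<omega> \<inter> T))"
    proof (rule card_UN_disjoint)
      show "\<forall>T\<in>{T \<in> \<T>. T \<subseteq> B}. finite (N \<omega> \<inter> T)"
        using ppp_finite[OF that(1)] E(3) that(2) bounded_subset by blast
      show "\<forall>i\<in>{T \<in> \<T>. T \<subseteq> B}. \<forall>j\<in>{T \<in> \<T>. T \<subseteq> B}. i \<noteq> j \<longrightarrow> N \<omega> \<inter> i \<inter> (N \<omega> \<inter> j) = {}"
        using disjointD[OF T(2)] by blast
    qed (use T in auto)
    finally show ?thesis .
  qed
  let ?Y = "{v. restrict (\<lambda>B. \<Sum>T | T \<in> \<T> \<and> T \<subseteq> B. v T) \<S> \<in> Y}"
  show ?thesis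
  proof (intro exI conjI ballI)
    show "E = {\<omega> \<in> space M. restrict (\<lambda>B. card (N \<omega> \<inter> B)) \<T> \<in> ?Y}"
      unfolding E(1) mem_Collect_eq using * by (intro Collect_cong conj_cong refl arg_cong[of _ _ "\<lambda>v. v \<in> Y"] restrict_ext) simp
    fix T assume "T \<in> \<T>"
    then obtain S where S: "S \<in> \<S>" "T \<subseteq> S" "T \<in> sets borel" using T(4,5) by blast
    then show "T \<in> sets borel" "bounded T" "T \<subseteq> R"
      using E(3) bounded_subset[of S T] by auto
  qed (use T in auto)
qed

text \<open>The pieces of both regions together form one disjoint family, whose counts are
  independent; grouping them by region makes the two count vectors independent.\<close>

lemma count_events_indep:
  assumes R: "R1 \<subseteq> S" "R2 \<subseteq> S" "R1 \<inter> R2 = {}"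
    and E1: "E1 \<in> count_events M N R1" and E2: "E2 \<in> count_events M N R2"
  shows "prob (E1 \<inter> E2) = prob E1 * prob E2"
proof -
  let ?c = "\<lambda>B \<omega>. card (N \<omega> \<inter> B)"
  obtain \<T>1 Y1 where T1: "finite \<T>1" "disjoint \<T>1" "{} \<notin> \<T>1"
    "\<forall>T\<in>\<T>1. T \<in> sets borel \<and> bounded T \<and> T \<subseteq> R1"
    "E1 = {\<omega> \<in> space M. restrict (\<lambda>B. ?c B \<omega>) \<T>1 \<in> Y1}"
    using count_events_refine[OF E1] by blast
  obtain \<T>2 Y2 where T2: "finite \<T>2" "disjoint \<T>2" "{} \<notin> \<T>2"
    "\<forall>T\<in>\<T>2. T \<in> sets borel \<and> bounded T \<and> T \<subseteq> R2"
    "E2 = {\<omega> \<in> space M. restrict (\<lambda>B. ?c B \<omega>) \<T>2 \<in> Y2}"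
    using count_events_refine[OF E2] by blast
  have cross: "T \<inter> T' = {}" if "T \<in> \<T>1" "T' \<in> \<T>2" for T T'
    using T1(4) T2(4) that R(3) by blast
  have "disjoint (\<T>1 \<union> \<T>2)"
    using T1(2) T2(2) cross unfolding disjoint_def by (metis Int_commute UnE)
  then have "indep_vars (\<lambda>_. count_space UNIV) ?c (\<T>1 \<union> \<T>2)"
  proof (rule ppp_indep[rotated])
    show "T \<in> sets borel \<and> bounded T \<and> T \<subseteq> S" if "T \<in> \<T>1 \<union> \<T>2" for T
      using that T1(4) T2(4) R by blast
  qed (use T1(1) T2(1) in simp)
  moreover have "\<T>1 \<inter> \<T>2 = {}" using cross T1(3) by (metis Int_absorb disjoint_iff)
  ultimately have ind: "indep_var
      (PiM \<T>1 (\<lambda>_. count_space UNIV)) (\<lambda>\<omega>. restrict (\<lambda>B. ?c B \<omega>) \<T>1)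
      (PiM \<T>2 (\<lambda>_. count_space UNIV)) (\<lambda>\<omega>. restrict (\<lambda>B. ?c B \<omega>) \<T>2)"
    by (intro indep_var_restrict) auto
  have P: "PiM \<T> (\<lambda>_. count_space (UNIV :: nat set)) = count_space (PiE \<T> (\<lambda>_. UNIV))"
    if "finite \<T>" for \<T> :: "'b set set"
    using that by (intro count_space_PiM_finite) auto
  let ?Y1 = "{v \<in> PiE \<T>1 (\<lambda>_. UNIV). v \<in> Y1}" and ?Y2 = "{v \<in> PiE \<T>2 (\<lambda>_. UNIV). v \<in> Y2}"
  have "prob ((\<lambda>x. (restrict (\<lambda>B. ?c B x) \<T>1, restrict (\<lambda>B. ?c B x) \<T>2)) -` (?Y1 \<times> ?Y2) \<inter> space M)
     = prob ((\<lambda>\<omega>. restrict (\<lambda>B. ?c B \<omega>) \<T>1) -` ?Y1 \<inter> space M)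
     * prob ((\<lambda>\<omega>. restrict (\<lambda>B. ?c B \<omega>) \<T>2) -` ?Y2 \<inter> space M)"
    by (rule indep_varD[OF ind]) (auto simp: P T1 T2)
  also have "(\<lambda>x. (restrict (\<lambda>B. ?c B x) \<T>1, restrict (\<lambda>B. ?c B x) \<T>2)) -` (?Y1 \<times> ?Y2) \<inter> space M
     = E1 \<inter> E2" unfolding T1(5) T2(5) by auto
  also have "(\<lambda>\<omega>. restrict (\<lambda>B. ?c B \<omega>) \<T>1) -` ?Y1 \<inter> space M = E1" unfolding T1(5) by auto
  also have "(\<lambda>\<omega>. restrict (\<lambda>B. ?c B \<omega>) \<T>2) -` ?Y2 \<inter> space M = E2" unfolding T2(5) by auto
  finally show ?thesis .
qed

end

end

section \<open>Joint independence of all processes over disjoint time sets\<close>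

locale driving_noise = prob_space M
  for M :: "'w measure" +
  fixes lam a0 :: real
    and A :: "int ^ 'd::finite \<Rightarrow> 'w \<Rightarrow> real set"
    and D :: "int ^ 'd \<Rightarrow> 'w \<Rightarrow> (real \<times> real) set"
  assumes driving: "driving_processes M lam a0 A D"
    and lam_pos: "0 < lam" and a0_pos: "0 < a0"
begin

lemma A_ppp: "poisson_point_process M lam UNIV (A i)"
  and D_ppp: "poisson_point_process M 1 (UNIV \<times> {0..1 / a0}) (D i)"
  using driving unfolding driving_processes_def by auto

definition process_events :: "int ^ 'd + int ^ 'd \<Rightarrow> 'w set set" where
  "process_events = case_sum (\<lambda>i. point_process_events M UNIV (A i))
     (\<lambda>i. point_process_events M (UNIV \<times> {0..1 / a0}) (D i))"

definition window_events :: "real set \<Rightarrow> int ^ 'd + int ^ 'd \<Rightarrow> 'w set set" where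
  "window_events U = case_sum (\<lambda>i. count_events M (A i) U)
     (\<lambda>i. count_events M (D i) (U \<times> {0..1 / a0}))"

text \<open>The information carried by all driving processes at times in \<open>U\<close>, where
  \<open>U\<close> will be either the past of the chain or a single cell.\<close>

definition history :: "real set \<Rightarrow> 'w measure" where
  "history U = sigma (space M) (\<Union>p. window_events U p)"

lemma process_indep: "indep_sets process_events UNIV"
  using driving unfolding driving_processes_def process_events_def by auto

lemma process_events_subset: "process_events p \<subseteq> events"
  unfolding process_events_def
  using point_process_events_subset[OF A_ppp] point_process_events_subset[OF D_ppp]
  by (cases p) auto

lemma window_events_subset: "window_events U p \<subseteq> process_events p"
  unfolding process_events_def window_events_def
  using count_events_subset[OF A_ppp, of U] count_events_subset[OF D_ppp, of "U \<times> {0..1 / a0}"]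
  by (cases p) auto

lemma process_events_Int:
  "E \<in> process_events p \<Longrightarrow> E' \<in> process_events p \<Longrightarrow> E \<inter> E' \<in> process_events p"
proof -
  have 1: "sigma_algebra (space M) (point_process_events M R N)"
    for R :: "'b::euclidean_space set" and N
    unfolding point_process_events_def by (rule sigma_algebra_sigma_sets) auto
  have "sigma_algebra (space M) (process_events p)"
    unfolding process_events_def by (cases p) (auto intro: 1)
  then interpret sigma_algebra "space M" "process_events p" .
  show "E \<in> process_events p \<Longrightarrow> E' \<in> process_events p \<Longrightarrow> E \<inter> E' \<in> process_events p"
    by (rule Int)
qed

lemma prob_INT_process:
  assumes "finite J" "J \<noteq> {}" "\<And>p. p \<in> J \<Longrightarrow> E p \<in> process_events p"
  shows "prob (\<Inter>p\<in>J. E p) = (\<Prod>p\<in>J. prob (E p))"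
  using assms by (intro indep_setsD[OF process_indep]) auto

lemma space_history [simp]: "space (history U) = space M"
  and sets_history: "sets (history U) = sigma_sets (space M) (\<Union>p. window_events U p)"
proof -
  have "(\<Union>p. window_events U p) \<subseteq> Pow (space M)"
    using window_events_subset process_events_subset sets.sets_into_space by blast
  then show "space (history U) = space M"
    "sets (history U) = sigma_sets (space M) (\<Union>p. window_events U p)"
    unfolding history_def by auto
qed

lemma sets_history_subset: "sets (history U) \<subseteq> events"
  unfolding sets_history using window_events_subset process_events_subset
  by (intro sets.sigma_sets_subset) blast

lemma history_events: "E \<in> sets (history U) \<Longrightarrow> E \<in> events"
  using sets_history_subset by blast

lemma sets_history_mono: "U \<subseteq> V \<Longrightarrow> sets (history U) \<subseteq> sets (history V)"
  unfolding sets_history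
proof (intro sigma_sets_mono' UN_mono subset_refl)
  fix p assume "U \<subseteq> V"
  then show "window_events U p \<subseteq> window_events V p"
    unfolding window_events_def
    using count_events_mono[of U V] count_events_mono[of "U \<times> {0..1 / a0}" "V \<times> {0..1 / a0}"]
    by (cases p) (auto simp: Sigma_mono dest!: subsetD)
qed

lemma A_count_history:
  assumes "B \<in> sets borel" "bounded B" "B \<subseteq> U"
  shows "{\<omega> \<in> space M. Q (card (A i \<omega> \<inter> B))} \<in> sets (history U)"
  unfolding sets_history using count_eventsI[OF assms, of M Q "A i"]
  by (intro sigma_sets.Basic UN_I[of "Inl i"]) (auto simp: window_events_def)

lemma D_count_history:
  assumes "B \<in> sets borel" "bounded B" "B \<subseteq> U \<times> {0..1 / a0}"
  shows "{\<omega> \<in> space M. Q (card (D i \<omega> \<inter> B))} \<in> sets (history U)"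
  unfolding sets_history using count_eventsI[OF assms, of M Q "D i"]
  by (intro sigma_sets.Basic UN_I[of "Inr i"]) (auto simp: window_events_def)

text \<open>For a full product of indices, a probability factorizes first over the processes, by
  their mutual independence, and then inside each process over \<open>U\<close> and
  \<open>V\<close>, by \<open>count_events_indep\<close>. An arbitrary finite index set is enlarged
  to such a product.\<close>

lemma window_indep:
  assumes "U \<inter> V = {}"
  shows "indep_sets (\<lambda>(p, b). window_events (if b then U else V) p) UNIV"
    (is "indep_sets ?F UNIV")
proof (subst indep_sets_finite_index_sets, intro allI impI)
  fix J :: "((int ^ 'd + int ^ 'd) \<times> bool) set" assume J: "finite J" "J \<noteq> {}"
  let ?P = "fst ` J"
  have P: "finite ?P" "?P \<noteq> {}" using J by auto
  have space: "space M \<in> window_events W p" for W p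
    unfolding window_events_def by (cases p) (auto intro: space_in_count_events)
  have "indep_sets ?F (?P \<times> UNIV)"
  proof (subst indep_sets_finite)
    show "\<forall>E\<in>Pi (?P \<times> UNIV) ?F. prob (\<Inter>j\<in>?P \<times> UNIV. E j) = (\<Prod>j\<in>?P \<times> UNIV. prob (E j))"
    proof
      fix E assume E: "E \<in> Pi (?P \<times> UNIV) ?F"
      have EU: "E (p, True) \<in> window_events U p" and EV: "E (p, False) \<in> window_events V p"
        if "p \<in> ?P" for p
        using Pi_mem[OF E, of "(p, True)"] Pi_mem[OF E, of "(p, False)"] that by auto
      have "(\<Inter>j\<in>?P \<times> UNIV. E j) = (\<Inter>p\<in>?P. E (p, True) \<inter> E (p, False))"
        by (auto simp: UNIV_bool)
      also have "prob \<dots> = (\<Prod>p\<in>?P. prob (E (p, True) \<inter> E (p, False)))"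
        using EU EV window_events_subset by (intro prob_INT_process P process_events_Int) blast+
      also have "\<dots> = (\<Prod>p\<in>?P. prob (E (p, True)) * prob (E (p, False)))"
      proof (rule prod.cong[OF refl])
        fix p assume p: "p \<in> ?P"
        show "prob (E (p, True) \<inter> E (p, False)) = prob (E (p, True)) * prob (E (p, False))"
        proof (cases p)
          case (Inl i)
          then show ?thesis using EU[OF p] EV[OF p] assms
            by (intro count_events_indep[OF A_ppp, of U V]) (auto simp: window_events_def)
        next
          case (Inr i)
          then show ?thesis using EU[OF p] EV[OF p] assms
            by (intro count_events_indep[OF D_ppp, of "U \<times> {0..1 / a0}" "V \<times> {0..1 / a0}"])
              (auto simp: window_events_def)
        qed
      qed
      also have "\<dots> = (\<Prod>p\<in>?P. \<Prod>b\<in>UNIV. prob (E (p, b)))"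
        by (simp add: UNIV_bool mult.commute)
      also have "\<dots> = (\<Prod>j\<in>?P \<times> UNIV. prob (E j))"
        by (simp add: prod.cartesian_product)
      finally show "prob (\<Inter>j\<in>?P \<times> UNIV. E j) = (\<Prod>j\<in>?P \<times> UNIV. prob (E j))" .
    qed
    show "?F j \<subseteq> events" for j
      using window_events_subset process_events_subset by (cases j) blast
  qed (use P space in auto)
  moreover have "J \<subseteq> ?P \<times> UNIV" by force
  ultimately show "indep_sets ?F J" using indep_sets_mono_index by blast
qed

text \<open>Grouping the intersection-stable families of \<open>window_indep\<close> by their time
  set carries independence over to the generated sigma-algebras.\<close>

lemma history_indep:
  assumes "U \<inter> V = {}" "E1 \<in> sets (history U)" "E2 \<in> sets (history V)"
  shows "prob (E1 \<inter> E2) = prob E1 * prob E2"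
proof -
  let ?F = "\<lambda>(p, b). window_events (if b then U else V) p"
  have "indep_sets (\<lambda>b::bool. sigma_sets (space M) (\<Union>j\<in>UNIV \<times> {b}. ?F j)) UNIV"
  proof (rule indep_sets_collect_sigma)
    show "indep_sets ?F (\<Union>b\<in>UNIV. UNIV \<times> {b})"
      by (rule indep_sets_mono_index[OF subset_UNIV window_indep[OF assms(1)]])
    have "Int_stable (window_events W p)" for W p
      unfolding window_events_def by (cases p) (simp_all add: Int_stable_count_events)
    then show "Int_stable (?F j)" for j by (cases j) simp
    show "disjoint_family (\<lambda>b::bool. UNIV \<times> {b})" by (auto simp: disjoint_family_on_def)
  qed
  moreover have "(\<Union>j\<in>UNIV \<times> {b}. ?F j) = (\<Union>p. window_events (if b then U else V) p)" for b
  proof -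
    have "UNIV \<times> {b} = range (\<lambda>p :: int ^ 'd + int ^ 'd. (p, b))" by auto
    then show ?thesis by (simp only: image_image prod.case)
  qed
  ultimately have "indep_sets (\<lambda>b::bool. sets (history (if b then U else V))) UNIV"
    unfolding sets_history by simp
  from indep_setsD[OF this, of UNIV "\<lambda>b. if b then E1 else E2"] assms(2,3)
  show ?thesis by (simp add: UNIV_bool Int_commute mult.commute)
qed

end

section \<open>Paths of the queueing system\<close>

text \<open>The effect of a cell \<open>C\<close> on one queue whose ratio is frozen at
  \<open>r\<close>. Truncated subtraction stands for the guard \<open>0 < y i\<close> of the
  dynamics; the two agree because the cells in question never hold both an arrival and a departure
  atom of the site.\<close>

definition local_step :: "real set \<Rightarrow> (real \<times> real) set \<Rightarrow> real set \<Rightarrow> nat \<Rightarrow> real \<Rightarrow> nat" where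
  "local_step A D C v r =
     v + of_bool (A \<inter> C \<noteq> {}) - of_bool (\<exists>\<tau> u. \<tau> \<in> C \<and> (\<tau>, u) \<in> D \<and> u \<le> r)"

text \<open>Both queues see the same atoms. At most one customer leaves, so a strict order can at
  worst become an equality; from equality, the queue with the smaller ratio departs only if the
  other one does.\<close>

lemma local_step_mono:
  assumes "v < v' \<or> v = v' \<and> r' \<le> r"
  shows "local_step A D C v r \<le> local_step A D C v' r'"
proof -
  have "(\<exists>\<tau> u. \<tau> \<in> C \<and> (\<tau>, u) \<in> D \<and> u \<le> r') \<Longrightarrow> r' \<le> r \<Longrightarrow> (\<exists>\<tau> u. \<tau> \<in> C \<and> (\<tau>, u) \<in> D \<and> u \<le> r)"
    using order_trans by blast
  then show ?thesis using assms unfolding local_step_def by (auto simp: of_bool_def)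
qed

context
  fixes a :: "int ^ 'd::finite \<Rightarrow> real" and A D t0 x0 x
  assumes evolution: "queue_evolution a A D t0 x0 x"
begin

lemma evolution_start: "x t0 = x0"
  using evolution unfolding queue_evolution_def by blast

lemma evolution_right: "t0 \<le> t \<Longrightarrow> eventually (\<lambda>s. x s i = x t i) (at_right t)"
  using evolution unfolding queue_evolution_def by (auto simp: tendsto_discrete)

lemma evolution_jump:
  assumes "t0 < t"
  shows "\<exists>y. (\<forall>i. eventually (\<lambda>s. x s i = y i) (at_left t)) \<and>
    (\<forall>i. x t i = y i + (if t \<in> A i then 1 else 0)
       - (if 0 < y i \<and> (\<exists>u. (t, u) \<in> D i \<and> u \<le> departure_ratio a y i) then 1 else 0))"
  using evolution[unfolded queue_evolution_def, THEN conjunct2, THEN conjunct2, rule_format, OF assms]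
  by (simp only: tendsto_discrete)

text \<open>Away from its own atoms a coordinate is locally constant on both sides of every time,
  and an interval is connected.\<close>

lemma evolution_const:
  assumes "t0 \<le> s" "s \<le> t" "A i \<inter> {s<..t} = {}" "D i \<inter> ({s<..t} \<times> UNIV) = {}"
  shows "x t i = x s i"
proof (rule connected_local_const[of "{s..t}" t s "\<lambda>r. x r i"])
  show "\<forall>r\<in>{s..t}. \<forall>\<^sub>F r' in at r within {s..t}. x r i = x r' i"
  proof
    fix r assume r: "r \<in> {s..t}"
    have right: "\<forall>\<^sub>F r' in at_right r. x r i = x r' i"
      using evolution_right[of r i] r assms(1) by (auto elim: eventually_mono)
    show "\<forall>\<^sub>F r' in at r within {s..t}. x r i = x r' i"
    proof (cases "r = s")
      case True
      have "at r within {s..t} \<le> at r within {r..}" by (intro at_le) (auto simp: True)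
      then show ?thesis using right filter_leD by (auto simp: at_within_Ici_at_right)
    next
      case False
      with r assms have "t0 < r" by simp
      then obtain y where y: "\<forall>i. eventually (\<lambda>s. x s i = y i) (at_left r)"
        "\<forall>i. x r i = y i + (if r \<in> A i then 1 else 0)
         - (if 0 < y i \<and> (\<exists>u. (r, u) \<in> D i \<and> u \<le> departure_ratio a y i) then 1 else 0)"
        using evolution_jump by blast
      have "r \<notin> A i" "\<And>u. (r, u) \<notin> D i" using assms(3,4) r False by auto
      with y(2)[rule_format, of i] have "x r i = y i" by simp
      with y(1)[rule_format, of i] have "\<forall>\<^sub>F r' in at_left r. x r i = x r' i" by (auto elim: eventually_mono)
      with right have "\<forall>\<^sub>F r' in at r. x r i = x r' i" by (simp add: eventually_at_split)
      moreover have "at r within {s..t} \<le> at r" by (intro at_le) auto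
      ultimately show ?thesis using filter_leD by blast
    qed
  qed
qed (use assms in auto)

lemma evolution_left_limit:
  assumes "t0 \<le> s" "s < t" "A i \<inter> {s<..<t} = {}" "D i \<inter> ({s<..<t} \<times> UNIV) = {}"
    and y: "eventually (\<lambda>r. x r i = y) (at_left t)"
  shows "y = x s i"
proof -
  have "eventually (\<lambda>r. r \<in> {s<..<t}) (at_left t)"
    using assms(2) by (rule eventually_at_leftI[rotated]) auto
  with y have "eventually (\<lambda>r. y = x s i) (at_left t)"
  proof eventually_elim
    case (elim r)
    then have "x r i = x s i" using assms(1,3,4) by (intro evolution_const) fastforce+
    with elim show ?case by simp
  qed
  then show ?thesis by simp
qed

text \<open>Other queues matter only through \<open>departure_ratio\<close> at the instant of a
  departure atom. Hence only the third alternative asks the interacting sites to be silent; the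
  ratio just before the atom is then the one at time \<open>s\<close>.\<close>

lemma evolution_local_step:
  assumes st: "t0 \<le> s" "s \<le> t"
    and a0: "0 < a 0"
    and isolated: "(A i \<inter> {s<..t} = {} \<and> D i \<inter> ({s<..t} \<times> UNIV) = {}) \<or>
      (\<exists>\<tau>. A i \<inter> {s<..t} = {\<tau>} \<and> D i \<inter> ({s<..t} \<times> UNIV) = {}) \<or>
      (A i \<inter> {s<..t} = {} \<and> (\<exists>\<tau> u. D i \<inter> ({s<..t} \<times> UNIV) = {(\<tau>, u)}) \<and>
        (\<forall>j. 0 < a j \<longrightarrow> j \<noteq> 0 \<longrightarrow> A (i - j) \<inter> {s<..t} = {} \<and> D (i - j) \<inter> ({s<..t} \<times> UNIV) = {}))"
  shows "x t i = local_step (A i) (D i) {s<..t} (x s i) (departure_ratio a (x s) i)"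
  using isolated
proof (elim disjE conjE exE)
  assume 1: "A i \<inter> {s<..t} = {}" "D i \<inter> ({s<..t} \<times> UNIV) = {}"
  then have "x t i = x s i" using st by (intro evolution_const)
  moreover have "(\<exists>\<tau> u. \<tau> \<in> {s<..t} \<and> (\<tau>, u) \<in> D i \<and> u \<le> r) = False" for r
    using 1(2) by blast
  ultimately show ?thesis by (simp only: local_step_def 1(1)) simp
next
  fix \<tau> assume 1: "A i \<inter> {s<..t} = {\<tau>}" "D i \<inter> ({s<..t} \<times> UNIV) = {}"
  then have \<tau>: "s < \<tau>" "\<tau> \<le> t" "\<tau> \<in> A i" by auto
  have "t0 < \<tau>" using \<tau> st by simp
  then obtain y where y: "\<forall>i. eventually (\<lambda>s. x s i = y i) (at_left \<tau>)"
    "\<forall>i. x \<tau> i = y i + (if \<tau> \<in> A i then 1 else 0)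
     - (if 0 < y i \<and> (\<exists>u. (\<tau>, u) \<in> D i \<and> u \<le> departure_ratio a y i) then 1 else 0)"
    using evolution_jump by blast
  have "y i = x s i"
  proof (rule evolution_left_limit[OF st(1) \<tau>(1) _ _ y(1)[rule_format]])
    show "A i \<inter> {s<..<\<tau>} = {}" "D i \<inter> ({s<..<\<tau>} \<times> UNIV) = {}" using 1 \<tau> by fastforce+
  qed
  moreover have "(\<tau>, u) \<notin> D i" for u using 1(2) \<tau> by auto
  ultimately have "x \<tau> i = x s i + 1" using y(2)[rule_format, of i] \<tau> by simp
  moreover have "x t i = x \<tau> i"
    using 1 \<tau> st by (intro evolution_const) fastforce+
  moreover have "(\<exists>\<tau> u. \<tau> \<in> {s<..t} \<and> (\<tau>, u) \<in> D i \<and> u \<le> r) = False" for r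
    using 1(2) by blast
  ultimately show ?thesis by (simp only: local_step_def 1(1)) simp
next
  fix \<tau> u assume 1: "A i \<inter> {s<..t} = {}" "D i \<inter> ({s<..t} \<times> UNIV) = {(\<tau>, u)}"
   "\<forall>j. 0 < a j \<longrightarrow> j \<noteq> 0 \<longrightarrow> A (i - j) \<inter> {s<..t} = {} \<and> D (i - j) \<inter> ({s<..t} \<times> UNIV) = {}"
  then have "(\<tau>, u) \<in> D i \<inter> ({s<..t} \<times> UNIV)" by blast
  then have \<tau>: "s < \<tau>" "\<tau> \<le> t" "(\<tau>, u) \<in> D i" by auto
  then have \<tau>A: "\<tau> \<notin> A i" using 1(1) by auto
  have uniq: "\<tau>' = \<tau> \<and> u' = u" if "(\<tau>', u') \<in> D i" "\<tau>' \<in> {s<..t}" for \<tau>' u'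
    using 1(2) that by blast
  have "t0 < \<tau>" using \<tau> st by simp
  then obtain y where y: "\<forall>i. eventually (\<lambda>s. x s i = y i) (at_left \<tau>)"
    "\<forall>i. x \<tau> i = y i + (if \<tau> \<in> A i then 1 else 0)
     - (if 0 < y i \<and> (\<exists>u. (\<tau>, u) \<in> D i \<and> u \<le> departure_ratio a y i) then 1 else 0)"
    using evolution_jump by blast
  have yi: "y i = x s i"
  proof (rule evolution_left_limit[OF st(1) \<tau>(1) _ _ y(1)[rule_format]])
    show "A i \<inter> {s<..<\<tau>} = {}" using 1 \<tau> by fastforce
    show "D i \<inter> ({s<..<\<tau>} \<times> UNIV) = {}"
    proof (rule equals0I)
      fix p assume "p \<in> D i \<inter> ({s<..<\<tau>} \<times> UNIV)"
      then obtain \<sigma> v where "(\<sigma>, v) \<in> D i" "s < \<sigma> \<and> \<sigma> < \<tau>" by (cases p) auto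
      then show False using uniq[of \<sigma> v] \<tau> by auto
    qed
  qed
  have yj: "y (i - j) = x s (i - j)" if "0 < a j" for j
  proof (cases "j = 0")
    case False
    with 1(3) that have j: "A (i - j) \<inter> {s<..t} = {}" "D (i - j) \<inter> ({s<..t} \<times> UNIV) = {}" by auto
    show ?thesis
    proof (rule evolution_left_limit[OF st(1) \<tau>(1) _ _ y(1)[rule_format]])
      show "A (i - j) \<inter> {s<..<\<tau>} = {}" "D (i - j) \<inter> ({s<..<\<tau>} \<times> UNIV) = {}"
        using j \<tau> by fastforce+
    qed
  qed (simp add: yi)
  have "departure_ratio a y i = departure_ratio a (x s) i"
    unfolding departure_ratio_def yi by (simp add: yj)
  moreover have "(\<exists>\<tau>' u'. \<tau>' \<in> {s<..t} \<and> (\<tau>', u') \<in> D i \<and> u' \<le> r) \<longleftrightarrow> u \<le> r"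
    "(\<exists>u'. (\<tau>, u') \<in> D i \<and> u' \<le> r) \<longleftrightarrow> u \<le> r" for r
  proof -
    have "\<tau> \<in> {s<..t}" using \<tau> by simp
    then show "(\<exists>\<tau>' u'. \<tau>' \<in> {s<..t} \<and> (\<tau>', u') \<in> D i \<and> u' \<le> r) \<longleftrightarrow> u \<le> r"
      "(\<exists>u'. (\<tau>, u') \<in> D i \<and> u' \<le> r) \<longleftrightarrow> u \<le> r"
      using uniq \<tau>(3) by blast+
  qed
  moreover have "x t i = x \<tau> i"
  proof (rule evolution_const)
    show "A i \<inter> {\<tau><..t} = {}" using 1 \<tau> by fastforce
    show "D i \<inter> ({\<tau><..t} \<times> UNIV) = {}"
    proof (rule equals0I)
      fix p assume "p \<in> D i \<inter> ({\<tau><..t} \<times> UNIV)"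
      then obtain \<sigma> v where "(\<sigma>, v) \<in> D i" "\<tau> < \<sigma> \<and> \<sigma> \<le> t" by (cases p) auto
      then show False using uniq[of \<sigma> v] \<tau> by auto
    qed
  qed (use \<tau> st in auto)
  ultimately show ?thesis using y(2)[rule_format, of i] \<tau>A
    by (simp only: local_step_def 1(1) yi) simp
qed

end

section \<open>Time discretization\<close>

lemma departure_ratio_antimono:
  assumes "finite {j. 0 < a j}" "0 < a 0" "\<And>j. 0 < a j \<Longrightarrow> y (i - j) \<le> z (i - j)" "y i = z i"
  shows "departure_ratio a z i \<le> departure_ratio a y i"
proof (cases "y i = 0")
  case False
  have "a 0 * real (y (i - 0)) \<le> (\<Sum>j | 0 < a j. a j * real (y (i - j)))"
    using assms(1,2) by (intro member_le_sum) auto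
  moreover have "0 < a 0 * real (y (i - 0))" using False assms(2) by simp
  moreover have "(\<Sum>j | 0 < a j. a j * real (y (i - j))) \<le> (\<Sum>j | 0 < a j. a j * real (z (i - j)))"
    using assms(3) by (intro sum_mono mult_left_mono) auto
  ultimately show ?thesis
    unfolding departure_ratio_def assms(4) by (intro divide_left_mono) (auto intro!: mult_pos_pos)
qed (use assms in \<open>simp add: departure_ratio_def\<close>)

lemma local_step_no_departure:
  assumes "D \<inter> (C \<times> UNIV) = {}"
  shows "local_step A D C v r = local_step A D C v r'"
proof -
  have "(\<exists>\<tau> u. \<tau> \<in> C \<and> (\<tau>, u) \<in> D \<and> u \<le> r) = False" for r using assms by blast
  then show ?thesis by (simp only: local_step_def)
qed

locale discretization = driving_noise M lam a0 A D
  for M :: "'w measure" and lam a0 :: real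
    and A :: "int ^ 'd::finite \<Rightarrow> 'w \<Rightarrow> real set"
    and D :: "int ^ 'd \<Rightarrow> 'w \<Rightarrow> (real \<times> real) set" +
  fixes a :: "int ^ 'd \<Rightarrow> real" and B :: "(int ^ 'd) set" and t0 h :: real
  assumes interference: "interference_sequence a" and a0: "a0 = a 0"
    and finite_box: "finite B" and box_nonempty: "B \<noteq> {}"
    and h_pos: "0 < h"
begin

lemma a_nonneg: "0 \<le> a i" and a_sym: "a (- i) = a i" and finite_support: "finite {j. 0 < a j}"
  using interference unfolding interference_sequence_def by auto

text \<open>Sites near the boundary of the box lose neighbours, so the full sum of \<open>a\<close>
  is only an upper bound for the row sums.\<close>

sublocale kern: weighted_kernel B "\<lambda>i k. a (i - k)" a0 lam "\<Sum>j | 0 < a j. a j"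
proof
  show "a (i - k) = a (k - i)" for i k using a_sym[of "k - i"] by simp
  show "(\<Sum>k\<in>B. a (i - k)) \<le> (\<Sum>j | 0 < a j. a j)" for i
  proof -
    have "(\<Sum>k\<in>B. a (i - k)) = (\<Sum>k\<in>{k\<in>B. 0 < a (i - k)}. a (i - k))"
      using finite_box a_nonneg by (intro sum.mono_neutral_right) (auto simp: less_le)
    also have "\<dots> = (\<Sum>j\<in>(\<lambda>k. i - k) ` {k\<in>B. 0 < a (i - k)}. a j)"
      by (subst sum.reindex) (auto simp: inj_on_def)
    also have "\<dots> \<le> (\<Sum>j | 0 < a j. a j)"
      using finite_support a_nonneg by (intro sum_mono2) auto
    finally show ?thesis .
  qed
qed (use finite_box a_nonneg a0 a0_pos lam_pos in auto)

lemma departure_ratio_eq_rate: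
  assumes "\<And>j. 0 < a j \<Longrightarrow> i - j \<in> B" "\<And>j. 0 < a j \<Longrightarrow> x (i - j) = y (i - j)"
  shows "departure_ratio a x i = kern.rate y i"
proof -
  have "(\<Sum>j | 0 < a j. a j * real (x (i - j))) = (\<Sum>k\<in>{k\<in>B. 0 < a (i - k)}. a (i - k) * real (y k))"
    by (rule sum.reindex_bij_witness[of _ "\<lambda>k. i - k" "\<lambda>j. i - j"]) (use assms in auto)
  also have "\<dots> = kern.load y i"
    unfolding kern.load_def using finite_box a_nonneg
    by (intro sum.mono_neutral_left) (auto simp: less_le)
  finally show ?thesis
    unfolding departure_ratio_def kern.rate_def using assms(2)[of 0] a0 a0_pos by simp
qed

section \<open>Cells, their atoms and the probabilities of cell events\<close>

definition start :: "nat \<Rightarrow> real" where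
  "start k = t0 + real k * h"

text \<open>Left-open because paths are right-continuous: an atom at \<open>start k\<close> already
  shows in the state at that time and belongs to the preceding cell.\<close>

definition win :: "nat \<Rightarrow> real set" where
  "win k = {start k<..start (Suc k)}"

definition past :: "nat \<Rightarrow> real set" where
  "past k = {start 0<..start k}"

lemma start_Suc: "start (Suc k) = start k + h"
  by (simp add: start_def algebra_simps)

lemma past_disjoint: "past k \<inter> win k = {}"
  by (auto simp: past_def win_def)

lemma past_subset: "past k \<subseteq> past (Suc k)" "win k \<subseteq> past (Suc k)"
proof -
  have "start 0 \<le> start k" using h_pos by (simp add: start_def)
  then show "past k \<subseteq> past (Suc k)" "win k \<subseteq> past (Suc k)"
    using h_pos by (auto simp: past_def win_def start_Suc)
qed

definition slab :: "nat \<Rightarrow> real set \<Rightarrow> (real \<times> real) set" where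
  "slab k I = win k \<times> I"

lemma win_borel: "win k \<in> sets borel" "bounded (win k)"
  unfolding win_def by auto

lemma measure_win: "measure lborel (win k) = h"
  unfolding win_def start_Suc using h_pos by simp

lemma slab_borel: "I \<in> sets borel \<Longrightarrow> bounded I \<Longrightarrow> slab k I \<in> sets borel \<and> bounded (slab k I)"
  unfolding slab_def using win_borel[of k]
  by (auto intro!: bounded_Times simp: borel_prod[symmetric])

lemma measure_slab: "I \<in> sets borel \<Longrightarrow> bounded I \<Longrightarrow> measure lborel (slab k I) = h * measure lborel I"
proof -
  assume I: "I \<in> sets borel" "bounded I"
  have "emeasure lborel (slab k I) = emeasure lborel (win k) * emeasure lborel I"
    unfolding slab_def lborel_prod[symmetric] using I win_borel[of k]
    by (intro lborel.emeasure_pair_measure_Times) auto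
  then show ?thesis
    using measure_win[of k] by (simp add: measure_def enn2real_mult)
qed

abbreviation nA :: "nat \<Rightarrow> int ^ 'd \<Rightarrow> 'w \<Rightarrow> nat" where
  "nA k i \<omega> \<equiv> card (A i \<omega> \<inter> win k)"

abbreviation nD :: "nat \<Rightarrow> real set \<Rightarrow> int ^ 'd \<Rightarrow> 'w \<Rightarrow> nat" where
  "nD k I i \<omega> \<equiv> card (D i \<omega> \<inter> slab k I)"

abbreviation "marks \<equiv> {0..1 / a0}"

definition quiet :: "nat \<Rightarrow> int ^ 'd \<Rightarrow> 'w \<Rightarrow> bool" where
  "quiet k i \<omega> \<longleftrightarrow> nA k i \<omega> = 0 \<and> nD k marks i \<omega> = 0"

definition idle :: "nat \<Rightarrow> 'w set" where
  "idle k = {\<omega> \<in> space M. \<forall>j\<in>B. quiet k j \<omega>}"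

definition arr :: "nat \<Rightarrow> int ^ 'd \<Rightarrow> 'w set" where
  "arr k i = {\<omega> \<in> space M. nA k i \<omega> = 1 \<and> nD k marks i \<omega> = 0 \<and> (\<forall>j\<in>B - {i}. quiet k j \<omega>)}"

definition dep :: "nat \<Rightarrow> int ^ 'd \<Rightarrow> real \<Rightarrow> 'w set" where
  "dep k i r = {\<omega> \<in> space M. nA k i \<omega> = 0 \<and> nD k {0..r} i \<omega> = 1 \<and> nD k {r<..1 / a0} i \<omega> = 0
     \<and> (\<forall>j\<in>B - {i}. quiet k j \<omega>)}"

definition hit :: "nat \<Rightarrow> int ^ 'd \<Rightarrow> 'w set" where
  "hit k i = {\<omega> \<in> space M. nD k marks i \<omega> \<noteq> 0}"

lemma pred_nA: "Measurable.pred (history (win k)) (\<lambda>\<omega>. Q (nA k i \<omega>))"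
  unfolding pred_def space_history using win_borel by (intro A_count_history) auto

lemma pred_nD:
  assumes "I \<in> sets borel" "I \<subseteq> marks"
  shows "Measurable.pred (history (win k)) (\<lambda>\<omega>. Q (nD k I i \<omega>))"
proof -
  have "bounded I" using assms(2) bounded_closed_interval bounded_subset by blast
  then show ?thesis
    unfolding pred_def space_history using slab_borel[OF assms(1), of k] assms(2)
    by (intro D_count_history) (auto simp: slab_def)
qed

lemma pred_quiet: "Measurable.pred (history (win k)) (\<lambda>\<omega>. quiet k i \<omega>)"
  unfolding quiet_def
  by (intro pred_intros_logic pred_nA[where Q = "\<lambda>n. n = 0"] pred_nD[where Q = "\<lambda>n. n = 0"]) auto

lemma pred_history_sets: "{\<omega> \<in> space M. P \<omega>} \<in> sets (history U) \<longleftrightarrow> Measurable.pred (history U) P"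
  by (simp add: pred_def)

lemma idle_history: "idle k \<in> sets (history (win k))"
  unfolding idle_def pred_history_sets using finite_box by (intro pred_intros_finite pred_quiet)

lemma arr_history: "arr k i \<in> sets (history (win k))"
  unfolding arr_def pred_history_sets using finite_box
  by (intro pred_intros_logic pred_intros_finite pred_quiet pred_nA[where Q = "\<lambda>n. n = 1"]
      pred_nD[where Q = "\<lambda>n. n = 0"]) auto

lemma dep_history: "0 \<le> r \<Longrightarrow> r \<le> 1 / a0 \<Longrightarrow> dep k i r \<in> sets (history (win k))"
  unfolding dep_def pred_history_sets using finite_box
  by (intro pred_intros_logic pred_intros_finite pred_quiet pred_nA[where Q = "\<lambda>n. n = 0"]
      pred_nD[where Q = "\<lambda>n. n = 0"] pred_nD[where Q = "\<lambda>n. n = 1"]) auto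

lemma hit_history: "hit k i \<in> sets (history (win k))"
  unfolding hit_def pred_history_sets by (intro pred_nD) auto

lemma A_fin: "\<omega> \<in> space M \<Longrightarrow> finite (A i \<omega> \<inter> win k)"
  using ppp_finite[OF A_ppp] win_borel by auto

lemma D_fin: "\<omega> \<in> space M \<Longrightarrow> bounded I \<Longrightarrow> finite (D i \<omega> \<inter> slab k I)"
  using ppp_finite[OF D_ppp] win_borel[of k] by (auto simp: slab_def bounded_Times)

lemma prob_nA: "prob {\<omega> \<in> space M. nA k i \<omega> = n} = exp (- (lam * h)) * (lam * h) ^ n / fact n"
  using ppp_prob[OF A_ppp, of "win k"] win_borel[of k] by (simp add: measure_win)

lemma prob_nD:
  assumes "I \<in> sets borel" "I \<subseteq> marks"
  shows "prob {\<omega> \<in> space M. nD k I i \<omega> = n}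
     = exp (- (h * measure lborel I)) * (h * measure lborel I) ^ n / fact n"
proof -
  have I: "bounded I" using assms(2) bounded_closed_interval bounded_subset by blast
  then show ?thesis
    using ppp_prob[OF D_ppp, of "slab k I" i n] slab_borel[of I k] measure_slab[of I k] assms
    by (simp add: slab_def Times_subset_cancel2 Sigma_mono)
qed

lemma prob_hit: "prob (hit k i) \<le> h / a0"
proof -
  have "hit k i = space M - {\<omega> \<in> space M. nD k marks i \<omega> = 0}" by (auto simp: hit_def)
  moreover have "{\<omega> \<in> space M. nD k marks i \<omega> = 0} \<in> events"
    using pred_nD[where I = marks and k = k and Q = "\<lambda>n. n = 0" and i = i] sets_history_subset unfolding pred_history_sets[symmetric]
    by auto
  ultimately have "prob (hit k i) = 1 - exp (- (h * (1 / a0)))"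
    using prob_nD[where I = marks and k = k and n = 0] a0_pos by (simp add: prob_compl)
  also have "\<dots> \<le> h / a0" using exp_ge_add_one_self[of "- (h * (1 / a0))"] by simp
  finally show ?thesis .
qed

definition silence :: real where
  "silence = exp (- (kern.total_rate * h))"

lemma nA_event: "{\<omega> \<in> space M. nA k i \<omega> = n} \<in> process_events (Inl i)"
proof -
  have "{\<omega> \<in> space M. nA k i \<omega> = n} \<in> window_events (win k) (Inl i)"
    unfolding window_events_def using win_borel by (auto intro!: count_eventsI[where Q = "\<lambda>m. m = n"])
  then show ?thesis using window_events_subset by blast
qed

lemma nD_event:
  assumes "I \<in> sets borel" "I \<subseteq> marks"
  shows "{\<omega> \<in> space M. nD k I i \<omega> = n} \<in> process_events (Inr i)"
proof -
  have "bounded I" using assms(2) bounded_closed_interval bounded_subset by blast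
  then have "{\<omega> \<in> space M. nD k I i \<omega> = n} \<in> window_events (win k) (Inr i)"
    unfolding window_events_def using slab_borel[of I k] assms
    by (auto intro!: count_eventsI[where Q = "\<lambda>m. m = n"] simp: slab_def)
  then show ?thesis using window_events_subset by blast
qed

text \<open>Every event that fixes the counts of all processes of the box in one cell is an
  intersection of independent events, one per process; all but one of them say that the process
  has no atom in the cell.\<close>

lemma prob_cell_event:
  assumes i: "i \<in> B"
    and EA: "EA \<in> process_events (Inl i)" and ED: "ED \<in> process_events (Inr i)"
  shows "prob {\<omega> \<in> space M. \<omega> \<in> EA \<and> \<omega> \<in> ED \<and> (\<forall>j\<in>B - {i}. quiet k j \<omega>)}
     = prob EA * exp (lam * h) * (prob ED * exp (h / a0)) * silence"
proof -
  define zA where "zA j = {\<omega> \<in> space M. nA k j \<omega> = 0}" for j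
  define zD where "zD j = {\<omega> \<in> space M. nD k marks j \<omega> = 0}" for j
  define E where "E = case_sum (\<lambda>j. if j = i then EA else zA j) (\<lambda>j. if j = i then ED else zD j)"
  have zA: "zA j \<in> process_events (Inl j)" and zD: "zD j \<in> process_events (Inr j)" for j
    unfolding zA_def zD_def by (simp_all only: nA_event) (rule nD_event, auto)
  have E: "E p \<in> process_events p" for p
    unfolding E_def using zA zD EA ED by (cases p) auto
  have "prob (\<Inter>p\<in>B <+> B. E p) = (\<Prod>p\<in>B <+> B. prob (E p))"
    using finite_box box_nonempty E by (intro prob_INT_process) auto
  also have "(\<Inter>p\<in>B <+> B. E p) = {\<omega> \<in> space M. \<omega> \<in> EA \<and> \<omega> \<in> ED \<and> (\<forall>j\<in>B - {i}. quiet k j \<omega>)}"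
  proof -
    have "EA \<subseteq> space M" using EA process_events_subset sets.sets_into_space by blast
    moreover have "(\<Inter>p\<in>B <+> B. E p) = (\<Inter>j\<in>B. E (Inl j)) \<inter> (\<Inter>j\<in>B. E (Inr j))"
      by (simp add: Plus_def INT_Un image_image)
    ultimately show ?thesis using i
      by (auto simp: E_def quiet_def zA_def zD_def split: if_splits)
  qed
  also have "(\<Prod>p\<in>B <+> B. prob (E p)) = (\<Prod>j\<in>B. prob (E (Inl j))) * (\<Prod>j\<in>B. prob (E (Inr j)))"
    using finite_box by (subst prod.Plus) (auto simp: comp_def)
  \<comment> \<open>The factor of site \<open>i\<close> is written as that of an empty cell times a
    correction, so that \<open>silence\<close> splits off from the product.\<close>
  also have "(\<Prod>j\<in>B. prob (E (Inl j))) = (\<Prod>j\<in>B. exp (- (lam * h)) * (if j = i then prob EA * exp (lam * h) else 1))"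
    using prob_nA[where k = k and n = 0] by (intro prod.cong) (auto simp: E_def zA_def exp_minus)
  also have "\<dots> = exp (- (lam * h)) ^ card B * (prob EA * exp (lam * h))"
    using finite_box i by (simp add: prod.distrib)
  also have "(\<Prod>j\<in>B. prob (E (Inr j))) = (\<Prod>j\<in>B. exp (- (h / a0)) * (if j = i then prob ED * exp (h / a0) else 1))"
    using prob_nD[where I = marks and k = k and n = 0] a0_pos by (intro prod.cong) (auto simp: E_def zD_def exp_minus)
  also have "\<dots> = exp (- (h / a0)) ^ card B * (prob ED * exp (h / a0))"
    using finite_box i by (simp add: prod.distrib)
  finally have "prob {\<omega> \<in> space M. \<omega> \<in> EA \<and> \<omega> \<in> ED \<and> (\<forall>j\<in>B - {i}. quiet k j \<omega>)}
     = prob EA * exp (lam * h) * (prob ED * exp (h / a0)) * (exp (- (lam * h)) ^ card B * exp (- (h / a0)) ^ card B)"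
    by simp
  also have "exp (- (lam * h)) ^ card B * exp (- (h / a0)) ^ card B = silence"
    unfolding silence_def kern.total_rate_def
    by (simp add: exp_of_nat_mult[symmetric] exp_add[symmetric] algebra_simps)
  finally show ?thesis .
qed

lemma prob_arr:
  assumes "i \<in> B"
  shows "prob (arr k i) = lam * h * silence"
proof -
  have "arr k i = {\<omega> \<in> space M. \<omega> \<in> {\<omega> \<in> space M. nA k i \<omega> = 1} \<and> \<omega> \<in> {\<omega> \<in> space M. nD k marks i \<omega> = 0}
      \<and> (\<forall>j\<in>B - {i}. quiet k j \<omega>)}"
    by (auto simp: arr_def)
  also have "prob \<dots> = prob {\<omega> \<in> space M. nA k i \<omega> = 1} * exp (lam * h)
     * (prob {\<omega> \<in> space M. nD k marks i \<omega> = 0} * exp (h / a0)) * silence"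
    by (intro prob_cell_event assms nA_event nD_event) auto
  also have "\<dots> = lam * h * silence"
    using a0_pos by (subst prob_nA, subst prob_nD) (auto simp: exp_minus)
  finally show ?thesis .
qed

lemma prob_idle: "prob (idle k) = silence"
proof -
  obtain i where i: "i \<in> B" using box_nonempty by blast
  have "idle k = {\<omega> \<in> space M. \<omega> \<in> {\<omega> \<in> space M. nA k i \<omega> = 0} \<and> \<omega> \<in> {\<omega> \<in> space M. nD k marks i \<omega> = 0}
      \<and> (\<forall>j\<in>B - {i}. quiet k j \<omega>)}"
    using i by (auto simp: idle_def quiet_def)
  also have "prob \<dots> = prob {\<omega> \<in> space M. nA k i \<omega> = 0} * exp (lam * h)
     * (prob {\<omega> \<in> space M. nD k marks i \<omega> = 0} * exp (h / a0)) * silence"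
    by (intro prob_cell_event i nA_event nD_event) auto
  also have "\<dots> = silence"
    using a0_pos by (subst prob_nA, subst prob_nD) (auto simp: exp_minus)
  finally show ?thesis .
qed

lemma prob_dep:
  assumes i: "i \<in> B" and r: "0 \<le> r" "r \<le> 1 / a0"
  shows "prob (dep k i r) = r * h * silence"
proof -
  let ?L = "{\<omega> \<in> space M. nD k {0..r} i \<omega> = 1}" and ?U = "{\<omega> \<in> space M. nD k {r<..1 / a0} i \<omega> = 0}"
  have LU: "?L \<in> process_events (Inr i)" "?U \<in> process_events (Inr i)"
    using r by (auto intro!: nD_event)
  have dep_eq: "dep k i r = {\<omega> \<in> space M. \<omega> \<in> {\<omega> \<in> space M. nA k i \<omega> = 0} \<and> \<omega> \<in> ?L \<inter> ?U
      \<and> (\<forall>j\<in>B - {i}. quiet k j \<omega>)}"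
    by (auto simp: dep_def)
  have 1: "prob (dep k i r) = prob {\<omega> \<in> space M. nA k i \<omega> = 0} * exp (lam * h)
     * (prob (?L \<inter> ?U) * exp (h / a0)) * silence"
    unfolding dep_eq by (rule prob_cell_event[OF i nA_event process_events_Int[OF LU]])
  \<comment> \<open>Thinning: marks up to \<open>r\<close> and marks above \<open>r\<close> lie in
    disjoint regions. The exponentials recombine to that of the whole mark interval, and a
    probability linear in \<open>r\<close> remains.\<close>
  have 2: "prob (?L \<inter> ?U) = prob ?L * prob ?U"
  proof -
    have "slab k {0..r} \<in> sets borel" "bounded (slab k {0..r})"
      "slab k {r<..1 / a0} \<in> sets borel" "bounded (slab k {r<..1 / a0})"
      by (simp_all add: slab_borel)
    then have "?L \<in> count_events M (D i) (slab k {0..r})" "?U \<in> count_events M (D i) (slab k {r<..1 / a0})"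
      by (simp_all add: count_eventsI[where Q = "\<lambda>n. n = Suc 0"] count_eventsI[where Q = "\<lambda>n. n = 0"])
    moreover have "slab k {0..r} \<subseteq> UNIV \<times> marks" "slab k {r<..1 / a0} \<subseteq> UNIV \<times> marks"
      "slab k {0..r} \<inter> slab k {r<..1 / a0} = {}"
      unfolding slab_def using r by auto
    ultimately show ?thesis by (intro count_events_indep[OF D_ppp])
  qed
  have 3: "prob ?L = exp (- (h * r)) * (h * r)" using r by (subst prob_nD) auto
  have 4: "prob ?U = exp (- (h * (1 / a0 - r)))" using r by (subst prob_nD) auto
  have 5: "exp (- (h * (1 / a0 - r))) = exp (h * r) / exp (h / a0)"
    by (simp add: right_diff_distrib exp_diff)
  show ?thesis unfolding 1 2 3 4 5 by (subst prob_nA) (simp add: exp_minus)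
qed

lemma arr_dep_disjoint:
  assumes "\<omega> \<in> arr k i" "i \<in> B" "j \<in> B" "\<omega> \<in> dep k j r"
  shows False
proof (cases "i = j")
  case False
  then have "quiet k i \<omega>" using assms unfolding dep_def by auto
  then show False using assms(1) by (auto simp: arr_def quiet_def)
qed (use assms in \<open>auto simp: arr_def dep_def\<close>)

lemma arr_unique: "\<omega> \<in> arr k i \<Longrightarrow> \<omega> \<in> arr k j \<Longrightarrow> i \<in> B \<Longrightarrow> j \<in> B \<Longrightarrow> i = j"
  by (rule ccontr) (auto simp: arr_def quiet_def)

lemma dep_unique:
  assumes "\<omega> \<in> dep k i r" "\<omega> \<in> dep k j r'" "i \<in> B" "j \<in> B" "r \<le> 1 / a0"
  shows "i = j"
proof (rule ccontr)
  assume "i \<noteq> j"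
  then have q: "quiet k i \<omega>" and \<omega>: "\<omega> \<in> space M" using assms unfolding dep_def by auto
  have "nD k {0..r} i \<omega> \<le> nD k marks i \<omega>"
    using D_fin[OF \<omega>, of marks] assms(5) by (intro card_mono) (auto simp: slab_def)
  with q show False using assms(1) by (auto simp: dep_def quiet_def)
qed

section \<open>The Markov chain on the box and its semigroup\<close>

text \<open>A cell with several atoms is ignored, so that one step of the chain is exactly
  \<open>kern.trans_op (h * silence)\<close>, without an error term in \<open>h\<close>.\<close>

primrec chain :: "nat \<Rightarrow> 'w \<Rightarrow> int ^ 'd \<Rightarrow> nat" where
  "chain 0 \<omega> = (\<lambda>_. 0)"
| "chain (Suc k) \<omega> = (\<lambda>i. if i \<in> B
      then chain k \<omega> i + of_bool (\<omega> \<in> arr k i) - of_bool (\<omega> \<in> dep k i (kern.rate (chain k \<omega>) i))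
      else 0)"

text \<open>Each queue grows by at most one per step, so the chain has finitely many possible values
  at step \<open>k\<close>; expectations become finite sums and integrability is automatic.\<close>

definition states :: "nat \<Rightarrow> (int ^ 'd \<Rightarrow> nat) set" where
  "states k = {y. \<forall>i. (i \<in> B \<longrightarrow> y i \<in> {..k}) \<and> (i \<notin> B \<longrightarrow> y i = 0)}"

lemma finite_states: "finite (states k)"
  unfolding states_def by (rule finite_set_of_finite_funs) (use finite_box in auto)

lemma chain_outside: "i \<notin> B \<Longrightarrow> chain k \<omega> i = 0"
  by (cases k) auto

lemma chain_le: "chain k \<omega> i \<le> k"
proof (induction k)
  case (Suc k)
  then show ?case by (auto simp: of_bool_def)
qed simp

lemma chain_states: "chain k \<omega> \<in> states k"
  by (auto simp: states_def chain_le chain_outside)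

lemma pred_chain: "Measurable.pred (history (past k)) (\<lambda>\<omega>. chain k \<omega> = y)"
proof (induction k arbitrary: y)
  case 0
  show ?case by simp
next
  case (Suc k)
  have IH: "Measurable.pred (history (past (Suc k))) (\<lambda>\<omega>. chain k \<omega> = y)" for y
    using Suc sets_history_mono[OF past_subset(1), of k] by (auto simp: pred_def)
  have ev: "Measurable.pred (history (past (Suc k))) (\<lambda>\<omega>. \<omega> \<in> E)" if "E \<in> sets (history (win k))" for E
  proof -
    have "{\<omega> \<in> space M. \<omega> \<in> E} = E" using that sets.sets_into_space[OF that] by auto
    then show ?thesis using that sets_history_mono[OF past_subset(2), of k] by (auto simp: pred_def)
  qed
  \<comment> \<open>The threshold inside \<open>dep\<close> depends on the random state. Quantifying
    over the finitely many values \<open>z\<close> of that state replaces it by fixed events of the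
    cell.\<close>
  have eq: "chain (Suc k) \<omega> = y \<longleftrightarrow> (\<exists>z\<in>states k. chain k \<omega> = z \<and>
      (\<forall>i\<in>B. (\<omega> \<in> arr k i \<longrightarrow> \<omega> \<in> dep k i (kern.rate z i) \<longrightarrow> y i = z i) \<and>
          (\<omega> \<in> arr k i \<longrightarrow> \<omega> \<notin> dep k i (kern.rate z i) \<longrightarrow> y i = z i + 1) \<and>
          (\<omega> \<notin> arr k i \<longrightarrow> \<omega> \<in> dep k i (kern.rate z i) \<longrightarrow> y i = z i - 1) \<and>
          (\<omega> \<notin> arr k i \<longrightarrow> \<omega> \<notin> dep k i (kern.rate z i) \<longrightarrow> y i = z i))
      \<and> (\<forall>i. i \<notin> B \<longrightarrow> y i = 0))" (is "?L \<longleftrightarrow> ?R") for \<omega>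
  proof -
    have *: "(v + of_bool P - of_bool Q = u) \<longleftrightarrow> (P \<longrightarrow> Q \<longrightarrow> u = v) \<and> (P \<longrightarrow> \<not> Q \<longrightarrow> u = v + 1)
       \<and> (\<not> P \<longrightarrow> Q \<longrightarrow> u = v - 1) \<and> (\<not> P \<longrightarrow> \<not> Q \<longrightarrow> u = v)" for u v :: nat and P Q
      by (cases P; cases Q) auto
    have "?R \<longleftrightarrow> (\<forall>i\<in>B. chain k \<omega> i + of_bool (\<omega> \<in> arr k i)
        - of_bool (\<omega> \<in> dep k i (kern.rate (chain k \<omega>) i)) = y i) \<and> (\<forall>i. i \<notin> B \<longrightarrow> y i = 0)"
      using chain_states[of k \<omega>] by (simp add: *)
    moreover have "(\<forall>i. (if i \<in> B then g i else 0) = y i) \<longleftrightarrow> (\<forall>i\<in>B. g i = y i) \<and> (\<forall>i. i \<notin> B \<longrightarrow> y i = 0)"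
      for g by metis
    ultimately show ?thesis by (simp only: chain.simps fun_eq_iff)
  qed
  have site: "Measurable.pred (history (past (Suc k))) (\<lambda>\<omega>.
      (\<omega> \<in> arr k i \<longrightarrow> \<omega> \<in> dep k i (kern.rate z i) \<longrightarrow> y i = z i) \<and>
      (\<omega> \<in> arr k i \<longrightarrow> \<omega> \<notin> dep k i (kern.rate z i) \<longrightarrow> y i = z i + 1) \<and>
      (\<omega> \<notin> arr k i \<longrightarrow> \<omega> \<in> dep k i (kern.rate z i) \<longrightarrow> y i = z i - 1) \<and>
      (\<omega> \<notin> arr k i \<longrightarrow> \<omega> \<notin> dep k i (kern.rate z i) \<longrightarrow> y i = z i))" if "i \<in> B" for i z
  proof -
    have [measurable]: "Measurable.pred (history (past (Suc k))) (\<lambda>\<omega>. \<omega> \<in> arr k i)"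
      "Measurable.pred (history (past (Suc k))) (\<lambda>\<omega>. \<omega> \<in> dep k i (kern.rate z i))"
      using ev arr_history dep_history kern.rate_nonneg kern.rate_le[OF that] by simp_all
    show ?thesis by measurable
  qed
  show ?case unfolding eq
  proof (rule pred_intros_finite(4)[OF finite_states])
    fix z
    note IH[measurable]
    have [measurable]: "Measurable.pred (history (past (Suc k))) (\<lambda>\<omega>. \<forall>i\<in>B.
      (\<omega> \<in> arr k i \<longrightarrow> \<omega> \<in> dep k i (kern.rate z i) \<longrightarrow> y i = z i) \<and>
      (\<omega> \<in> arr k i \<longrightarrow> \<omega> \<notin> dep k i (kern.rate z i) \<longrightarrow> y i = z i + 1) \<and>
      (\<omega> \<notin> arr k i \<longrightarrow> \<omega> \<in> dep k i (kern.rate z i) \<longrightarrow> y i = z i - 1) \<and>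
      (\<omega> \<notin> arr k i \<longrightarrow> \<omega> \<notin> dep k i (kern.rate z i) \<longrightarrow> y i = z i))"
      by (rule pred_intros_finite(3)[OF finite_box site])
    show "Measurable.pred (history (past (Suc k))) (\<lambda>\<omega>. chain k \<omega> = z \<and> (\<forall>i\<in>B.
      (\<omega> \<in> arr k i \<longrightarrow> \<omega> \<in> dep k i (kern.rate z i) \<longrightarrow> y i = z i) \<and>
      (\<omega> \<in> arr k i \<longrightarrow> \<omega> \<notin> dep k i (kern.rate z i) \<longrightarrow> y i = z i + 1) \<and>
      (\<omega> \<notin> arr k i \<longrightarrow> \<omega> \<in> dep k i (kern.rate z i) \<longrightarrow> y i = z i - 1) \<and>
      (\<omega> \<notin> arr k i \<longrightarrow> \<omega> \<notin> dep k i (kern.rate z i) \<longrightarrow> y i = z i)) \<and> (\<forall>i. i \<notin> B \<longrightarrow> y i = 0))"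
      by (intro pred_intros_logic(3) IH) measurable
  qed
qed

text \<open>The arrival and departure events of all sites of the box exclude each other within a
  cell, so at most one summand is nonzero and it is the actual increment.\<close>

lemma chain_step_identity:
  fixes f :: "(int ^ 'd \<Rightarrow> nat) \<Rightarrow> real" and k :: nat
  defines "g \<equiv> \<lambda>\<omega> y i. indicator (arr k i) \<omega> * (f (y(i := y i + 1)) - f y)
        + indicator (dep k i (kern.rate y i)) \<omega> * (f (y(i := y i - 1)) - f y)"
  shows "f (chain (Suc k) \<omega>) = f (chain k \<omega>) + (\<Sum>i\<in>B. g \<omega> (chain k \<omega>) i)"
proof -
  define y where "y = chain k \<omega>"
  have out: "y j = 0" if "j \<notin> B" for j using that chain_outside by (simp add: y_def)
  have single: "f (chain (Suc k) \<omega>) = f y + (\<Sum>i\<in>B. g \<omega> y i)"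
    if i: "i \<in> B" and z: "\<And>j. j \<in> B \<Longrightarrow> j \<noteq> i \<Longrightarrow> \<omega> \<notin> arr k j \<and> \<omega> \<notin> dep k j (kern.rate y j)" for i
  proof -
    have "(\<Sum>j\<in>B. g \<omega> y j) = (\<Sum>j\<in>B. if j = i then g \<omega> y i else 0)"
      using z by (intro sum.cong) (auto simp: g_def)
    also have "\<dots> = g \<omega> y i" using i finite_box by simp
    finally have 1: "(\<Sum>j\<in>B. g \<omega> y j) = g \<omega> y i" .
    have "chain (Suc k) \<omega> = y(i := y i + of_bool (\<omega> \<in> arr k i) - of_bool (\<omega> \<in> dep k i (kern.rate y i)))"
      using z i out by (auto simp: fun_eq_iff y_def[symmetric])
    then show ?thesis unfolding 1
      using arr_dep_disjoint[of \<omega> k i i "kern.rate y i"] i by (auto simp: g_def)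
  qed
  show ?thesis
  proof (cases "\<exists>i\<in>B. \<omega> \<in> arr k i \<or> \<omega> \<in> dep k i (kern.rate y i)")
    case True
    then obtain i where i: "i \<in> B" "\<omega> \<in> arr k i \<or> \<omega> \<in> dep k i (kern.rate y i)" by blast
    have "f (chain (Suc k) \<omega>) = f y + (\<Sum>i\<in>B. g \<omega> y i)"
    proof (rule single[OF i(1)])
      show "\<omega> \<notin> arr k j \<and> \<omega> \<notin> dep k j (kern.rate y j)" if "j \<in> B" "j \<noteq> i" for j
        using i that arr_dep_disjoint arr_unique dep_unique kern.rate_le by metis
    qed
    then show ?thesis by (simp only: y_def)
  next
    case False
    obtain i where "i \<in> B" using box_nonempty by blast
    from single[OF this] False have "f (chain (Suc k) \<omega>) = f y + (\<Sum>i\<in>B. g \<omega> y i)" by blast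
    then show ?thesis by (simp only: y_def)
  qed
qed

lemma past_win_indep:
  "E \<in> sets (history (past k)) \<Longrightarrow> E' \<in> sets (history (win k)) \<Longrightarrow> prob (E \<inter> E') = prob E * prob E'"
  using history_indep[OF past_disjoint] by blast

definition chain_at :: "nat \<Rightarrow> (int ^ 'd \<Rightarrow> nat) \<Rightarrow> 'w set" where
  "chain_at k y = {\<omega> \<in> space M. chain k \<omega> = y}"

lemma chain_at_history: "chain_at k y \<in> sets (history (past k))"
  unfolding chain_at_def pred_history_sets by (rule pred_chain)

lemma chain_at_events: "chain_at k y \<in> events"
  using chain_at_history sets_history_subset by blast

lemma sum_chain_at:
  fixes F :: "(int ^ 'd \<Rightarrow> nat) \<Rightarrow> real"
  assumes "\<omega> \<in> space M"
  shows "F (chain k \<omega>) = (\<Sum>y\<in>states k. indicator (chain_at k y) \<omega> * F y)"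
proof -
  have "(\<Sum>y\<in>states k. indicator (chain_at k y) \<omega> * F y) = (\<Sum>y\<in>states k. if y = chain k \<omega> then F y else 0)"
    using assms by (intro sum.cong) (auto simp: chain_at_def indicator_def)
  then show ?thesis using finite_states chain_states by simp
qed

lemma integrable_indicator_mult:
  fixes c :: real
  assumes "E \<in> events"
  shows "integrable M (\<lambda>\<omega>. indicator E \<omega> * c)"
proof -
  have "integrable M (indicator E :: 'w \<Rightarrow> real)"
    using assms by (intro integrable_real_indicator) (simp_all add: emeasure_eq_measure)
  then show ?thesis by simp
qed

lemma expectation_chain_states:
  fixes f :: "(int ^ 'd \<Rightarrow> nat) \<Rightarrow> real"
  shows "expectation (\<lambda>\<omega>. f (chain k \<omega>)) = (\<Sum>y\<in>states k. prob (chain_at k y) * f y)"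
    and "integrable M (\<lambda>\<omega>. f (chain k \<omega>))"
proof -
  have int: "integrable M (\<lambda>\<omega>. \<Sum>y\<in>states k. indicator (chain_at k y) \<omega> * f y)"
    by (intro Bochner_Integration.integrable_sum integrable_indicator_mult chain_at_events)
  then show "integrable M (\<lambda>\<omega>. f (chain k \<omega>))"
    using Bochner_Integration.integrable_cong[of M M "\<lambda>\<omega>. f (chain k \<omega>)"
        "\<lambda>\<omega>. \<Sum>y\<in>states k. indicator (chain_at k y) \<omega> * f y", OF refl sum_chain_at] by blast
  have "expectation (\<lambda>\<omega>. f (chain k \<omega>)) = expectation (\<lambda>\<omega>. \<Sum>y\<in>states k. indicator (chain_at k y) \<omega> * f y)"
    by (intro Bochner_Integration.integral_cong refl sum_chain_at)
  also have "\<dots> = (\<Sum>y\<in>states k. expectation (\<lambda>\<omega>. indicator (chain_at k y) \<omega> * f y))"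
    by (intro Bochner_Integration.integral_sum integrable_indicator_mult chain_at_events)
  also have "\<dots> = (\<Sum>y\<in>states k. prob (chain_at k y) * f y)"
    using chain_at_events by simp
  finally show "expectation (\<lambda>\<omega>. f (chain k \<omega>)) = (\<Sum>y\<in>states k. prob (chain_at k y) * f y)" .
qed

text \<open>The Markov property by hand: split by the current state, which is determined by the
  past, and use that the cell is independent of it. The move probabilities
  \<open>lam * h * silence\<close> and \<open>kern.rate y i * h * silence\<close> show that the step
  size is \<open>h * silence\<close>.\<close>

lemma expectation_chain_step:
  fixes f :: "(int ^ 'd \<Rightarrow> nat) \<Rightarrow> real"
  shows "expectation (\<lambda>\<omega>. f (chain (Suc k) \<omega>))
     = expectation (\<lambda>\<omega>. kern.trans_op (h * silence) f (chain k \<omega>))"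
proof -
  let ?u = "\<lambda>y i. f (y(i := y i + 1)) - f y" and ?d = "\<lambda>y i. f (y(i := y i - 1)) - f y"
  have ev: "arr k i \<in> events" "dep k i (kern.rate y i) \<in> events" if "i \<in> B" for i y
    using arr_history dep_history kern.rate_nonneg kern.rate_le that sets_history_subset by blast+
  have "f (chain (Suc k) \<omega>) = (\<Sum>y\<in>states k. indicator (chain_at k y) \<omega> * f y + (\<Sum>i\<in>B.
      indicator (chain_at k y \<inter> arr k i) \<omega> * ?u y i + indicator (chain_at k y \<inter> dep k i (kern.rate y i)) \<omega> * ?d y i))"
    if "\<omega> \<in> space M" for \<omega>
    unfolding chain_step_identity
    by (subst sum_chain_at[OF that, of "\<lambda>y. f y + (\<Sum>i\<in>B. indicator (arr k i) \<omega> * ?u y i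
        + indicator (dep k i (kern.rate y i)) \<omega> * ?d y i)"])
      (simp add: indicator_inter_arith distrib_left sum_distrib_left mult.assoc)
  then have "expectation (\<lambda>\<omega>. f (chain (Suc k) \<omega>)) = expectation (\<lambda>\<omega>.
      \<Sum>y\<in>states k. indicator (chain_at k y) \<omega> * f y + (\<Sum>i\<in>B.
      indicator (chain_at k y \<inter> arr k i) \<omega> * ?u y i + indicator (chain_at k y \<inter> dep k i (kern.rate y i)) \<omega> * ?d y i))"
    by (intro Bochner_Integration.integral_cong refl)
  also have "\<dots> = (\<Sum>y\<in>states k. prob (chain_at k y) * f y + (\<Sum>i\<in>B.
      prob (chain_at k y \<inter> arr k i) * ?u y i + prob (chain_at k y \<inter> dep k i (kern.rate y i)) * ?d y i))"
  proof -
    note I = integrable_indicator_mult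
    have J: "integrable M (\<lambda>\<omega>. indicator (chain_at k y \<inter> arr k i) \<omega> * ?u y i
        + indicator (chain_at k y \<inter> dep k i (kern.rate y i)) \<omega> * ?d y i)" if "i \<in> B" for y i
      using ev[OF that] chain_at_events by (intro Bochner_Integration.integrable_add I sets.Int)
    have S: "integrable M (\<lambda>\<omega>. \<Sum>i\<in>B. indicator (chain_at k y \<inter> arr k i) \<omega> * ?u y i
        + indicator (chain_at k y \<inter> dep k i (kern.rate y i)) \<omega> * ?d y i)" for y
      by (intro Bochner_Integration.integrable_sum J)
    have P: "expectation (\<lambda>\<omega>. indicator E \<omega> * (c :: real)) = prob E * c" if "E \<in> events" for E c
      using that by simp
    have "expectation (\<lambda>\<omega>. indicator (chain_at k y) \<omega> * f y + (\<Sum>i\<in>B.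
        indicator (chain_at k y \<inter> arr k i) \<omega> * ?u y i + indicator (chain_at k y \<inter> dep k i (kern.rate y i)) \<omega> * ?d y i))
      = prob (chain_at k y) * f y + (\<Sum>i\<in>B.
        prob (chain_at k y \<inter> arr k i) * ?u y i + prob (chain_at k y \<inter> dep k i (kern.rate y i)) * ?d y i)" for y
    proof (subst Bochner_Integration.integral_add[OF I[OF chain_at_events] S], rule arg_cong2[where f = "(+)"])
      show "expectation (\<lambda>\<omega>. \<Sum>i\<in>B. indicator (chain_at k y \<inter> arr k i) \<omega> * ?u y i
          + indicator (chain_at k y \<inter> dep k i (kern.rate y i)) \<omega> * ?d y i)
        = (\<Sum>i\<in>B. prob (chain_at k y \<inter> arr k i) * ?u y i + prob (chain_at k y \<inter> dep k i (kern.rate y i)) * ?d y i)"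
      proof (subst Bochner_Integration.integral_sum[OF J], assumption, rule sum.cong[OF refl])
        fix i assume i: "i \<in> B"
        show "expectation (\<lambda>\<omega>. indicator (chain_at k y \<inter> arr k i) \<omega> * ?u y i
          + indicator (chain_at k y \<inter> dep k i (kern.rate y i)) \<omega> * ?d y i)
          = prob (chain_at k y \<inter> arr k i) * ?u y i + prob (chain_at k y \<inter> dep k i (kern.rate y i)) * ?d y i"
        proof -
          have e: "chain_at k y \<inter> arr k i \<in> events" "chain_at k y \<inter> dep k i (kern.rate y i) \<in> events"
            using ev[OF i] chain_at_events by auto
          show ?thesis
            by (simp only: Bochner_Integration.integral_add[OF I[OF e(1)] I[OF e(2)]] P[OF e(1)] P[OF e(2)])
        qed
      qed
    qed (rule P[OF chain_at_events])
    then show ?thesis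
      by (simp only: Bochner_Integration.integral_sum[OF Bochner_Integration.integrable_add[OF I[OF chain_at_events] S]])
  qed
  also have "\<dots> = (\<Sum>y\<in>states k. prob (chain_at k y) * kern.trans_op (h * silence) f y)"
  proof (rule sum.cong[OF refl])
    fix y
    have "prob (chain_at k y \<inter> arr k i) * ?u y i + prob (chain_at k y \<inter> dep k i (kern.rate y i)) * ?d y i
       = prob (chain_at k y) * (h * silence * (lam * ?u y i + kern.rate y i * ?d y i))" if i: "i \<in> B" for i
    proof -
      have "prob (chain_at k y \<inter> arr k i) = prob (chain_at k y) * (lam * h * silence)"
        using past_win_indep[OF chain_at_history arr_history] prob_arr[OF i] by simp
      moreover have "prob (chain_at k y \<inter> dep k i (kern.rate y i)) = prob (chain_at k y) * (kern.rate y i * h * silence)"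
        using past_win_indep[OF chain_at_history dep_history[OF kern.rate_nonneg kern.rate_le[OF i]]]
          prob_dep[OF i kern.rate_nonneg kern.rate_le[OF i]] by simp
      ultimately show ?thesis by (simp only: algebra_simps)
    qed
    then have "prob (chain_at k y) * f y + (\<Sum>i\<in>B.
      prob (chain_at k y \<inter> arr k i) * ?u y i + prob (chain_at k y \<inter> dep k i (kern.rate y i)) * ?d y i)
      = prob (chain_at k y) * f y + prob (chain_at k y) * (h * silence * kern.gen f y)"
      unfolding kern.gen_def by (simp only: sum_distrib_left cong: sum.cong)
    then show "prob (chain_at k y) * f y + (\<Sum>i\<in>B.
      prob (chain_at k y \<inter> arr k i) * ?u y i + prob (chain_at k y \<inter> dep k i (kern.rate y i)) * ?d y i)
      = prob (chain_at k y) * kern.trans_op (h * silence) f y"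
      unfolding kern.trans_op_def by (simp only: distrib_left)
  qed
  also have "\<dots> = expectation (\<lambda>\<omega>. kern.trans_op (h * silence) f (chain k \<omega>))"
    by (rule expectation_chain_states(1)[symmetric])
  finally show ?thesis .
qed

lemma expectation_chain:
  fixes f :: "(int ^ 'd \<Rightarrow> nat) \<Rightarrow> real"
  shows "expectation (\<lambda>\<omega>. f (chain k \<omega>)) = (kern.trans_op (h * silence) ^^ k) f (\<lambda>_. 0)"
proof (induction k arbitrary: f)
  case (Suc k)
  then show ?case by (simp add: expectation_chain_step funpow_swap1 del: chain.simps)
qed (simp add: prob_space)

section \<open>Agreement of the chain with the infinite system\<close>

text \<open>At most one atom, of whatever kind and mark, in the whole box during the cell.\<close>

definition good :: "nat \<Rightarrow> 'w set" where
  "good k = idle k \<union> ((\<Union>i\<in>B. arr k i) \<union> (\<Union>i\<in>B. dep k i (1 / a0)))"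

lemma good_events: "good k \<in> events"
proof -
  have "idle k \<in> events" "arr k i \<in> events" "dep k i (1 / a0) \<in> events" for i
    using history_events[OF idle_history] history_events[OF arr_history]
      history_events[OF dep_history[of "1 / a0"]] a0_pos by simp_all
  then show ?thesis unfolding good_def using finite_box by (intro sets.Un sets.finite_UN) auto
qed

text \<open>A Poisson count of mean \<open>u\<close> exceeds 1 with probability
  \<open>1 - exp (- u) * (1 + u)\<close>. The second order in \<open>h\<close> is essential, because
  the bound is later summed over a number of cells of order \<open>1 / h\<close>.\<close>

lemma prob_not_good: "prob (space M - good k) \<le> (kern.total_rate * h)\<^sup>2"
proof -
  define u where "u = kern.total_rate * h"
  have ev: "idle k \<in> events" "arr k i \<in> events" "dep k i (1 / a0) \<in> events" for i
    using history_events[OF idle_history] history_events[OF arr_history]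
      history_events[OF dep_history[of "1 / a0"]] a0_pos by simp_all
  have 1: "prob (\<Union>i\<in>B. arr k i) = (\<Sum>i\<in>B. prob (arr k i))"
    using finite_box ev arr_unique
    by (intro finite_measure_finite_Union) (auto simp: disjoint_family_on_def)
  have 2: "prob (\<Union>i\<in>B. dep k i (1 / a0)) = (\<Sum>i\<in>B. prob (dep k i (1 / a0)))"
    using finite_box ev dep_unique
    by (intro finite_measure_finite_Union) (auto simp: disjoint_family_on_def)
  have idle_arr: "idle k \<inter> (\<Union>i\<in>B. arr k i) = {}"
    by (auto simp: idle_def arr_def quiet_def)
  have idle_dep: "idle k \<inter> (\<Union>i\<in>B. dep k i (1 / a0)) = {}"
    by (auto simp: idle_def dep_def quiet_def)
  have arr_dep: "(\<Union>i\<in>B. arr k i) \<inter> (\<Union>i\<in>B. dep k i (1 / a0)) = {}"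
    using arr_dep_disjoint by blast
  have m: "(\<Union>i\<in>B. arr k i) \<in> events" "(\<Union>i\<in>B. dep k i (1 / a0)) \<in> events"
    using ev finite_box by (auto intro!: sets.finite_UN)
  have "prob (good k) = prob (idle k) + (prob (\<Union>i\<in>B. arr k i) + prob (\<Union>i\<in>B. dep k i (1 / a0)))"
    unfolding good_def using ev m idle_arr idle_dep arr_dep
    by (subst finite_measure_Union; (subst finite_measure_Union)?) auto
  also have "\<dots> = silence * (1 + u)"
    unfolding 1 2 using a0_pos
    by (simp add: prob_idle prob_arr prob_dep u_def kern.total_rate_def algebra_simps)
  finally have "prob (space M - good k) = 1 - silence * (1 + u)"
    using good_events by (simp add: prob_compl)
  also have "\<dots> \<le> 1 - (1 - u) * (1 + u)"
  proof -
    have "0 \<le> u" unfolding u_def kern.total_rate_def using h_pos lam_pos a0_pos by simp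
    moreover have "1 - u \<le> silence"
      unfolding silence_def using exp_ge_add_one_self[of "- u"] by (simp add: u_def)
    ultimately have "(1 - u) * (1 + u) \<le> silence * (1 + u)" by (intro mult_right_mono) auto
    then show ?thesis by simp
  qed
  also have "\<dots> = u\<^sup>2" by (simp add: power2_eq_square algebra_simps)
  finally show ?thesis by (simp add: u_def)
qed

lemma D_marks:
  assumes "\<omega> \<in> space M"
  shows "D i \<omega> \<inter> (win k \<times> UNIV) = D i \<omega> \<inter> slab k marks"
proof -
  have "D i \<omega> \<subseteq> UNIV \<times> marks"
    using D_ppp[of i, unfolded poisson_point_process_def, THEN conjunct1] assms by blast
  then show ?thesis unfolding slab_def by blast
qed

lemma quiet_empty:
  assumes "\<omega> \<in> space M" "quiet k i \<omega>"
  shows "A i \<omega> \<inter> win k = {}" "D i \<omega> \<inter> (win k \<times> UNIV) = {}"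
  using assms A_fin[of \<omega> i k] D_fin[of \<omega> marks i k] by (auto simp: quiet_def D_marks)

text \<open>Counts are translated back into atoms. In the last alternative one mark \<open>u\<close>
  decides \<open>dep\<close> for all thresholds at once, so the state-dependent threshold of the
  chain can be inserted.\<close>

lemma good_cases:
  assumes "\<omega> \<in> good k" "i \<in> B"
  shows "(\<omega> \<notin> arr k i \<and> (\<forall>r\<le>1 / a0. \<omega> \<notin> dep k i r) \<and> A i \<omega> \<inter> win k = {} \<and> D i \<omega> \<inter> (win k \<times> UNIV) = {})
    \<or> (\<omega> \<in> arr k i \<and> (\<forall>r\<le>1 / a0. \<omega> \<notin> dep k i r)
        \<and> (\<exists>\<tau>. A i \<omega> \<inter> win k = {\<tau>}) \<and> D i \<omega> \<inter> (win k \<times> UNIV) = {})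
    \<or> (\<omega> \<notin> arr k i \<and> A i \<omega> \<inter> win k = {} \<and> (\<exists>\<tau> u. D i \<omega> \<inter> (win k \<times> UNIV) = {(\<tau>, u)}
        \<and> (\<forall>r. 0 \<le> r \<longrightarrow> r \<le> 1 / a0 \<longrightarrow> (\<omega> \<in> dep k i r \<longleftrightarrow> u \<le> r)))
        \<and> (\<forall>j\<in>B - {i}. A j \<omega> \<inter> win k = {} \<and> D j \<omega> \<inter> (win k \<times> UNIV) = {}))"
proof -
  have \<omega>: "\<omega> \<in> space M" using assms(1) good_events sets.sets_into_space by blast
  have no: "\<omega> \<notin> arr k i \<and> (\<forall>r\<le>1 / a0. \<omega> \<notin> dep k i r) \<and> A i \<omega> \<inter> win k = {} \<and> D i \<omega> \<inter> (win k \<times> UNIV) = {}"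
    if q: "quiet k i \<omega>"
  proof -
    have "nD k {0..r} i \<omega> \<le> nD k marks i \<omega>" if "r \<le> 1 / a0" for r
      using D_fin[OF \<omega>, of marks] that by (intro card_mono) (auto simp: slab_def)
    then have "\<omega> \<notin> dep k i r" if "r \<le> 1 / a0" for r
      using that q by (force simp: dep_def quiet_def)
    moreover have "\<omega> \<notin> arr k i" using q by (auto simp: arr_def quiet_def)
    ultimately show ?thesis using quiet_empty[OF \<omega> q] by blast
  qed
  consider "\<omega> \<in> idle k" | j where "j \<in> B" "\<omega> \<in> arr k j" | j where "j \<in> B" "\<omega> \<in> dep k j (1 / a0)"
    using assms(1) unfolding good_def by blast
  then show ?thesis
  proof cases
    case 1
    then show ?thesis using no assms(2) by (auto simp: idle_def)
  next
    case 2
    show ?thesis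
    proof (cases "i = j")
      case False
      then have "quiet k i \<omega>" using 2 assms(2) by (auto simp: arr_def)
      then show ?thesis using no by blast
    next
      case True
      have "nA k i \<omega> = 1" "nD k marks i \<omega> = 0" using 2 True by (auto simp: arr_def)
      then have "\<exists>\<tau>. A i \<omega> \<inter> win k = {\<tau>}" "D i \<omega> \<inter> (win k \<times> UNIV) = {}"
        using D_fin[OF \<omega>, of marks] by (auto simp: D_marks[OF \<omega>] card_1_singleton_iff)
      moreover have "\<omega> \<notin> dep k i r" for r using arr_dep_disjoint 2 True by blast
      ultimately show ?thesis using 2 True by blast
    qed
  next
    case 3
    show ?thesis
    proof (cases "i = j")
      case False
      then have "quiet k i \<omega>" using 3 assms(2) by (auto simp: dep_def)
      then show ?thesis using no by blast
    next
      case True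
      have *: "nA k i \<omega> = 0" "nD k marks i \<omega> = 1" "\<forall>j\<in>B - {i}. quiet k j \<omega>"
        using 3 True by (auto simp: dep_def)
      obtain p where p: "D i \<omega> \<inter> slab k marks = {p}" using *(2) by (auto simp: card_1_singleton_iff)
      obtain \<tau> u where tu: "p = (\<tau>, u)" by (cases p)
      have "(\<tau>, u) \<in> D i \<omega> \<inter> slab k marks" using p tu by simp
      then have pin: "(\<tau>, u) \<in> D i \<omega>" "\<tau> \<in> win k" "u \<in> marks" by (auto simp: slab_def)
      have "\<omega> \<in> dep k i r \<longleftrightarrow> u \<le> r" if r: "0 \<le> r" "r \<le> 1 / a0" for r
      proof -
        have lo: "D i \<omega> \<inter> slab k {0..r} = (if u \<le> r then {(\<tau>, u)} else {})"
        proof -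
          have "D i \<omega> \<inter> slab k {0..r} = (D i \<omega> \<inter> slab k marks) \<inter> (UNIV \<times> {0..r})"
            using r by (auto simp: slab_def)
          then show ?thesis using pin by (auto simp: p tu)
        qed
        have hi: "D i \<omega> \<inter> slab k {r<..1 / a0} = (if u \<le> r then {} else {(\<tau>, u)})"
        proof -
          have "D i \<omega> \<inter> slab k {r<..1 / a0} = (D i \<omega> \<inter> slab k marks) \<inter> (UNIV \<times> {r<..1 / a0})"
            using r by (auto simp: slab_def)
          then show ?thesis using pin by (auto simp: p tu)
        qed
        show ?thesis using * \<omega> by (simp add: dep_def lo hi)
      qed
      moreover have "\<omega> \<notin> arr k i" using * by (auto simp: arr_def)
      moreover have "A i \<omega> \<inter> win k = {}" using *(1) A_fin[OF \<omega>] by auto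
      moreover have "D i \<omega> \<inter> (win k \<times> UNIV) = {(\<tau>, u)}" by (simp add: D_marks[OF \<omega>] p tu)
      moreover have "\<forall>j\<in>B - {i}. A j \<omega> \<inter> win k = {} \<and> D j \<omega> \<inter> (win k \<times> UNIV) = {}"
        using *(3) quiet_empty[OF \<omega>] by blast
      ultimately show ?thesis by blast
    qed
  qed
qed

text \<open>With this, chain and infinite system follow the same local rule on good cells and differ
  only in the ratio they insert.\<close>

lemma chain_local_step:
  assumes "\<omega> \<in> good k" "i \<in> B"
  shows "chain (Suc k) \<omega> i
     = local_step (A i \<omega>) (D i \<omega>) (win k) (chain k \<omega> i) (kern.rate (chain k \<omega>) i)"
proof -
  let ?r = "kern.rate (chain k \<omega>) i"
  have r: "0 \<le> ?r" "?r \<le> 1 / a0" using kern.rate_nonneg kern.rate_le[OF assms(2)] by auto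
  have chain: "chain (Suc k) \<omega> i = chain k \<omega> i + of_bool (\<omega> \<in> arr k i) - of_bool (\<omega> \<in> dep k i ?r)"
    using assms(2) by simp
  have none: "(\<exists>\<tau> u. \<tau> \<in> win k \<and> (\<tau>, u) \<in> D i \<omega> \<and> u \<le> ?r) = False" if "D i \<omega> \<inter> (win k \<times> UNIV) = {}"
    using that by blast
  from good_cases[OF assms] show ?thesis
  proof (elim disjE conjE exE)
    assume 1: "\<omega> \<notin> arr k i" "\<forall>r\<le>1 / a0. \<omega> \<notin> dep k i r" "A i \<omega> \<inter> win k = {}" "D i \<omega> \<inter> (win k \<times> UNIV) = {}"
    then have "\<omega> \<notin> dep k i ?r" using r by blast
    then show ?thesis unfolding chain local_step_def none[OF 1(4)] using 1 by simp
  next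
    fix \<tau> assume 1: "\<omega> \<in> arr k i" "\<forall>r\<le>1 / a0. \<omega> \<notin> dep k i r" "A i \<omega> \<inter> win k = {\<tau>}" "D i \<omega> \<inter> (win k \<times> UNIV) = {}"
    then have "\<omega> \<notin> dep k i ?r" using r by blast
    then show ?thesis unfolding chain local_step_def none[OF 1(4)] using 1 by simp
  next
    fix \<tau> u assume 1: "\<omega> \<notin> arr k i" "A i \<omega> \<inter> win k = {}" "D i \<omega> \<inter> (win k \<times> UNIV) = {(\<tau>, u)}"
       "\<forall>r. 0 \<le> r \<longrightarrow> r \<le> 1 / a0 \<longrightarrow> (\<omega> \<in> dep k i r \<longleftrightarrow> u \<le> r)"
    have "(\<omega> \<in> dep k i ?r) = (u \<le> ?r)" using 1(4) r by blast
    moreover have "(\<exists>\<tau> u. \<tau> \<in> win k \<and> (\<tau>, u) \<in> D i \<omega> \<and> u \<le> ?r) = (u \<le> ?r)"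
    proof -
      have "(\<tau>, u) \<in> D i \<omega> \<inter> (win k \<times> UNIV)" by (simp add: 1(3))
      then have "\<tau> \<in> win k" "(\<tau>, u) \<in> D i \<omega>" by auto
      moreover have "v = u" if "\<sigma> \<in> win k" "(\<sigma>, v) \<in> D i \<omega>" for \<sigma> v
      proof -
        have "(\<sigma>, v) \<in> D i \<omega> \<inter> (win k \<times> UNIV)" using that by simp
        then show ?thesis by (simp add: 1(3))
      qed
      ultimately show ?thesis by metis
    qed
    ultimately show ?thesis unfolding chain local_step_def using 1(1,2) by simp
  qed
qed

section \<open>Influence from outside the box, and comparison of paths\<close>

text \<open>On \<open>bad k i\<close> the state of site \<open>i\<close> at time \<open>start k\<close> may have been influenced from
  outside the box: influence is passed on by an atom of the departure process.\<close>

primrec bad :: "nat \<Rightarrow> int ^ 'd \<Rightarrow> 'w set" where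
  "bad 0 i = (if i \<in> B then {} else space M)"
| "bad (Suc k) i = bad k i \<union> (hit k i \<inter> (\<Union>j\<in>{j. 0 < a j}. bad k (i - j)))"

lemma bad_outside: "i \<notin> B \<Longrightarrow> bad k i \<supseteq> space M"
  by (induction k) auto

lemma bad_history: "bad k i \<in> sets (history (past k))"
proof (induction k arbitrary: i)
  case 0
  show ?case using sets.top[of "history (past 0)"] by auto
next
  case (Suc k)
  have "bad k j \<in> sets (history (past (Suc k)))" for j
    using Suc sets_history_mono[OF past_subset(1)] by blast
  moreover have "hit k i \<in> sets (history (past (Suc k)))"
    using hit_history sets_history_mono[OF past_subset(2)] by blast
  ultimately show ?case using finite_support by (auto intro!: sets.Un sets.Int sets.finite_UN)
qed

lemma bad_events: "bad k i \<in> events"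
  by (rule history_events[OF bad_history])

text \<open>Since \<open>hit k i\<close> belongs to a fresh cell, the probabilities
  \<open>P k i\<close> of \<open>bad k i\<close> satisfy \<open>P (Suc k) i \<le> P k i + h / a0 *
  (\<Sum>j | 0 < a j. P k (i - j))\<close>. A function \<open>g\<close> that is at least 1 outside
  the box and reproduces itself up to \<open>K\<close> yields a supersolution of this
  recursion.\<close>

lemma prob_bad:
  assumes g: "\<And>i. 0 \<le> g i" "\<And>i. i \<notin> B \<Longrightarrow> 1 \<le> g i"
    and K: "\<And>i. (\<Sum>j | 0 < a j. g (i - j)) \<le> K * g i" "0 \<le> K"
  shows "prob (bad k i) \<le> (1 + h / a0 * K) ^ k * g i"
proof (induction k arbitrary: i)
  case 0
  show ?case using g by (simp add: prob_space)
next
  case (Suc k)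
  have ev: "hit k i \<inter> (\<Union>j\<in>{j. 0 < a j}. bad k (i - j)) \<in> events"
    using history_events[OF hit_history] bad_events finite_support
    by (intro sets.Int sets.finite_UN) auto
  have "prob (bad (Suc k) i) \<le> prob (bad k i) + prob (hit k i \<inter> (\<Union>j\<in>{j. 0 < a j}. bad k (i - j)))"
    using bad_events ev by (simp add: measure_Un_le)
  also have "prob (hit k i \<inter> (\<Union>j\<in>{j. 0 < a j}. bad k (i - j)))
      = prob (\<Union>j\<in>{j. 0 < a j}. bad k (i - j)) * prob (hit k i)"
  proof -
    have "(\<Union>j\<in>{j. 0 < a j}. bad k (i - j)) \<in> sets (history (past k))"
      using bad_history finite_support by (intro sets.finite_UN) auto
    from past_win_indep[OF this hit_history] show ?thesis by (simp add: Int_commute)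
  qed
  also have "\<dots> \<le> (\<Sum>j | 0 < a j. prob (bad k (i - j))) * (h / a0)"
    using finite_support bad_events prob_hit
    by (intro mult_mono finite_measure_subadditive_finite sum_nonneg) auto
  also have "\<dots> \<le> (\<Sum>j | 0 < a j. (1 + h / a0 * K) ^ k * g (i - j)) * (h / a0)"
    using Suc h_pos a0_pos by (intro mult_right_mono sum_mono) auto
  also have "\<dots> \<le> (1 + h / a0 * K) ^ k * (K * g i) * (h / a0)"
    using K(1)[of i] K(2) h_pos a0_pos unfolding sum_distrib_left[symmetric]
    by (intro mult_right_mono mult_left_mono) auto
  also have "prob (bad k i) \<le> (1 + h / a0 * K) ^ k * g i" by (rule Suc)
  finally show ?case by (simp add: algebra_simps)
qed

lemma hitI: "\<omega> \<in> space M \<Longrightarrow> D i \<omega> \<inter> (win k \<times> UNIV) \<noteq> {} \<Longrightarrow> \<omega> \<in> hit k i"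
  using D_fin[of \<omega> marks i k] by (auto simp: hit_def D_marks)

lemma bad_neighbours:
  assumes "\<omega> \<notin> bad (Suc k) i" "\<omega> \<in> hit k i" "0 < a j"
  shows "\<omega> \<notin> bad k (i - j)"
  using assms by auto

text \<open>A departure atom at \<open>i\<close> is a hit, so all interacting sites were not bad;
  hence they lie in the box, where \<open>good\<close> makes them silent. The time \<open>s\<close>
  may be interior to the cell, as solutions may start off the grid.\<close>

lemma evolution_on_good_cell:
  assumes \<omega>: "\<omega> \<in> good k" "\<omega> \<notin> bad (Suc k) i"
    and ev: "queue_evolution a (\<lambda>i. A i \<omega>) (\<lambda>i. D i \<omega>) t1 x0 x"
    and s: "t1 \<le> s" "start k \<le> s" "s \<le> start (Suc k)"
  shows "x (start (Suc k)) i
     = local_step (A i \<omega>) (D i \<omega>) {s<..start (Suc k)} (x s i) (departure_ratio a (x s) i)"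
proof (rule evolution_local_step[OF ev s(1,3)])
  show "0 < a 0" using a0 a0_pos by simp
  have sub: "{s<..start (Suc k)} \<subseteq> win k" using s by (auto simp: win_def)
  have \<omega>M: "\<omega> \<in> space M" using \<omega>(1) good_events sets.sets_into_space by blast
  have notbad: "j \<in> B" if "\<omega> \<notin> bad l j" for l j using bad_outside that \<omega>M by blast
  have i: "i \<in> B" using notbad \<omega>(2) by blast
  have emp: "A j \<omega> \<inter> {s<..start (Suc k)} = {}" if "A j \<omega> \<inter> win k = {}" for j using that sub by blast
  have empD: "D j \<omega> \<inter> ({s<..start (Suc k)} \<times> UNIV) = {}" if "D j \<omega> \<inter> (win k \<times> UNIV) = {}" for j
    using that sub by blast
  have one: "A i \<omega> \<inter> {s<..start (Suc k)} = {} \<or> (\<exists>\<tau>. A i \<omega> \<inter> {s<..start (Suc k)} = {\<tau>})"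
    if "A i \<omega> \<inter> win k = {\<tau>}" for \<tau>
  proof -
    have "A i \<omega> \<inter> {s<..start (Suc k)} \<subseteq> {\<tau>}" using sub unfolding that[symmetric] by blast
    then show ?thesis using subset_singletonD by metis
  qed
  have oneD: "D i \<omega> \<inter> ({s<..start (Suc k)} \<times> UNIV) = {}
      \<or> (\<exists>\<tau> u. D i \<omega> \<inter> ({s<..start (Suc k)} \<times> UNIV) = {(\<tau>, u)})"
    if "D i \<omega> \<inter> (win k \<times> UNIV) = {(\<tau>, u)}" for \<tau> u
  proof -
    have "D i \<omega> \<inter> ({s<..start (Suc k)} \<times> UNIV) \<subseteq> {(\<tau>, u)}"
      using sub unfolding that[symmetric] by blast
    then show ?thesis using subset_singletonD by metis
  qed
  let ?C = "{s<..start (Suc k)}"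
  from good_cases[OF \<omega>(1) i]
  show "(A i \<omega> \<inter> ?C = {} \<and> D i \<omega> \<inter> (?C \<times> UNIV) = {}) \<or>
      (\<exists>\<tau>. A i \<omega> \<inter> ?C = {\<tau>} \<and> D i \<omega> \<inter> (?C \<times> UNIV) = {}) \<or>
      (A i \<omega> \<inter> ?C = {} \<and> (\<exists>\<tau> u. D i \<omega> \<inter> (?C \<times> UNIV) = {(\<tau>, u)}) \<and>
        (\<forall>j. 0 < a j \<longrightarrow> j \<noteq> 0 \<longrightarrow> A (i - j) \<omega> \<inter> ?C = {} \<and> D (i - j) \<omega> \<inter> (?C \<times> UNIV) = {}))"
  proof (elim disjE conjE exE)
    assume "A i \<omega> \<inter> win k = {}" "D i \<omega> \<inter> (win k \<times> UNIV) = {}"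
    then have "A i \<omega> \<inter> ?C = {}" "D i \<omega> \<inter> (?C \<times> UNIV) = {}" by (auto dest: emp empD)
    then show ?thesis by (intro disjI1 conjI)
  next
    fix \<tau> assume 1: "A i \<omega> \<inter> win k = {\<tau>}" "D i \<omega> \<inter> (win k \<times> UNIV) = {}"
    from one[OF 1(1)] empD[OF 1(2)] show ?thesis by metis
  next
    fix \<tau> u assume 1: "A i \<omega> \<inter> win k = {}" "D i \<omega> \<inter> (win k \<times> UNIV) = {(\<tau>, u)}"
      "\<forall>j\<in>B - {i}. A j \<omega> \<inter> win k = {} \<and> D j \<omega> \<inter> (win k \<times> UNIV) = {}"
    have "D i \<omega> \<inter> (win k \<times> UNIV) \<noteq> {}" unfolding 1(2) by simp
    then have "\<omega> \<in> hit k i" by (rule hitI[OF \<omega>M])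
    then have "i - j \<in> B" if "0 < a j" for j using bad_neighbours[OF \<omega>(2)] that notbad by blast
    then have "A (i - j) \<omega> \<inter> ?C = {} \<and> D (i - j) \<omega> \<inter> (?C \<times> UNIV) = {}" if "0 < a j" "j \<noteq> 0" for j
      using 1(3) that emp empD by auto
    moreover have "A i \<omega> \<inter> ?C = {}" by (rule emp[OF 1(1)])
    ultimately show ?thesis using oneD[OF 1(2)] by metis
  qed
qed

text \<open>The ratios are consulted only when a departure atom occurs at \<open>i\<close>. In that
  case the interacting sites were not bad before the cell, and the induction hypothesis makes the
  two ratios equal.\<close>

lemma chain_eq_evolution:
  assumes good: "\<And>k. k < m \<Longrightarrow> \<omega> \<in> good k"
    and ev: "queue_evolution a (\<lambda>i. A i \<omega>) (\<lambda>i. D i \<omega>) t0 (\<lambda>_. 0) x"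
    and \<omega>: "\<omega> \<in> space M"
  shows "k \<le> m \<Longrightarrow> \<omega> \<notin> bad k i \<Longrightarrow> x (start k) i = chain k \<omega> i"
proof (induction k arbitrary: i)
  case 0
  then show ?case using evolution_start[OF ev] by (simp add: start_def)
next
  case (Suc k)
  have g: "\<omega> \<in> good k" using good Suc.prems by simp
  have notbad: "j \<in> B" if "\<omega> \<notin> bad l j" for l j using bad_outside that \<omega> by blast
  have eq: "x (start k) i = chain k \<omega> i" using Suc by simp
  have "x (start (Suc k)) i
     = local_step (A i \<omega>) (D i \<omega>) (win k) (chain k \<omega> i) (departure_ratio a (x (start k)) i)"
    using evolution_on_good_cell[OF g Suc.prems(2) ev, of "start k"] h_pos
    by (simp add: eq win_def start_Suc) (simp add: start_def)
  also have "\<dots> = local_step (A i \<omega>) (D i \<omega>) (win k) (chain k \<omega> i) (kern.rate (chain k \<omega>) i)"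
  proof (cases "D i \<omega> \<inter> (win k \<times> UNIV) = {}")
    case True
    then show ?thesis by (rule local_step_no_departure)
  next
    case False
    then have "\<omega> \<in> hit k i" using hitI \<omega> by blast
    then have nb: "\<omega> \<notin> bad k (i - j)" if "0 < a j" for j
      using bad_neighbours Suc.prems(2) that by blast
    have "departure_ratio a (x (start k)) i = kern.rate (chain k \<omega>) i"
      using nb notbad Suc by (intro departure_ratio_eq_rate) auto
    then show ?thesis by simp
  qed
  also have "\<dots> = chain (Suc k) \<omega> i"
    using chain_local_step[OF g notbad[OF Suc.prems(2)]] by simp
  finally show ?case .
qed

text \<open>The preceding induction with equality replaced by an inequality and equal ratios by
  \<open>departure_ratio_antimono\<close>. It makes the solutions monotone in their starting time at
  sites that are not bad.\<close>

lemma evolution_comparison: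
  assumes good: "\<And>k. k < m \<Longrightarrow> \<omega> \<in> good k" and \<omega>: "\<omega> \<in> space M"
    and ev: "queue_evolution a (\<lambda>i. A i \<omega>) (\<lambda>i. D i \<omega>) t1 (\<lambda>_. 0) x"
    and ev': "queue_evolution a (\<lambda>i. A i \<omega>) (\<lambda>i. D i \<omega>) t2 (\<lambda>_. 0) x'"
    and t: "t0 \<le> t2" "t2 \<le> t1"
  shows "k \<le> m \<Longrightarrow> t1 \<le> start k \<Longrightarrow> \<omega> \<notin> bad k i \<Longrightarrow> x (start k) i \<le> x' (start k) i"
proof (induction k arbitrary: i)
  case 0
  then have "start 0 = t1" using t by (simp add: start_def)
  then show ?case using evolution_start[OF ev] by simp
next
  case (Suc k)
  have g: "\<omega> \<in> good k" using good Suc.prems by simp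
  \<comment> \<open>In the cell where the later solution begins, the comparison begins at
    \<open>t1\<close> instead of the grid point, and the empty state lies below every state.\<close>
  define s where "s = max (start k) t1"
  have s: "t1 \<le> s" "t2 \<le> s" "start k \<le> s" "s \<le> start (Suc k)"
    using Suc.prems t h_pos by (auto simp: s_def start_Suc)
  have le: "x s j \<le> x' s j" if "\<omega> \<notin> bad k j" for j
  proof (cases "start k \<le> t1")
    case True
    then have "s = t1" by (simp add: s_def)
    then show ?thesis using evolution_start[OF ev] by simp
  next
    case False
    then have "s = start k" by (simp add: s_def)
    then show ?thesis using Suc that False by simp
  qed
  let ?C = "{s<..start (Suc k)}"
  have i: "\<omega> \<notin> bad k i" using Suc.prems by simp
  have "local_step (A i \<omega>) (D i \<omega>) ?C (x s i) (departure_ratio a (x s) i)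
     \<le> local_step (A i \<omega>) (D i \<omega>) ?C (x' s i) (departure_ratio a (x' s) i)"
  proof (cases "D i \<omega> \<inter> (?C \<times> UNIV) = {}")
    case True
    have "local_step (A i \<omega>) (D i \<omega>) ?C (x s i) (departure_ratio a (x s) i)
       = local_step (A i \<omega>) (D i \<omega>) ?C (x s i) (departure_ratio a (x' s) i)"
      by (rule local_step_no_departure[OF True])
    also have "\<dots> \<le> local_step (A i \<omega>) (D i \<omega>) ?C (x' s i) (departure_ratio a (x' s) i)"
      using le[OF i] by (intro local_step_mono) auto
    finally show ?thesis .
  next
    case False
    have "?C \<subseteq> win k" using s by (auto simp: win_def)
    then have "D i \<omega> \<inter> (win k \<times> UNIV) \<noteq> {}" using False by blast
    then have "\<omega> \<in> hit k i" using hitI \<omega> by blast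
    then have nb: "x s (i - j) \<le> x' s (i - j)" if "0 < a j" for j
      using bad_neighbours Suc.prems(3) that le by blast
    show ?thesis
    proof (rule local_step_mono, cases "x s i = x' s i")
      case True
      then have "departure_ratio a (x' s) i \<le> departure_ratio a (x s) i"
        using nb finite_support a0 a0_pos by (intro departure_ratio_antimono) auto
      then show "x s i < x' s i \<or> x s i = x' s i \<and> departure_ratio a (x' s) i \<le> departure_ratio a (x s) i"
        using True by simp
    next
      case False
      then show "x s i < x' s i \<or> x s i = x' s i \<and> departure_ratio a (x' s) i \<le> departure_ratio a (x s) i"
        using le[OF i] by simp
    qed
  qed
  then show ?case
    using evolution_on_good_cell[OF g Suc.prems(3) ev s(1,3,4)]
      evolution_on_good_cell[OF g Suc.prems(3) ev' s(2,3,4)] by simp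
qed

end

section \<open>Uniform second moments\<close>

definition l1 :: "int ^ 'd::finite \<Rightarrow> nat" where
  "l1 i = (\<Sum>l\<in>UNIV. nat \<bar>i $ l\<bar>)"

lemma l1_0 [simp]: "l1 0 = 0"
  by (simp add: l1_def)

lemma l1_minus_le: "l1 (i - j) \<le> l1 i + l1 j"
  unfolding l1_def sum.distrib[symmetric] by (intro sum_mono) (simp add: nat_le_iff)

lemma nth_le_l1: "nat \<bar>i $ l\<bar> \<le> l1 i"
  unfolding l1_def by (rule member_le_sum) auto

lemma l1_ball_subset:
  "{i :: int ^ 'd::finite. l1 i \<le> n} \<subseteq> vec_lambda ` (UNIV \<rightarrow>\<^sub>E {- int n..int n})"
proof
  fix i :: "int ^ 'd" assume "i \<in> {i. l1 i \<le> n}"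
  then have "nat \<bar>i $ l\<bar> \<le> n" for l using nth_le_l1[of i l] by simp
  then have "\<bar>i $ l\<bar> \<le> int n" for l by (simp add: nat_le_iff)
  then have "i $ l \<in> {- int n..int n}" for l using abs_le_iff[of "i $ l" "int n"] by auto
  then show "i \<in> vec_lambda ` (UNIV \<rightarrow>\<^sub>E {- int n..int n})"
    by (intro image_eqI[of _ _ "vec_nth i"]) (auto simp: PiE_def)
qed

lemma finite_l1_ball: "finite {i :: int ^ 'd::finite. l1 i \<le> n}"
  by (rule finite_subset[OF l1_ball_subset]) (intro finite_imageI finite_PiE, auto)

lemma sum_power_abs_le:
  fixes \<rho> :: real
  assumes "0 < \<rho>" "\<rho> < 1"
  shows "(\<Sum>m\<in>{- int n..int n}. \<rho> ^ nat \<bar>m\<bar>) \<le> 2 / (1 - \<rho>)"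
proof -
  have geo: "(\<Sum>k\<le>n. \<rho> ^ k) \<le> 1 / (1 - \<rho>)"
  proof -
    have "(\<Sum>k\<le>n. \<rho> ^ k) \<le> (\<Sum>k. \<rho> ^ k)"
      using assms by (intro sum_le_suminf summable_geometric) auto
    then show ?thesis using assms by (simp add: suminf_geometric)
  qed
  let ?P = "int ` {..n}" and ?N = "(\<lambda>k. - int k) ` {..n}"
  have "{- int n..int n} \<subseteq> ?P \<union> ?N"
  proof
    fix m assume "m \<in> {- int n..int n}"
    then have "m = int (nat m) \<and> nat m \<le> n \<or> m = - int (nat (- m)) \<and> nat (- m) \<le> n" by auto
    then show "m \<in> ?P \<union> ?N" by (metis UnI1 UnI2 atMost_iff image_eqI)
  qed
  then have "(\<Sum>m\<in>{- int n..int n}. \<rho> ^ nat \<bar>m\<bar>) \<le> (\<Sum>m\<in>?P \<union> ?N. \<rho> ^ nat \<bar>m\<bar>)"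
    using assms by (intro sum_mono2) auto
  also have "\<dots> \<le> (\<Sum>m\<in>?P. \<rho> ^ nat \<bar>m\<bar>) + (\<Sum>m\<in>?N. \<rho> ^ nat \<bar>m\<bar>)"
    using sum.union_inter[of ?P ?N "\<lambda>m. \<rho> ^ nat \<bar>m\<bar>"] assms
      sum_nonneg[of "?P \<inter> ?N" "\<lambda>m. \<rho> ^ nat \<bar>m\<bar>"] by simp
  also have "(\<Sum>m\<in>?P. \<rho> ^ nat \<bar>m\<bar>) = (\<Sum>k\<le>n. \<rho> ^ k)"
    by (subst sum.reindex) (auto simp: inj_on_def)
  also have "(\<Sum>m\<in>?N. \<rho> ^ nat \<bar>m\<bar>) = (\<Sum>k\<le>n. \<rho> ^ k)"
    by (subst sum.reindex) (auto simp: inj_on_def)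
  finally show ?thesis using geo by simp
qed

text \<open>Enlarging the ball to a cube turns the sum into a product of one-dimensional geometric
  sums, bounded independently of \<open>n\<close>.\<close>

lemma sum_power_l1_le:
  fixes \<rho> :: real
  assumes \<rho>: "0 < \<rho>" "\<rho> < 1"
  shows "(\<Sum>i | l1 (i :: int ^ 'd::finite) \<le> n. \<rho> ^ l1 i) \<le> (2 / (1 - \<rho>)) ^ CARD('d)"
proof -
  let ?I = "{- int n..int n}" and ?F = "UNIV \<rightarrow>\<^sub>E {- int n..int n} :: ('d \<Rightarrow> int) set"
  have "(\<Sum>i | l1 (i :: int ^ 'd) \<le> n. \<rho> ^ l1 i) \<le> (\<Sum>i\<in>vec_lambda ` ?F. \<rho> ^ l1 i)"
    using \<rho> by (intro sum_mono2 l1_ball_subset finite_imageI finite_PiE) auto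
  also have "\<dots> = (\<Sum>f\<in>?F. \<Prod>l\<in>UNIV. \<rho> ^ nat \<bar>f l\<bar>)"
    by (subst sum.reindex) (auto simp: inj_on_def l1_def power_sum vec_lambda_inject)
  also have "\<dots> = (\<Prod>l\<in>(UNIV :: 'd set). \<Sum>m\<in>?I. \<rho> ^ nat \<bar>m\<bar>)"
    by (subst prod_sum_PiE) auto
  also have "\<dots> \<le> (\<Prod>l\<in>(UNIV :: 'd set). 2 / (1 - \<rho>))"
    using \<rho> by (intro prod_mono conjI sum_nonneg sum_power_abs_le) auto
  finally show ?thesis by simp
qed

section \<open>Moment bound for the chain and choice of box and mesh\<close>

context discretization
begin

lemma expectation_square_le:
  fixes w :: "int ^ 'd \<Rightarrow> real" and q :: real
  defines "s \<equiv> (\<Sum>j | 0 < a j. a j)"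
  assumes subcritical: "lam * s < 1" and q: "q = 1 + (1 - lam * s) / 2"
    and w: "\<And>i. 0 < w i" "\<And>i k. 0 < a (i - k) \<Longrightarrow> w i \<le> q * w k" "w 0 = 1"
    and box: "0 \<in> B" "(\<Sum>i\<in>B. w i) \<le> W"
  shows "expectation (\<lambda>\<omega>. (real (chain k \<omega> 0))\<^sup>2)
     \<le> 4 * ((lam * (q * s + 2 * a0) + 3)\<^sup>2 / (2 * (1 - lam * s)) + lam * a0) / (1 - lam * s) * W"
proof -
  have s_pos: "0 < s"
    unfolding s_def using finite_support a0 a0_pos by (intro sum_pos) auto
  interpret lyapunov B "\<lambda>i k. a (i - k)" a0 lam s w q
  proof
    show "(\<Sum>k\<in>B. a (i - k)) \<le> s" if "i \<in> B" for i
      unfolding s_def using kern.row_sum[OF that] .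
  qed (use subcritical q w s_pos finite_box a_nonneg kern.b_sym a0 a0_pos lam_pos in auto)
  let ?C = "4 * ((lam * (q * s + 2 * a0) + 3)\<^sup>2 / (2 * (1 - lam * s)) + lam * a0) / (1 - lam * s)"
  have "(real (y 0))\<^sup>2 \<le> energy y" for y
    unfolding energy_def using member_le_sum[of 0 B "\<lambda>k. w k * (real (y k))\<^sup>2"] finite_box w box(1)
    by (simp add: less_imp_le)
  then have "expectation (\<lambda>\<omega>. (real (chain k \<omega> 0))\<^sup>2) \<le> expectation (\<lambda>\<omega>. energy (chain k \<omega>))"
    by (intro integral_mono expectation_chain_states)
  also have "\<dots> = (kern.trans_op (h * silence) ^^ k) energy (\<lambda>_. 0)"
    by (rule expectation_chain)
  also have "\<dots> \<le> ?C * (\<Sum>i\<in>B. w i)"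
  proof (rule energy_bound)
    show "0 < h * silence" using h_pos by (simp add: silence_def)
    \<comment> \<open>With \<open>u = total_rate * h\<close> this is
      \<open>u * exp (- u) \<le> 1\<close>, valid for every mesh.\<close>
    show "h * silence * total_rate \<le> 1"
    proof -
      have "total_rate * h \<le> exp (total_rate * h)"
        using exp_ge_add_one_self[of "total_rate * h"] by linarith
      then show ?thesis by (simp add: silence_def exp_minus field_simps)
    qed
  qed
  also have "\<dots> \<le> ?C * W"
    using box(2) subcritical lam_pos a0_pos by (intro mult_left_mono) auto
  finally show ?thesis .
qed

definition ok :: "nat \<Rightarrow> 'w set" where
  "ok m = (space M \<inter> (\<Inter>k\<in>{..<m}. good k)) - bad m 0"

lemma ok_events: "ok m \<in> events"
proof -
  have "(\<Inter>k\<in>{..<m}. good k) \<inter> space M \<in> events"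
    using good_events by (cases "m = 0") (auto intro!: sets.finite_INT)
  then show ?thesis unfolding ok_def using bad_events by (simp add: Int_commute)
qed

lemma prob_not_ok:
  "prob (space M - ok m) \<le> real m * (kern.total_rate * h)\<^sup>2 + prob (bad m 0)"
proof -
  have ev: "(\<Union>k\<in>{..<m}. space M - good k) \<in> events"
    by (intro sets.finite_UN sets.Diff sets.top good_events) simp
  have "space M - ok m \<subseteq> (\<Union>k\<in>{..<m}. space M - good k) \<union> bad m 0"
    unfolding ok_def by blast
  then have "prob (space M - ok m) \<le> prob ((\<Union>k\<in>{..<m}. space M - good k) \<union> bad m 0)"
    using ev bad_events by (intro finite_measure_mono) auto
  also have "\<dots> \<le> prob (\<Union>k\<in>{..<m}. space M - good k) + prob (bad m 0)"
    using ev bad_events by (intro measure_Un_le) auto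
  also have "prob (\<Union>k\<in>{..<m}. space M - good k) \<le> (\<Sum>k\<in>{..<m}. prob (space M - good k))"
    using good_events by (intro finite_measure_subadditive_finite) auto
  also have "\<dots> \<le> (\<Sum>k\<in>{..<m}. (kern.total_rate * h)\<^sup>2)"
    by (intro sum_mono prob_not_good)
  finally show ?thesis by simp
qed

end

context driving_noise
begin

text \<open>The order of choices matters. The growth factor of \<open>prob_bad\<close> over all
  \<open>m\<close> cells is at most \<open>E\<close>, whatever \<open>m\<close> is, so the radius
  \<open>n\<close> comes first. The mesh comes second, because \<open>kern.total_rate\<close> grows
  with the box.\<close>

lemma ex_discretization:
  fixes a :: "int ^ 'd \<Rightarrow> real" and T \<epsilon> :: real
  assumes interference: "interference_sequence a" and a0: "a0 = a 0" and T: "0 < T" and \<epsilon>: "0 < \<epsilon>"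
  shows "\<exists>n m. 0 < m \<and>
    prob (space M - discretization.ok M a0 A D a {i. l1 i \<le> n} (- T) (T / real m) m) \<le> \<epsilon>"
proof -
  \<comment> \<open>The supersolution will be \<open>2 ^ l1 i / 2 ^ n\<close>: at least 1 outside
    the ball of radius \<open>n\<close> and exponentially small in \<open>n\<close> at the origin.
    The triangle inequality for \<open>l1\<close> produces this \<open>K\<close>.\<close>
  define K :: real where "K = (\<Sum>j | 0 < a j. 2 ^ l1 j)"
  have K: "0 \<le> K" by (simp add: K_def sum_nonneg)
  define E where "E = exp (T / a0 * K)"
  have "(\<lambda>n. E * (1 / 2) ^ n) \<longlonglongrightarrow> E * 0"
    by (intro tendsto_intros) simp
  then have "eventually (\<lambda>n. E * (1 / 2) ^ n < \<epsilon> / 2) sequentially"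
    using \<epsilon> by (intro order_tendstoD(2)) auto
  then obtain n where n: "E * (1 / 2) ^ n < \<epsilon> / 2" by (auto simp: eventually_sequentially)
  let ?B = "{i :: int ^ 'd. l1 i \<le> n}"
  define R where "R = real (card ?B) * (lam + 1 / a0)"
  have "(\<lambda>m. (R * T)\<^sup>2 / real m) \<longlonglongrightarrow> 0"
    by (rule lim_const_over_n)
  then have "eventually (\<lambda>m. (R * T)\<^sup>2 / real m < \<epsilon> / 2) sequentially"
    using \<epsilon> by (intro order_tendstoD(2)) auto
  then have "eventually (\<lambda>m. (R * T)\<^sup>2 / real m < \<epsilon> / 2 \<and> 0 < m) sequentially"
    using eventually_gt_at_top[of 0] by eventually_elim auto
  then obtain m where m: "(R * T)\<^sup>2 / real m < \<epsilon> / 2" "0 < m" by (auto simp: eventually_sequentially)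
  interpret discretization M lam a0 A D a ?B "- T" "T / real m"
  proof
    show "?B \<noteq> {}" by (auto intro!: exI[of _ 0])
  qed (use interference a0 T m finite_l1_ball in auto)
  have "prob (bad m 0) \<le> (1 + T / real m / a0 * K) ^ m * (2 ^ l1 (0 :: int ^ 'd) / 2 ^ n)"
  proof (rule prob_bad[of "\<lambda>i. 2 ^ l1 i / 2 ^ n"])
    show "1 \<le> (2 ^ l1 i / 2 ^ n :: real)" if "i \<notin> ?B" for i
      using that by (simp add: power_increasing)
    show "(\<Sum>j | 0 < a j. 2 ^ l1 (i - j) / 2 ^ n) \<le> K * (2 ^ l1 i / 2 ^ n :: real)" for i
    proof -
      have "(\<Sum>j | 0 < a j. 2 ^ l1 (i - j) / 2 ^ n) \<le> (\<Sum>j | 0 < a j. 2 ^ (l1 i + l1 j) / 2 ^ n :: real)"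
        by (intro sum_mono divide_right_mono power_increasing l1_minus_le) auto
      also have "\<dots> = K * (2 ^ l1 i / 2 ^ n)"
        by (simp add: K_def power_add sum_distrib_left sum_distrib_right sum_divide_distrib mult_ac)
      finally show ?thesis .
    qed
  qed (use K in auto)
  also have "(1 + T / real m / a0 * K) ^ m \<le> exp (T / real m / a0 * K) ^ m"
    using T a0_pos K by (intro power_mono) (auto intro: add_nonneg_nonneg)
  also have "\<dots> = E"
    using m(2) by (simp add: E_def exp_of_nat_mult[symmetric] field_simps)
  finally have "prob (bad m 0) \<le> E * (1 / 2) ^ n"
    by (simp add: power_one_over divide_simps)
  moreover have "real m * (kern.total_rate * (T / real m))\<^sup>2 = (R * T)\<^sup>2 / real m"
    using m(2) by (simp add: R_def kern.total_rate_def power2_eq_square)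
  ultimately have "prob (space M - ok m) \<le> \<epsilon>"
    using prob_not_ok[of m] n m by linarith
  then show ?thesis using m(2) by blast
qed

text \<open>The constant is fixed before the horizon \<open>Suc N\<close>, and the good event
  \<open>G\<close> before the solution \<open>x\<close>, so that one exceptional set serves all
  solutions. The rate \<open>(1 / 2) ^ N\<close> makes the failures summable.\<close>

lemma ex_uniform_approximation:
  fixes a :: "int ^ 'd \<Rightarrow> real"
  assumes interference: "interference_sequence a" and a0: "a0 = a 0"
    and subcritical: "lam * (\<Sum>j | 0 < a j. a j) < 1"
  shows "\<exists>C. \<forall>N. \<exists>Z G. G \<in> events \<and> prob (space M - G) \<le> (1 / 2) ^ N \<and>
    integrable M (\<lambda>\<omega>. (real (Z \<omega>))\<^sup>2) \<and> expectation (\<lambda>\<omega>. (real (Z \<omega>))\<^sup>2) \<le> C \<and>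
    (\<forall>\<omega>\<in>G. \<forall>x. (\<forall>T\<ge>0. queue_evolution a (\<lambda>i. A i \<omega>) (\<lambda>i. D i \<omega>) (- T) (\<lambda>_. 0) (x T)) \<longrightarrow>
       x (real (Suc N)) 0 0 = (Z \<omega> :: nat) \<and>
       (\<forall>T T'. 0 \<le> T \<and> T \<le> T' \<and> T' \<le> real (Suc N) \<longrightarrow> x T 0 0 \<le> x T' 0 0))"
proof -
  define s where "s = (\<Sum>j | 0 < a j. a j)"
  define q where "q = 1 + (1 - lam * s) / 2"
  \<comment> \<open>\<open>R\<close> exceeds the range of the interaction in \<open>l1\<close>, and
    \<open>\<rho>\<close> is the \<open>R\<close>-th root of \<open>1 / q\<close>. Thus the weights
    \<open>\<rho> ^ l1 i\<close> change at most by the factor \<open>q\<close> between interacting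
    sites.\<close>
  define R where "R = Suc (\<Sum>j | 0 < a j. l1 j)"
  define \<rho> where "\<rho> = (1 / q) powr (1 / real R)"
  have fin: "finite {j. 0 < a j}" using interference by (simp add: interference_sequence_def)
  have q: "1 < q" using subcritical by (simp add: q_def s_def)
  have R: "0 < real R" unfolding R_def of_nat_0_less_iff by simp
  have \<rho>: "0 < \<rho>" "\<rho> < 1"
  proof -
    show "0 < \<rho>" using q by (simp add: \<rho>_def)
    have "(1 / q) powr (1 / real R) < 1 powr (1 / real R)"
      using q R by (intro powr_less_mono2) auto
    then show "\<rho> < 1" by (simp add: \<rho>_def)
  qed
  have \<rho>R: "\<rho> ^ R = 1 / q"
    using q R by (simp add: \<rho>_def powr_realpow[symmetric] powr_powr)
  have w_ratio: "\<rho> ^ l1 i \<le> q * \<rho> ^ l1 k" if "0 < a (i - k)" for i k :: "int ^ 'd"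
  proof -
    have "l1 (i - k) \<le> (\<Sum>j | 0 < a j. l1 j)"
      using fin that by (intro member_le_sum) auto
    moreover have "l1 k \<le> l1 i + l1 (i - k)" using l1_minus_le[of i "i - k"] by simp
    ultimately have "l1 k \<le> l1 i + R" by (simp add: R_def)
    then have "\<rho> ^ (l1 i + R) \<le> \<rho> ^ l1 k" using \<rho> by (intro power_decreasing) auto
    then show ?thesis using q by (simp add: power_add \<rho>R field_simps)
  qed
  let ?W = "(2 / (1 - \<rho>)) ^ CARD('d)"
  let ?C = "4 * ((lam * (q * s + 2 * a0) + 3)\<^sup>2 / (2 * (1 - lam * s)) + lam * a0) / (1 - lam * s) * ?W"
  show ?thesis
  proof (rule exI[of _ ?C], rule allI)
    fix N :: nat
    define T0 where "T0 = real (Suc N)"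
    have T0: "0 < T0" by (simp add: T0_def)
    obtain n m where m: "0 < m" and
      ok: "prob (space M - discretization.ok M a0 A D a {i. l1 i \<le> n} (- T0) (T0 / real m) m) \<le> (1 / 2) ^ N"
      using ex_discretization[OF interference a0 T0, of "(1 / 2) ^ N"] by auto
    let ?B = "{i :: int ^ 'd. l1 i \<le> n}"
    interpret discretization M lam a0 A D a ?B "- T0" "T0 / real m"
    proof
      show "?B \<noteq> {}" by (auto intro!: exI[of _ 0])
    qed (use interference a0 m T0 finite_l1_ball in auto)
    have start_m: "start m = 0" unfolding start_def using m by simp
    have "\<exists>Z G. G \<in> events \<and> prob (space M - G) \<le> (1 / 2) ^ N \<and>
      integrable M (\<lambda>\<omega>. (real (Z \<omega>))\<^sup>2) \<and> expectation (\<lambda>\<omega>. (real (Z \<omega>))\<^sup>2) \<le> ?C \<and>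
      (\<forall>\<omega>\<in>G. \<forall>x. (\<forall>T\<ge>0. queue_evolution a (\<lambda>i. A i \<omega>) (\<lambda>i. D i \<omega>) (- T) (\<lambda>_. 0) (x T)) \<longrightarrow>
       x T0 0 0 = (Z \<omega> :: nat) \<and>
       (\<forall>T T'. 0 \<le> T \<and> T \<le> T' \<and> T' \<le> T0 \<longrightarrow> x T 0 0 \<le> x T' 0 0))"
    proof (intro exI[of _ "\<lambda>\<omega>. chain m \<omega> 0"] exI[of _ "ok m"] conjI ballI allI impI)
      show "ok m \<in> events" by (rule ok_events)
      show "prob (space M - ok m) \<le> (1 / 2) ^ N" by (rule ok)
      show "integrable M (\<lambda>\<omega>. (real (chain m \<omega> 0))\<^sup>2)"
        by (rule expectation_chain_states(2)[of "\<lambda>y. (real (y 0))\<^sup>2"])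
      show "expectation (\<lambda>\<omega>. (real (chain m \<omega> 0))\<^sup>2) \<le> ?C"
        unfolding s_def
      proof (rule expectation_square_le[where w = "\<lambda>i. \<rho> ^ l1 i"])
        show "(\<Sum>i\<in>?B. \<rho> ^ l1 i) \<le> ?W" by (rule sum_power_l1_le[OF \<rho>])
      qed (use subcritical \<rho> w_ratio in \<open>auto simp: q_def s_def\<close>)
    next
      fix \<omega> x assume \<omega>: "\<omega> \<in> ok m"
        and x: "\<forall>T\<ge>0. queue_evolution a (\<lambda>i. A i \<omega>) (\<lambda>i. D i \<omega>) (- T) (\<lambda>_. 0) (x T)"
      have g: "\<And>k. k < m \<Longrightarrow> \<omega> \<in> good k" and M: "\<omega> \<in> space M" and b: "\<omega> \<notin> bad m 0"
        using \<omega> by (auto simp: ok_def)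
      have "x T0 (start m) 0 = chain m \<omega> 0"
        using x T0 by (intro chain_eq_evolution[OF g _ M _ b]) auto
      then show "x T0 0 0 = chain m \<omega> 0" by (simp add: start_m)
      fix T T' assume T: "0 \<le> T \<and> T \<le> T' \<and> T' \<le> T0"
      have evT: "queue_evolution a (\<lambda>i. A i \<omega>) (\<lambda>i. D i \<omega>) (- T) (\<lambda>_. 0) (x T)"
        and evT': "queue_evolution a (\<lambda>i. A i \<omega>) (\<lambda>i. D i \<omega>) (- T') (\<lambda>_. 0) (x T')"
        using x[rule_format, of T] x[rule_format, of T'] T by simp_all
      have "x T (start m) 0 \<le> x T' (start m) 0"
        by (rule evolution_comparison[where m = m, OF g M evT evT' _ _ order_refl _ b])
          (use T start_m in auto)
      then show "x T 0 0 \<le> x T' 0 0" by (simp add: start_m)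
    qed
    then show "\<exists>Z G. G \<in> events \<and> prob (space M - G) \<le> (1 / 2) ^ N \<and>
      integrable M (\<lambda>\<omega>. (real (Z \<omega>))\<^sup>2) \<and> expectation (\<lambda>\<omega>. (real (Z \<omega>))\<^sup>2) \<le> ?C \<and>
      (\<forall>\<omega>\<in>G. \<forall>x. (\<forall>T\<ge>0. queue_evolution a (\<lambda>i. A i \<omega>) (\<lambda>i. D i \<omega>) (- T) (\<lambda>_. 0) (x T)) \<longrightarrow>
       x (real (Suc N)) 0 0 = (Z \<omega> :: nat) \<and>
       (\<forall>T T'. 0 \<le> T \<and> T \<le> T' \<and> T' \<le> real (Suc N) \<longrightarrow> x T 0 0 \<le> x T' 0 0))"
      unfolding T0_def .
  qed
qed

end

section \<open>Passage to the limit\<close>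

lemma mono_limit_state:
  assumes "\<And>T T'. 0 \<le> T \<Longrightarrow> T \<le> T' \<Longrightarrow> x T s i \<le> x T' s i"
  shows "((\<lambda>T. enat (x T s i)) \<longlongrightarrow> limit_state x s i) at_top"
proof -
  let ?L = "SUP T\<in>{0..}. enat (x T s i)"
  have "((\<lambda>T. enat (x T s i)) \<longlongrightarrow> ?L) at_top"
  proof (rule order_tendstoI)
    fix l assume "l < ?L"
    then obtain T0 where T0: "0 \<le> T0" "l < enat (x T0 s i)" by (auto simp: less_SUP_iff)
    show "eventually (\<lambda>T. l < enat (x T s i)) at_top"
      using eventually_ge_at_top[of T0]
    proof eventually_elim
      case (elim T)
      then show ?case using assms[of T0 T] T0 by (auto intro: less_le_trans)
    qed
  next
    fix u assume u: "?L < u"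
    show "eventually (\<lambda>T. enat (x T s i) < u) at_top"
      using eventually_ge_at_top[of 0]
    proof eventually_elim
      case (elim T)
      then have "enat (x T s i) \<le> ?L" by (intro SUP_upper) auto
      then show ?case using u by (rule le_less_trans)
    qed
  qed
  \<comment> \<open>\<open>Lim\<close> is a definite description, which acquires its meaning from
    the convergence just proved.\<close>
  then show ?thesis
    unfolding limit_state_def by (subst tendsto_Lim) auto
qed

text \<open>Comparing squares gives \<open>sqrt ((a 0)^2 + a 0 * b) < a 0 + b / 2\<close>, that is
  \<open>c < 1 / 2\<close>, so that \<open>2 / 3 * (1 + c)\<close> stays below 1.\<close>

lemma interference_load_bound:
  fixes a :: "int ^ 'd::finite \<Rightarrow> real"
  assumes interference: "interference_sequence a" and lam: "0 < lam"
    and c: "c = (sqrt ((a 0)\<^sup>2 + a 0 * (\<Sum>j\<in>{j. 0 < a j} - {0}. a j)) - a 0)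
                  / (\<Sum>j\<in>{j. 0 < a j} - {0}. a j)"
    and lam_less: "lam < 2 / 3 * ((1 + c) / (\<Sum>j | 0 < a j. a j))"
  shows "lam * (\<Sum>j | 0 < a j. a j) < 1"
proof -
  define b where "b = (\<Sum>j\<in>{j. 0 < a j} - {0}. a j)"
  have fin: "finite {j. 0 < a j}" and a0: "0 < a 0" and ex: "\<exists>i. i \<noteq> 0 \<and> 0 < a i"
    using interference by (auto simp: interference_sequence_def)
  have b: "0 < b" unfolding b_def using fin ex by (intro sum_pos) auto
  have s: "(\<Sum>j | 0 < a j. a j) = a 0 + b"
    unfolding b_def using fin a0 by (subst sum.remove[of _ 0]) auto
  have "sqrt ((a 0)\<^sup>2 + a 0 * b) < a 0 + b / 2"
  proof (rule real_less_lsqrt)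
    show "(a 0)\<^sup>2 + a 0 * b < (a 0 + b / 2)\<^sup>2"
      using b by (simp add: power2_eq_square algebra_simps)
  qed (use a0 b in auto)
  then have "c < 1 / 2" unfolding c b_def[symmetric] using b by (simp add: pos_divide_less_eq)
  then have "2 / 3 * (1 + c) < 1" by simp
  moreover have "lam * (a 0 + b) < 2 / 3 * (1 + c)"
    using lam_less a0 b unfolding s by (simp add: field_simps)
  ultimately show ?thesis unfolding s by linarith
qed

theorem proposition1p3:
  fixes a :: "int ^ 'd::finite \<Rightarrow> real"
    and lam c :: real
    and M :: "'w measure"
    and A :: "int ^ 'd \<Rightarrow> 'w \<Rightarrow> real set"
    and D :: "int ^ 'd \<Rightarrow> 'w \<Rightarrow> (real \<times> real) set"
    and x :: "'w \<Rightarrow> real \<Rightarrow> real \<Rightarrow> int ^ 'd \<Rightarrow> nat"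
  assumes interference: "interference_sequence a"
    and lam_pos: "0 < lam"
    and M: "prob_space M"
    and driving: "driving_processes M lam (a 0) A D"
    and dynamics: "AE \<omega> in M. \<forall>T\<ge>0.
          queue_evolution a (\<lambda>i. A i \<omega>) (\<lambda>i. D i \<omega>) (- T) (\<lambda>_. 0) (x \<omega> T)"
    and c: "c = (sqrt ((a 0)\<^sup>2 + a 0 * (\<Sum>j\<in>{j. 0 < a j} - {0}. a j)) - a 0)
                  / (\<Sum>j\<in>{j. 0 < a j} - {0}. a j)"
    and lam_less: "lam < 2 / 3 * ((1 + c) / (\<Sum>j | 0 < a j. a j))"
  shows "(\<integral>\<^sup>+ \<omega>. (ennreal_of_enat (limit_state (x \<omega>) 0 0))\<^sup>2 \<partial>M) < \<infinity>"
proof -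
  interpret prob_space M by (rule M)
  interpret driving_noise M lam "a 0" A D
    by unfold_locales (use driving lam_pos interference in \<open>auto simp: interference_sequence_def\<close>)
  have subcritical: "lam * (\<Sum>j | 0 < a j. a j) < 1"
    by (rule interference_load_bound[OF interference lam_pos c lam_less])
  obtain C where C: "\<forall>N. \<exists>Z G. G \<in> events \<and> prob (space M - G) \<le> (1 / 2) ^ N \<and>
    integrable M (\<lambda>\<omega>. (real (Z \<omega>))\<^sup>2) \<and> expectation (\<lambda>\<omega>. (real (Z \<omega>))\<^sup>2) \<le> C \<and>
    (\<forall>\<omega>\<in>G. \<forall>x. (\<forall>T\<ge>0. queue_evolution a (\<lambda>i. A i \<omega>) (\<lambda>i. D i \<omega>) (- T) (\<lambda>_. 0) (x T)) \<longrightarrow>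
       x (real (Suc N)) 0 0 = (Z \<omega> :: nat) \<and>
       (\<forall>T T'. 0 \<le> T \<and> T \<le> T' \<and> T' \<le> real (Suc N) \<longrightarrow> x T 0 0 \<le> x T' 0 0))"
    using ex_uniform_approximation[OF interference refl subcritical] by (elim exE)
  then obtain Z G where ZG: "\<forall>N. G N \<in> events \<and> prob (space M - G N) \<le> (1 / 2) ^ N \<and>
    integrable M (\<lambda>\<omega>. (real (Z N \<omega>))\<^sup>2) \<and> expectation (\<lambda>\<omega>. (real (Z N \<omega>))\<^sup>2) \<le> C \<and>
    (\<forall>\<omega>\<in>G N. \<forall>x. (\<forall>T\<ge>0. queue_evolution a (\<lambda>i. A i \<omega>) (\<lambda>i. D i \<omega>) (- T) (\<lambda>_. 0) (x T)) \<longrightarrow>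
       x (real (Suc N)) 0 0 = (Z N \<omega> :: nat) \<and>
       (\<forall>T T'. 0 \<le> T \<and> T \<le> T' \<and> T' \<le> real (Suc N) \<longrightarrow> x T 0 0 \<le> x T' 0 0))"
    by (simp only: choice_iff) (elim exE)
  have G: "G N \<in> events" "prob (space M - G N) \<le> (1 / 2) ^ N"
    and Z: "integrable M (\<lambda>\<omega>. (real (Z N \<omega>))\<^sup>2)" "expectation (\<lambda>\<omega>. (real (Z N \<omega>))\<^sup>2) \<le> C" for N
    using ZG by blast+
  have ZG': "x (real (Suc N)) 0 0 = Z N \<omega>"
      "\<And>T T'. 0 \<le> T \<Longrightarrow> T \<le> T' \<Longrightarrow> T' \<le> real (Suc N) \<Longrightarrow> x T 0 0 \<le> x T' 0 0"
    if "\<omega> \<in> G N" "\<forall>T\<ge>0. queue_evolution a (\<lambda>i. A i \<omega>) (\<lambda>i. D i \<omega>) (- T) (\<lambda>_. 0) (x T)" for N \<omega> x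
    using ZG[rule_format, THEN conjunct2, THEN conjunct2, THEN conjunct2, THEN conjunct2,
        rule_format, OF that(1), of x] that(2) by simp_all
  \<comment> \<open>Almost surely all but finitely many horizons are good.\<close>
  have BC: "AE \<omega> in M. eventually (\<lambda>N. \<omega> \<in> space M - (space M - G N)) sequentially"
  proof (rule borel_cantelli_AE1)
    show "space M - G N \<in> events" for N using G(1) by auto
    show "summable (\<lambda>N. prob (space M - G N))"
      by (rule summable_comparison_test'[of "\<lambda>N. (1 / 2) ^ N" 0]) (auto intro: G(2))
  qed (simp add: emeasure_eq_measure)
  let ?u = "\<lambda>N \<omega>. ennreal ((real (Z N \<omega>))\<^sup>2)"
  have "AE \<omega> in M. (ennreal_of_enat (limit_state (x \<omega>) 0 0))\<^sup>2 \<le> liminf (\<lambda>N. ?u N \<omega>)"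
    using BC dynamics
  proof eventually_elim
    case (elim \<omega>)
    then have ev: "eventually (\<lambda>N. \<omega> \<in> G N) sequentially" by (auto elim: eventually_mono)
    let ?L = "limit_state (x \<omega>) 0 0"
    \<comment> \<open>Each good horizon gives monotonicity up to that horizon, and arbitrarily large
      ones are good.\<close>
    have mono: "x \<omega> T 0 0 \<le> x \<omega> T' 0 0" if T: "0 \<le> T" "T \<le> T'" for T T'
    proof -
      obtain N0 where N0: "T' \<le> real N0" using real_arch_simple by blast
      from ev eventually_ge_at_top[of N0] have "eventually (\<lambda>N. \<omega> \<in> G N \<and> N0 \<le> N) sequentially"
        by eventually_elim auto
      then obtain N where "\<omega> \<in> G N" "N0 \<le> N" by (auto simp: eventually_sequentially)
      then show ?thesis using ZG'(2)[OF _ elim(2) T, of N] N0 by simp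
    qed
    have "((\<lambda>T. enat (x \<omega> T 0 0)) \<longlongrightarrow> ?L) at_top"
      by (rule mono_limit_state) (rule mono)
    moreover have "filterlim (\<lambda>N. real (Suc N)) at_top sequentially"
      using filterlim_compose[OF filterlim_real_sequentially filterlim_Suc] by simp
    ultimately have "(\<lambda>N. enat (x \<omega> (real (Suc N)) 0 0)) \<longlonglongrightarrow> ?L"
      by (rule filterlim_compose)
    then have "(\<lambda>N. ennreal_of_enat (enat (x \<omega> (real (Suc N)) 0 0))) \<longlonglongrightarrow> ennreal_of_enat ?L"
      by (rule isCont_tendsto_compose[OF isCont_ennreal_of_enat])
    moreover have "eventually (\<lambda>N. ennreal_of_enat (enat (x \<omega> (real (Suc N)) 0 0)) = of_nat (Z N \<omega>)) sequentially"
      using ev by eventually_elim (simp add: ZG'(1)[OF _ elim(2)] del: of_nat_Suc)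
    ultimately have "(\<lambda>N. of_nat (Z N \<omega>) :: ennreal) \<longlonglongrightarrow> ennreal_of_enat ?L"
      by (rule Lim_transform_eventually)
    from tendsto_mult_ennreal[OF this this]
    have "(\<lambda>N. of_nat (Z N \<omega>) * of_nat (Z N \<omega>) :: ennreal) \<longlonglongrightarrow> ennreal_of_enat ?L * ennreal_of_enat ?L"
      by auto
    moreover have "?u N \<omega> = of_nat (Z N \<omega>) * of_nat (Z N \<omega>)" for N
      by (simp add: power2_eq_square ennreal_mult ennreal_of_nat_eq_real_of_nat)
    ultimately have "(\<lambda>N. ?u N \<omega>) \<longlonglongrightarrow> (ennreal_of_enat ?L)\<^sup>2"
      by (simp add: power2_eq_square)
    then have "liminf (\<lambda>N. ?u N \<omega>) = (ennreal_of_enat ?L)\<^sup>2"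
      by (intro lim_imp_Liminf) auto
    then show ?case by simp
  qed
  \<comment> \<open>No measurability of \<open>x\<close> is at hand. The integral is carried by the
    almost sure bound through the \<open>Z N\<close>, which are functions of the chain and hence
    measurable, so Fatou's lemma applies to them.\<close>
  then have "(\<integral>\<^sup>+ \<omega>. (ennreal_of_enat (limit_state (x \<omega>) 0 0))\<^sup>2 \<partial>M) \<le> (\<integral>\<^sup>+ \<omega>. liminf (\<lambda>N. ?u N \<omega>) \<partial>M)"
    by (rule nn_integral_mono_AE)
  also have "\<dots> \<le> liminf (\<lambda>N. \<integral>\<^sup>+ \<omega>. ?u N \<omega> \<partial>M)"
    using Z(1) by (intro nn_integral_liminf) (auto dest: borel_measurable_integrable)
  also have "\<dots> \<le> liminf (\<lambda>N. ennreal C)"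
  proof (intro Liminf_mono always_eventually allI)
    fix N
    have "(\<integral>\<^sup>+ \<omega>. ?u N \<omega> \<partial>M) = ennreal (expectation (\<lambda>\<omega>. (real (Z N \<omega>))\<^sup>2))"
      by (rule nn_integral_eq_integral[OF Z(1)]) simp
    then show "(\<integral>\<^sup>+ \<omega>. ?u N \<omega> \<partial>M) \<le> ennreal C" using Z(2) by (simp add: ennreal_leI)
  qed
  also have "\<dots> < \<infinity>" by (simp add: Liminf_const)
  finally show ?thesis .
qed

end
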